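(* Let $(M,g)$ be a Riemannian manifold with Levi-Civita connection $\nabla$ and curvature tensor $\mathfrak R$, and let $m_1,m_2,m_3\in\mathbb{R}$ satisfy $m_1>0$, $m_3>0$, $m_1m_3-m_2^2>0$. Equip $TM$ with the Riemannian metric $\bar g$ determined by $$\bar g_{(p,u)}(X^{\bar h},Y^{\bar h})=m_1g_p(X,Y),\quad \bar g_{(p,u)}(X^{\bar h},Y^{\bar v})=m_2g_p(X,Y),\quad \bar g_{(p,u)}(X^{\bar v},Y^{\bar v})=m_3g_p(X,Y),$$ where $X^{\bar h},X^{\bar v}$ are the horizontal and vertical lifts of $X$, and let $\bar\nabla$ be the Levi-Civita connection of $(TM,\bar g)$. Then for all vector fields $X,Y$ on $M$ and all $(p,u)\in TM$, at the point $(p,u)$ (with $\nabla$ and $\mathfrak R$ evaluated at $p$): (i) $d\pi(\bar\nabla_{X^{\bar h}}Y^{\bar h})=\nabla_XY+\frac{1}{m_1m_3-m_2^2}\left(m_2m_3\mathfrak R(u,X)Y+\frac{m_2m_3}{2}\mathfrak R(X,Y)u\right)$; (ii) $K(\bar\nabla_{X^{\bar h}}Y^{\bar h})=\frac{1}{m_1m_3-m_2^2}\left(-m_2^2\mathfrak R(u,X)Y-\frac{m_1m_3}{2}\mathfrak R(X,Y)u\right)$; (iii) $d\pi(\bar\nabla_{X^{\bar h}}Y^{\bar v})=\frac{1}{m_1m_3-m_2^2}\left(\frac{m_3^2}{2}\mathfrak R(u,Y)X\right)$; (iv) $K(\bar\nabla_{X^{\bar h}}Y^{\bar v})=\nabla_XY-\frac{1}{m_1m_3-m_2^2}\left(\frac{m_2m_3}{2}\mathfrak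 R(u,Y)X\right)$; (v) $d\pi(\bar\nabla_{X^{\bar v}}Y^{\bar h})=\frac{1}{m_1m_3-m_2^2}\left(\frac{m_3^2}{2}\mathfrak R(u,X)Y\right)$; (vi) $K(\bar\nabla_{X^{\bar v}}Y^{\bar h})=-\frac{1}{m_1m_3-m_2^2}\left(\frac{m_2m_3}{2}\mathfrak R(u,X)Y\right)$; (vii) $d\pi(\bar\nabla_{X^{\bar v}}Y^{\bar v})=0$; (viii) $K(\bar\nabla_{X^{\bar v}}Y^{\bar v})=0$.
   Context: $(M,g)$ is an $n$-dimensional Riemannian manifold and $\pi:TM\to M$ is the bundle projection; points of $TM$ are pairs $(p,u)$ with $p\in M$, $u\in T_pM$. The connection map $K_{(p,u)}:T_{(p,u)}TM\to T_pM$ of $\nabla$ is $K(\bar X)=d(\exp_p\circ R_{-u}\circ\tau)(\bar X)$, where, for a normal neighborhood $U$ of $p$, $\tau:\pi^{-1}(U)\to T_pM$ is parallel transport of each $Y\in\pi^{-1}(U)$ from $\pi(Y)$ to $p$ (along the geodesic in $U$), and $R_{-u}:T_pM\to T_pM$, $R_{-u}(X)=X-u$; equivalently, $K(dZ(X))=\nabla_XZ$ for a vector field $Z:M\to TM$. One has $T_{(p,u)}TM=\mathcal H_{(p,u)}\oplus\mathcal V_{(p,u)}$ with $\mathcal H=\ker K$, $\mathcal V=\ker d\pi$. For a vector field $X$ on $M$, the horizontal lift $X^{\bar h}$ and vertical lift $X^{\bar v}$ are the unique vector fields on $TM$ with $d\pi(X^{\bar h})_{(p,u)}=X_p$, $K(X^{\bar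 h})_{(p,u)}=0$, and $d\pi(X^{\bar v})_{(p,u)}=0$, $K(X^{\bar v})_{(p,u)}=X_p$. Curvature sign convention: $\mathfrak R(X,Y)Z=\nabla_X\nabla_YZ-\nabla_Y\nabla_XZ-\nabla_{[X,Y]}Z$; this is the convention for which the Lie bracket on $TM$ satisfies $[X^{\bar h},Y^{\bar h}]_{(p,u)}=([X,Y])^{\bar h}_{(p,u)}-(\mathfrak R(X,Y)u)^{\bar v}_{(p,u)}$. *)

theory Defs
  imports "HOL-Analysis.Analysis" "HOL-Library.Function_Algebras"
begin

instantiation "fun" :: (type, real_vector) real_vector
begin

definition scaleR_fun :: "real \<Rightarrow> ('a \<Rightarrow> 'b) \<Rightarrow> 'a \<Rightarrow> 'b" where
  "scaleR_fun r f = (\<lambda>x. r *\<^sub>R f x)"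

instance
  by standard (auto simp: scaleR_fun_def fun_eq_iff scaleR_add_right scaleR_add_left)

end


section \<open>Smooth manifolds\<close>

(* C^k on an open subset of a Euclidean space *)
primrec Ck_on :: "nat \<Rightarrow> ('e::euclidean_space \<Rightarrow> 'f::real_normed_vector) \<Rightarrow> 'e set \<Rightarrow> bool" where
  "Ck_on 0 f S \<longleftrightarrow> continuous_on S f"
| "Ck_on (Suc k) f S \<longleftrightarrow>
     (\<forall>x\<in>S. f differentiable (at x)) \<and> (\<forall>v. Ck_on k (\<lambda>x. frechet_derivative f (at x) v) S)"

definition smooth_on :: "'e::euclidean_space set \<Rightarrow> ('e \<Rightarrow> 'f::real_normed_vector) \<Rightarrow> bool" where
  "smooth_on S f \<longleftrightarrow> (\<forall>k. Ck_on k f S)"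

text \<open>
  A chart is a domain together with a coordinate map; the values of the map outside the domain
  are irrelevant.  A manifold of dimension DIM('e) is given by a smooth atlas, which determines
  both the underlying set and the topology.
\<close>

type_synonym ('a, 'e) chart = "'a set \<times> ('a \<Rightarrow> 'e)"

definition chart_inv :: "('a, 'e) chart \<Rightarrow> 'e \<Rightarrow> 'a" where
  "chart_inv c = inv_into (fst c) (snd c)"

definition carrier :: "('a, 'e) chart set \<Rightarrow> 'a set" where
  "carrier A = \<Union> (fst ` A)"

definition chart_at :: "('a, 'e) chart set \<Rightarrow> 'a \<Rightarrow> ('a, 'e) chart" where
  "chart_at A p = (SOME c. c \<in> A \<and> p \<in> fst c)"

definition smooth_atlas :: "('a, 'e::euclidean_space) chart set \<Rightarrow> bool" where
  "smooth_atlas A \<longleftrightarrow>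
     (\<forall>c\<in>A. inj_on (snd c) (fst c) \<and> open (snd c ` fst c)) \<and>
     (\<forall>c\<in>A. \<forall>d\<in>A. open (snd c ` (fst c \<inter> fst d)) \<and>
        smooth_on (snd c ` (fst c \<inter> fst d)) (snd d \<circ> chart_inv c))"

definition manifold_topology :: "('a, 'e::euclidean_space) chart set \<Rightarrow> 'a topology" where
  "manifold_topology A =
     topology (\<lambda>S. S \<subseteq> carrier A \<and> (\<forall>c\<in>A. open (snd c ` (fst c \<inter> S))))"

definition smooth_manifold :: "('a, 'e::euclidean_space) chart set \<Rightarrow> bool" where
  "smooth_manifold A \<longleftrightarrow> smooth_atlas A \<and>
     Hausdorff_space (manifold_topology A) \<and> second_countable (manifold_topology A)"

definition smooth_function ::
  "('a, 'e::euclidean_space) chart set \<Rightarrow> 'a set \<Rightarrow> ('a \<Rightarrow> real) \<Rightarrow> bool" where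
  "smooth_function A W f \<longleftrightarrow> (\<forall>c\<in>A. smooth_on (snd c ` (fst c \<inter> W)) (f \<circ> chart_inv c))"

definition smooth_map :: "('a, 'e::euclidean_space) chart set \<Rightarrow>
    ('b, 'f::euclidean_space) chart set \<Rightarrow> 'a set \<Rightarrow> ('a \<Rightarrow> 'b) \<Rightarrow> bool" where
  "smooth_map A B W f \<longleftrightarrow> f ` W \<subseteq> carrier B \<and>
     (\<forall>c\<in>A. \<forall>d\<in>B. open (snd c ` (fst c \<inter> W \<inter> f -` fst d)) \<and>
        smooth_on (snd c ` (fst c \<inter> W \<inter> f -` fst d)) (snd d \<circ> f \<circ> chart_inv c))"

definition diffeomorphism :: "('a, 'e::euclidean_space) chart set \<Rightarrow>
    ('b, 'f::euclidean_space) chart set \<Rightarrow> 'a set \<Rightarrow> 'b set \<Rightarrow> ('a \<Rightarrow> 'b) \<Rightarrow> bool" where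
  "diffeomorphism A B V U f \<longleftrightarrow>
     bij_betw f V U \<and> smooth_map A B V f \<and> smooth_map B A U (inv_into V f)"


section \<open>Tangent vectors and the tangent bundle\<close>

text \<open>
  A tangent vector at p is an equivalence class of pairs (chart around p, coordinate vector) under
  the derivative of the chart transition.  Each class is the graph of a function assigning to
  every chart around p the coordinate vector in that chart, and it is encoded by this
  function, extended by 0 to all other charts.  The vector space operations are pointwise.
\<close>

type_synonym ('a, 'e) tvec = "('a, 'e) chart \<Rightarrow> 'e"

definition tangent_space ::
  "('a, 'e::euclidean_space) chart set \<Rightarrow> 'a \<Rightarrow> ('a, 'e) tvec set" where
  "tangent_space A p =
     {v. (\<forall>c. c \<notin> A \<or> p \<notin> fst c \<longrightarrow> v c = 0) \<and>
         (\<forall>c\<in>A. \<forall>d\<in>A. p \<in> fst c \<inter> fst d \<longrightarrow>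
            v d = frechet_derivative (snd d \<circ> chart_inv c) (at (snd c p)) (v c))}"

definition tangent_space_atlas ::
  "('a, 'e::euclidean_space) chart set \<Rightarrow> 'a \<Rightarrow> (('a, 'e) tvec, 'e) chart set" where
  "tangent_space_atlas A p = {(tangent_space A p, \<lambda>v. v c) | c. c \<in> A \<and> p \<in> fst c}"

definition tangent_bundle :: "('a, 'e::euclidean_space) chart set \<Rightarrow>
    ('a \<times> ('a, 'e) tvec, 'e \<times> 'e) chart set" where
  "tangent_bundle A =
     (\<lambda>c. ({(p, v). p \<in> fst c \<and> v \<in> tangent_space A p}, \<lambda>(p, v). (snd c p, v c))) ` A"

definition differential :: "('a, 'e::euclidean_space) chart set \<Rightarrow>
    ('b, 'f::euclidean_space) chart set \<Rightarrow> ('a \<Rightarrow> 'b) \<Rightarrow> 'a \<Rightarrow> ('a, 'e) tvec \<Rightarrow> ('b, 'f) tvec" where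
  "differential A B f p v =
     (let c = chart_at A p in
      (\<lambda>d. if d \<in> B \<and> f p \<in> fst d
           then frechet_derivative (snd d \<circ> f \<circ> chart_inv c) (at (snd c p)) (v c) else 0))"

definition directional_derivative :: "('a, 'e::euclidean_space) chart set \<Rightarrow>
    'a \<Rightarrow> ('a, 'e) tvec \<Rightarrow> ('a \<Rightarrow> real) \<Rightarrow> real" where
  "directional_derivative A p v f =
     (let c = chart_at A p in frechet_derivative (f \<circ> chart_inv c) (at (snd c p)) (v c))"

type_synonym ('a, 'e) vfield = "'a \<Rightarrow> ('a, 'e) tvec"

definition smooth_vector_field ::
  "('a, 'e::euclidean_space) chart set \<Rightarrow> 'a set \<Rightarrow> ('a, 'e) vfield \<Rightarrow> bool" where
  "smooth_vector_field A W X \<longleftrightarrow>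
     (\<forall>p\<in>W. X p \<in> tangent_space A p) \<and>
     (\<forall>c\<in>A. smooth_on (snd c ` (fst c \<inter> W)) (\<lambda>x. X (chart_inv c x) c))"

definition lie_bracket :: "('a, 'e::euclidean_space) chart set \<Rightarrow>
    ('a, 'e) vfield \<Rightarrow> ('a, 'e) vfield \<Rightarrow> ('a, 'e) vfield" where
  "lie_bracket A X Y = (\<lambda>p c. if c \<in> A \<and> p \<in> fst c
     then frechet_derivative (\<lambda>x. Y (chart_inv c x) c) (at (snd c p)) (X p c) -
          frechet_derivative (\<lambda>x. X (chart_inv c x) c) (at (snd c p)) (Y p c)
     else 0)"


section \<open>Riemannian metrics and the Levi-Civita connection\<close>

type_synonym ('a, 'e) metric = "'a \<Rightarrow> ('a, 'e) tvec \<Rightarrow> ('a, 'e) tvec \<Rightarrow> real"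

definition riemannian_metric ::
  "('a, 'e::euclidean_space) chart set \<Rightarrow> ('a, 'e) metric \<Rightarrow> bool" where
  "riemannian_metric A g \<longleftrightarrow>
     (\<forall>p\<in>carrier A. \<forall>x\<in>tangent_space A p. \<forall>y\<in>tangent_space A p. \<forall>z\<in>tangent_space A p. \<forall>r.
        g p x y = g p y x \<and>
        g p (x + y) z = g p x z + g p y z \<and>
        g p (r *\<^sub>R x) y = r * g p x y \<and>
        (x \<noteq> 0 \<longrightarrow> g p x x > 0)) \<and>
     (\<forall>W X Y. openin (manifold_topology A) W \<longrightarrow>
        smooth_vector_field A W X \<longrightarrow> smooth_vector_field A W Y \<longrightarrow>
        smooth_function A W (\<lambda>p. g p (X p) (Y p)))"

type_synonym ('a, 'e) connection = "('a, 'e) vfield \<Rightarrow> ('a, 'e) vfield \<Rightarrow> ('a, 'e) vfield"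

text \<open>
  The operator nab X Y is the covariant derivative of Y along X.  It acts on vector fields on
  arbitrary open sets W.  Since vector fields are total functions with unspecified values outside
  W, the second clause says that the result on W depends only on the fields on W.
\<close>

definition affine_connection ::
  "('a, 'e::euclidean_space) chart set \<Rightarrow> ('a, 'e) connection \<Rightarrow> bool" where
  "affine_connection A nab \<longleftrightarrow>
     (\<forall>W X X' Y Y' f. openin (manifold_topology A) W \<longrightarrow>
        smooth_vector_field A W X \<longrightarrow> smooth_vector_field A W X' \<longrightarrow>
        smooth_vector_field A W Y \<longrightarrow> smooth_vector_field A W Y' \<longrightarrow>
        smooth_function A W f \<longrightarrow>
          smooth_vector_field A W (nab X Y) \<and>
          ((\<forall>p\<in>W. X p = X' p \<and> Y p = Y' p) \<longrightarrow> (\<forall>p\<in>W. nab X Y p = nab X' Y' p)) \<and>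
          (\<forall>p\<in>W. nab (X + X') Y p = nab X Y p + nab X' Y p) \<and>
          (\<forall>p\<in>W. nab (\<lambda>q. f q *\<^sub>R X q) Y p = f p *\<^sub>R nab X Y p) \<and>
          (\<forall>p\<in>W. nab X (Y + Y') p = nab X Y p + nab X Y' p) \<and>
          (\<forall>p\<in>W. nab X (\<lambda>q. f q *\<^sub>R Y q) p =
                 directional_derivative A p (X p) f *\<^sub>R Y p + f p *\<^sub>R nab X Y p))"

definition levi_civita_connection ::
  "('a, 'e::euclidean_space) chart set \<Rightarrow> ('a, 'e) metric \<Rightarrow> ('a, 'e) connection \<Rightarrow> bool" where
  "levi_civita_connection A g nab \<longleftrightarrow> affine_connection A nab \<and>
     (\<forall>W X Y Z. openin (manifold_topology A) W \<longrightarrow>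
        smooth_vector_field A W X \<longrightarrow> smooth_vector_field A W Y \<longrightarrow>
        smooth_vector_field A W Z \<longrightarrow>
          (\<forall>p\<in>W. nab X Y p - nab Y X p = lie_bracket A X Y p) \<and>
          (\<forall>p\<in>W. directional_derivative A p (X p) (\<lambda>q. g q (Y q) (Z q)) =
                 g p (nab X Y p) (Z p) + g p (Y p) (nab X Z p)))"

definition curvature_field :: "('a, 'e::euclidean_space) chart set \<Rightarrow> ('a, 'e) connection \<Rightarrow>
    ('a, 'e) vfield \<Rightarrow> ('a, 'e) vfield \<Rightarrow> ('a, 'e) vfield \<Rightarrow> ('a, 'e) vfield" where
  "curvature_field A nab X Y Z =
     nab X (nab Y Z) - nab Y (nab X Z) - nab (lie_bracket A X Y) Z"

(* The value at p of the curvature tensor on tangent vectors: the common value of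
   curvature_field at p over all extensions of x, y, z to vector fields near p. *)
definition curvature :: "('a, 'e::euclidean_space) chart set \<Rightarrow> ('a, 'e) connection \<Rightarrow>
    'a \<Rightarrow> ('a, 'e) tvec \<Rightarrow> ('a, 'e) tvec \<Rightarrow> ('a, 'e) tvec \<Rightarrow> ('a, 'e) tvec" where
  "curvature A nab p x y z =
     (THE w. \<exists>W X Y Z. openin (manifold_topology A) W \<and> p \<in> W \<and>
        smooth_vector_field A W X \<and> smooth_vector_field A W Y \<and> smooth_vector_field A W Z \<and>
        X p = x \<and> Y p = y \<and> Z p = z \<and> w = curvature_field A nab X Y Z p)"


section \<open>Geodesics, parallel transport and the exponential map\<close>

(* the vector field on the domain of c with constant coordinates v in the chart c *)
definition coordinate_field ::
  "('a, 'e::euclidean_space) chart set \<Rightarrow> ('a, 'e) chart \<Rightarrow> 'e \<Rightarrow> ('a, 'e) vfield" where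
  "coordinate_field A c v = (\<lambda>p d. if d \<in> A \<and> p \<in> fst c \<inter> fst d
     then frechet_derivative (snd d \<circ> chart_inv c) (at (snd c p)) v else 0)"

definition christoffel :: "('a, 'e::euclidean_space) chart set \<Rightarrow> ('a, 'e) connection \<Rightarrow>
    ('a, 'e) chart \<Rightarrow> 'a \<Rightarrow> 'e \<Rightarrow> 'e \<Rightarrow> 'e" where
  "christoffel A nab c p v w = nab (coordinate_field A c v) (coordinate_field A c w) p c"

definition differentiable_curve ::
  "('a, 'e::euclidean_space) chart set \<Rightarrow> real set \<Rightarrow> (real \<Rightarrow> 'a) \<Rightarrow> bool" where
  "differentiable_curve A I \<gamma> \<longleftrightarrow>
     continuous_map (top_of_set I) (manifold_topology A) \<gamma> \<and>
     (\<forall>t\<in>I. \<forall>c\<in>A. \<gamma> t \<in> fst c \<longrightarrow> (snd c \<circ> \<gamma>) differentiable (at t within I))"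

definition velocity ::
  "('a, 'e::euclidean_space) chart set \<Rightarrow> real set \<Rightarrow> (real \<Rightarrow> 'a) \<Rightarrow> real \<Rightarrow> ('a, 'e) tvec" where
  "velocity A I \<gamma> t = (\<lambda>c. if c \<in> A \<and> \<gamma> t \<in> fst c
     then vector_derivative (snd c \<circ> \<gamma>) (at t within I) else 0)"

(* V is a vector field along the curve \<gamma> whose covariant derivative along \<gamma> vanishes *)
definition parallel_along :: "('a, 'e::euclidean_space) chart set \<Rightarrow> ('a, 'e) connection \<Rightarrow>
    real set \<Rightarrow> (real \<Rightarrow> 'a) \<Rightarrow> (real \<Rightarrow> ('a, 'e) tvec) \<Rightarrow> bool" where
  "parallel_along A nab I \<gamma> V \<longleftrightarrow>
     differentiable_curve A I \<gamma> \<and>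
     (\<forall>t\<in>I. V t \<in> tangent_space A (\<gamma> t)) \<and>
     (\<forall>t\<in>I. \<forall>c\<in>A. \<gamma> t \<in> fst c \<longrightarrow>
        ((\<lambda>s. V s c) has_vector_derivative
           - christoffel A nab c (\<gamma> t) (velocity A I \<gamma> t c) (V t c)) (at t within I))"

definition parallel_transport :: "('a, 'e::euclidean_space) chart set \<Rightarrow> ('a, 'e) connection \<Rightarrow>
    (real \<Rightarrow> 'a) \<Rightarrow> ('a, 'e) tvec \<Rightarrow> ('a, 'e) tvec" where
  "parallel_transport A nab \<gamma> v =
     (THE w. \<exists>V. parallel_along A nab {0..1} \<gamma> V \<and> V 0 = v \<and> V 1 = w)"

definition geodesic_from :: "('a, 'e::euclidean_space) chart set \<Rightarrow> ('a, 'e) connection \<Rightarrow>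
    'a \<Rightarrow> ('a, 'e) tvec \<Rightarrow> (real \<Rightarrow> 'a) \<Rightarrow> bool" where
  "geodesic_from A nab p v \<gamma> \<longleftrightarrow>
     parallel_along A nab {0..1} \<gamma> (velocity A {0..1} \<gamma>) \<and>
     \<gamma> 0 = p \<and> velocity A {0..1} \<gamma> 0 = v"

definition exp_domain :: "('a, 'e::euclidean_space) chart set \<Rightarrow> ('a, 'e) connection \<Rightarrow>
    'a \<Rightarrow> ('a, 'e) tvec set" where
  "exp_domain A nab p = {v \<in> tangent_space A p. \<exists>\<gamma>. geodesic_from A nab p v \<gamma>}"

definition exp_map :: "('a, 'e::euclidean_space) chart set \<Rightarrow> ('a, 'e) connection \<Rightarrow>
    'a \<Rightarrow> ('a, 'e) tvec \<Rightarrow> 'a" where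
  "exp_map A nab p v = (THE q. \<exists>\<gamma>. geodesic_from A nab p v \<gamma> \<and> \<gamma> 1 = q)"

(* U is a normal neighbourhood of p, the diffeomorphic image under exp_p of the star-shaped V *)
definition normal_neighbourhood :: "('a, 'e::euclidean_space) chart set \<Rightarrow>
    ('a, 'e) connection \<Rightarrow> 'a \<Rightarrow> ('a, 'e) tvec set \<Rightarrow> 'a set \<Rightarrow> bool" where
  "normal_neighbourhood A nab p V U \<longleftrightarrow>
     V \<subseteq> exp_domain A nab p \<and>
     openin (manifold_topology (tangent_space_atlas A p)) V \<and>
     0 \<in> V \<and> (\<forall>v\<in>V. \<forall>t\<in>{0..1}. t *\<^sub>R v \<in> V) \<and>
     openin (manifold_topology A) U \<and> p \<in> U \<and>
     diffeomorphism (tangent_space_atlas A p) A V U (exp_map A nab p)"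


section \<open>The connection map and the lifts\<close>

(* Parallel transport of (q, y), q in U, to p along the geodesic in U from q to p, i.e. along the
   reversed radial geodesic. *)
definition transport_to :: "('a, 'e::euclidean_space) chart set \<Rightarrow> ('a, 'e) connection \<Rightarrow>
    'a \<Rightarrow> ('a, 'e) tvec set \<Rightarrow> 'a \<times> ('a, 'e) tvec \<Rightarrow> ('a, 'e) tvec" where
  "transport_to A nab p V = (\<lambda>(q, y). parallel_transport A nab
     (\<lambda>t. exp_map A nab p ((1 - t) *\<^sub>R inv_into V (exp_map A nab p) q)) y)"

(* K at (p, u) is the differential of exp_p o R_(-u) o tau, for some normal neighbourhood of p. *)
definition connection_map :: "('a, 'e::euclidean_space) chart set \<Rightarrow> ('a, 'e) connection \<Rightarrow>
    ('a \<times> ('a, 'e) tvec \<Rightarrow> ('a \<times> ('a, 'e) tvec, 'e \<times> 'e) tvec \<Rightarrow> ('a, 'e) tvec) \<Rightarrow> bool" where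
  "connection_map A nab K \<longleftrightarrow>
     (\<forall>p u. (p, u) \<in> carrier (tangent_bundle A) \<longrightarrow>
        (\<exists>V U. normal_neighbourhood A nab p V U \<and>
           (\<forall>\<xi> \<in> tangent_space (tangent_bundle A) (p, u).
              K (p, u) \<xi> = differential (tangent_bundle A) A
                (exp_map A nab p \<circ> (\<lambda>y. y - u) \<circ> transport_to A nab p V) (p, u) \<xi>)))"

definition d_proj :: "('a, 'e::euclidean_space) chart set \<Rightarrow> 'a \<times> ('a, 'e) tvec \<Rightarrow>
    ('a \<times> ('a, 'e) tvec, 'e \<times> 'e) tvec \<Rightarrow> ('a, 'e) tvec" where
  "d_proj A = differential (tangent_bundle A) A fst"

definition horizontal_lift_at :: "('a, 'e::euclidean_space) chart set \<Rightarrow>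
    ('a \<times> ('a, 'e) tvec \<Rightarrow> ('a \<times> ('a, 'e) tvec, 'e \<times> 'e) tvec \<Rightarrow> ('a, 'e) tvec) \<Rightarrow>
    'a \<times> ('a, 'e) tvec \<Rightarrow> ('a, 'e) tvec \<Rightarrow> ('a \<times> ('a, 'e) tvec, 'e \<times> 'e) tvec" where
  "horizontal_lift_at A K P x =
     (THE \<xi>. \<xi> \<in> tangent_space (tangent_bundle A) P \<and> d_proj A P \<xi> = x \<and> K P \<xi> = 0)"

definition vertical_lift_at :: "('a, 'e::euclidean_space) chart set \<Rightarrow>
    ('a \<times> ('a, 'e) tvec \<Rightarrow> ('a \<times> ('a, 'e) tvec, 'e \<times> 'e) tvec \<Rightarrow> ('a, 'e) tvec) \<Rightarrow>
    'a \<times> ('a, 'e) tvec \<Rightarrow> ('a, 'e) tvec \<Rightarrow> ('a \<times> ('a, 'e) tvec, 'e \<times> 'e) tvec" where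
  "vertical_lift_at A K P x =
     (THE \<xi>. \<xi> \<in> tangent_space (tangent_bundle A) P \<and> d_proj A P \<xi> = 0 \<and> K P \<xi> = x)"

definition horizontal_lift :: "('a, 'e::euclidean_space) chart set \<Rightarrow>
    ('a \<times> ('a, 'e) tvec \<Rightarrow> ('a \<times> ('a, 'e) tvec, 'e \<times> 'e) tvec \<Rightarrow> ('a, 'e) tvec) \<Rightarrow>
    ('a, 'e) vfield \<Rightarrow> ('a \<times> ('a, 'e) tvec, 'e \<times> 'e) vfield" where
  "horizontal_lift A K X = (\<lambda>P. horizontal_lift_at A K P (X (fst P)))"

definition vertical_lift :: "('a, 'e::euclidean_space) chart set \<Rightarrow>
    ('a \<times> ('a, 'e) tvec \<Rightarrow> ('a \<times> ('a, 'e) tvec, 'e \<times> 'e) tvec \<Rightarrow> ('a, 'e) tvec) \<Rightarrow>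
    ('a, 'e) vfield \<Rightarrow> ('a \<times> ('a, 'e) tvec, 'e \<times> 'e) vfield" where
  "vertical_lift A K X = (\<lambda>P. vertical_lift_at A K P (X (fst P)))"

(* The condition relating the metric gbar on TM to the metric g on M.  The values of the lifts
   at (p, u) depend only on X p, so it is stated for tangent vectors x, y at p. *)
definition lift_metric :: "('a, 'e::euclidean_space) chart set \<Rightarrow> ('a, 'e) metric \<Rightarrow>
    ('a \<times> ('a, 'e) tvec \<Rightarrow> ('a \<times> ('a, 'e) tvec, 'e \<times> 'e) tvec \<Rightarrow> ('a, 'e) tvec) \<Rightarrow>
    real \<Rightarrow> real \<Rightarrow> real \<Rightarrow> ('a \<times> ('a, 'e) tvec, 'e \<times> 'e) metric \<Rightarrow> bool" where
  "lift_metric A g K m1 m2 m3 gbar \<longleftrightarrow>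
     (\<forall>p u. (p, u) \<in> carrier (tangent_bundle A) \<longrightarrow>
        (\<forall>x\<in>tangent_space A p. \<forall>y\<in>tangent_space A p.
           gbar (p, u) (horizontal_lift_at A K (p, u) x) (horizontal_lift_at A K (p, u) y)
             = m1 * g p x y \<and>
           gbar (p, u) (horizontal_lift_at A K (p, u) x) (vertical_lift_at A K (p, u) y)
             = m2 * g p x y \<and>
           gbar (p, u) (vertical_lift_at A K (p, u) x) (vertical_lift_at A K (p, u) y)
             = m3 * g p x y))"

end

theory Submission
  imports Defs
begin

text \<open>
  In a chart of \<open>M\<close> with Christoffel symbols \<open>\<Gamma>\<close>, the connection map is
  \<open>K (a, b) = b + \<Gamma>(a, u)\<close> on tangent vectors \<open>(a, b)\<close> of \<open>TM\<close> at \<open>(p, u)\<close>.  To see this, note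
  that parallel transport along the radial geodesics of a normal neighbourhood is the flow of a
  linear equation whose coefficients are small near \<open>p\<close>: the time-one map is differentiable at the
  centre, with the first Picard iterate as derivative, and \<open>d(exp\<^sub>p)\<close> at \<open>0\<close> is the identity.
  With this formula the lifts and their brackets are computed in charts,
  \<open>[X\<^sup>h, Y\<^sup>h] = [X, Y]\<^sup>h - (R(X, Y)u)\<^sup>v\<close>, \<open>[X\<^sup>h, Y\<^sup>v] = (\<nabla>\<^sub>X Y)\<^sup>v\<close> and \<open>[X\<^sup>v, Y\<^sup>v] = 0\<close>.
  The Koszul formula on \<open>TM\<close> then gives the inner products of the covariant derivatives of lifts with
  all horizontal and vertical lifts; the symmetries of the curvature tensor bring them into the
  stated form, and solving the linear system with matrix \<open>((m1, m2), (m2, m3))\<close> finishes the proof.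
\<close>


section \<open>Smooth maps between Euclidean spaces\<close>

text \<open>\<open>K\<close> is given only as the differential, at the single point
  \<open>(p, u)\<close>, of a composite containing parallel transport, so it is settled by a
  first-order estimate at that point; smoothness of \<open>exp_map\<close> and of its inverse comes
  with \<open>normal_neighbourhood\<close>. The neighbourhood may vary with the point, but the
  resulting formula does not mention it. Transport and \<open>exp_map\<close> are definite
  descriptions: existence and uniqueness of solutions must be established before either can be
  evaluated, and the Hausdorff property enters in the uniqueness of geodesics that leave a chart.
  Connections act on fields over every open set. The computations therefore take place over one
  chart domain \<open>fst c\<close>, where coordinate fields extend any given tangent vector. In the
  Koszul formula on \<open>TM\<close>, the functions \<open>gbar\<close> of two lifts are constant
  multiples of functions pulled back from \<open>M\<close>. Their vertical derivatives vanish, their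
  horizontal ones split by metric compatibility on \<open>M\<close>, and curvature enters only
  through the brackets of two horizontal lifts.\<close>

lemma frechet_derivative_eq: "(f has_derivative f') (at x) \<Longrightarrow> frechet_derivative f (at x) = f'"
  using frechet_derivative_at by metis

text \<open>On an open set equality of values is equality of germs, so the derivatives agree as well
  and the induction passes to them.\<close>

lemma Ck_on_cong:
  assumes "open S" "\<And>x. x \<in> S \<Longrightarrow> f x = g x" "Ck_on k f S"
  shows "Ck_on k g S"
  using assms(2,3)
proof (induction k arbitrary: f g)
  case 0
  then show ?case by (metis Ck_on.simps(1) continuous_on_cong)
next
  case (Suc k)
  have g: "(g has_derivative frechet_derivative f (at x)) (at x)" if "x \<in> S" for x
    using Suc.prems that assms(1) has_derivative_transform_within_open
    by (metis Ck_on.simps(2) frechet_derivative_works)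
  have "Ck_on k (\<lambda>x. frechet_derivative g (at x) v) S" for v
    by (rule Suc.IH[of "\<lambda>x. frechet_derivative f (at x) v"])
      (use Suc.prems(2) in \<open>auto simp: frechet_derivative_eq[OF g]\<close>)
  with g show ?case by (auto simp: differentiable_def)
qed

text \<open>Allows the derivative to be presented by any explicit \<open>f'\<close>, whereas the
  definition speaks of the selected \<open>frechet_derivative\<close>; the closure properties below
  reach the successor case through it.\<close>

lemma Ck_on_SucI:
  assumes "open S" "\<And>x. x \<in> S \<Longrightarrow> (f has_derivative f' x) (at x)"
    and "\<And>v. Ck_on k (\<lambda>x. f' x v) S"
  shows "Ck_on (Suc k) f S"
proof -
  have "Ck_on k (\<lambda>x. frechet_derivative f (at x) v) S" for v
    by (rule Ck_on_cong[OF assms(1) _ assms(3)[of v]]) (simp add: frechet_derivative_eq[OF assms(2)])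
  then show ?thesis using assms(2) by (auto simp: differentiable_def)
qed

lemma Ck_on_has_derivative:
  "Ck_on (Suc k) f S \<Longrightarrow> x \<in> S \<Longrightarrow> (f has_derivative frechet_derivative f (at x)) (at x)"
  by (simp add: frechet_derivative_works[symmetric])

lemma Ck_on_SucD: "Ck_on (Suc k) f S \<Longrightarrow> Ck_on k f S"
proof (induction k arbitrary: f)
  case 0
  then show ?case
    by (auto intro: continuous_at_imp_continuous_on differentiable_imp_continuous_within)
qed auto

lemma Ck_on_subset: "Ck_on k f S \<Longrightarrow> T \<subseteq> S \<Longrightarrow> Ck_on k f T"
  by (induction k arbitrary: f) (auto intro: continuous_on_subset)

lemma Ck_on_const:
  assumes "open S" shows "Ck_on k (\<lambda>x. c) S"
proof (induction k arbitrary: c)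
  case (Suc k)
  show ?case by (rule Ck_on_SucI[OF assms has_derivative_const Suc])
qed simp

lemma Ck_on_ident:
  assumes "open S" shows "Ck_on k (\<lambda>x. x) S"
proof (cases k)
  case (Suc n)
  then show ?thesis using Ck_on_SucI[OF assms has_derivative_ident Ck_on_const[OF assms]] by simp
qed simp

lemma Ck_on_bounded_linear:
  assumes "open S" "bounded_linear h" "Ck_on k f S"
  shows "Ck_on k (\<lambda>x. h (f x)) S"
  using assms(3)
proof (induction k arbitrary: f)
  case 0
  then show ?case by (auto intro: bounded_linear.continuous_on[OF assms(2)])
next
  case (Suc k)
  show ?case
  proof (rule Ck_on_SucI[OF assms(1)])
    show "((\<lambda>x. h (f x)) has_derivative (\<lambda>v. h (frechet_derivative f (at x) v))) (at x)"
      if "x \<in> S" for x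
      using bounded_linear.has_derivative[OF assms(2) Ck_on_has_derivative[OF Suc.prems that]] .
  qed (use Suc in auto)
qed

lemma Ck_on_add:
  assumes "open S" "Ck_on k f S" "Ck_on k g S"
  shows "Ck_on k (\<lambda>x. f x + g x) S"
  using assms(2,3)
proof (induction k arbitrary: f g)
  case 0
  then show ?case by (auto intro: continuous_on_add)
next
  case (Suc k)
  show ?case
  proof (rule Ck_on_SucI[OF assms(1)])
    show "((\<lambda>x. f x + g x) has_derivative (\<lambda>v. frechet_derivative f (at x) v + frechet_derivative g (at x) v)) (at x)"
      if "x \<in> S" for x
      using Ck_on_has_derivative[OF Suc.prems(1) that] Ck_on_has_derivative[OF Suc.prems(2) that]
      by (rule has_derivative_add)
  qed (use Suc in auto)
qed

lemma Ck_on_sum: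
  assumes "open S" "\<And>i. i \<in> I \<Longrightarrow> Ck_on k (f i) S"
  shows "Ck_on k (\<lambda>x. \<Sum>i\<in>I. f i x) S"
  using assms(2)
proof (induction I rule: infinite_finite_induct)
  case (insert i I)
  then have "Ck_on k (\<lambda>x. f i x + (\<Sum>i\<in>I. f i x)) S"
    by (intro Ck_on_add[OF assms(1)]) auto
  with insert.hyps show ?case by simp
qed (simp_all add: Ck_on_const[OF assms(1)])

lemma Ck_on_scaleR:
  assumes "open S" "Ck_on k f S" "Ck_on k g S"
  shows "Ck_on k (\<lambda>x. f x *\<^sub>R g x) S"
  using assms(2,3)
proof (induction k arbitrary: f g)
  case 0
  then show ?case by (auto intro: continuous_on_scaleR)
next
  case (Suc k)
  show ?case
  proof (rule Ck_on_SucI[OF assms(1)])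
    show "((\<lambda>x. f x *\<^sub>R g x) has_derivative (\<lambda>v. f x *\<^sub>R frechet_derivative g (at x) v + frechet_derivative f (at x) v *\<^sub>R g x)) (at x)"
      if "x \<in> S" for x
      using Ck_on_has_derivative[OF Suc.prems(1) that] Ck_on_has_derivative[OF Suc.prems(2) that]
      by (rule has_derivative_scaleR)
    show "Ck_on k (\<lambda>x. f x *\<^sub>R frechet_derivative g (at x) v + frechet_derivative f (at x) v *\<^sub>R g x) S" for v
      using Suc.prems Ck_on_SucD[of k f S] Ck_on_SucD[of k g S]
      by (intro Ck_on_add[OF assms(1)] Suc.IH) auto
  qed
qed

text \<open>Expansion over the basis reduces a varying argument to finitely many fixed ones. This is
  how smoothness or continuity in each fixed direction is turned into joint statements
  throughout.\<close>

lemma linear_euclidean_sum: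
  assumes "linear f" shows "f v = (\<Sum>b\<in>Basis. (v \<bullet> b) *\<^sub>R f b)"
proof -
  have "f v = f (\<Sum>b\<in>Basis. (v \<bullet> b) *\<^sub>R b)" by (simp add: euclidean_representation)
  then show ?thesis by (simp only: linear_sum[OF assms] linear_cmul[OF assms])
qed

text \<open>In the chain rule the derivative of \<open>g\<close> is taken at \<open>f x\<close> in a
  direction that itself varies with \<open>x\<close>. Expanding that direction over the basis leaves
  derivatives of \<open>g\<close> in fixed directions, to which the induction hypothesis
  applies.\<close>

lemma Ck_on_compose:
  assumes "open S" "open T" "f ` S \<subseteq> T" "Ck_on k f S" "Ck_on k g T"
  shows "Ck_on k (\<lambda>x. g (f x)) S"
  using assms(4,5)
proof (induction k arbitrary: g)
  case 0
  then show ?case using continuous_on_compose2[OF _ _ assms(3)] by simp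
next
  case (Suc k)
  let ?Df = "\<lambda>x. frechet_derivative f (at x)" and ?Dg = "\<lambda>x. frechet_derivative g (at x)"
  have dg: "(g has_derivative ?Dg (f x)) (at (f x))" if "x \<in> S" for x
    using Suc.prems(2) that assms(3) by (intro Ck_on_has_derivative) auto
  show ?case
  proof (rule Ck_on_SucI[OF assms(1)])
    show "((\<lambda>x. g (f x)) has_derivative (\<lambda>v. \<Sum>b\<in>Basis. (?Df x v \<bullet> b) *\<^sub>R ?Dg (f x) b)) (at x)"
      if "x \<in> S" for x
      using has_derivative_compose[OF Ck_on_has_derivative[OF Suc.prems(1) that] dg[OF that]]
      unfolding linear_euclidean_sum[OF has_derivative_linear[OF dg[OF that]], of "?Df x _"] .
    show "Ck_on k (\<lambda>x. \<Sum>b\<in>Basis. (?Df x v \<bullet> b) *\<^sub>R ?Dg (f x) b) S" for v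
    proof (rule Ck_on_sum[OF assms(1)], rule Ck_on_scaleR[OF assms(1)])
      fix b :: 'b
      show "Ck_on k (\<lambda>x. ?Df x v \<bullet> b) S"
        using Suc.prems(1) by (intro Ck_on_bounded_linear[OF assms(1) bounded_linear_inner_left]) simp
      show "Ck_on k (\<lambda>x. ?Dg (f x) b) S"
        using Suc.prems Ck_on_SucD by (intro Suc.IH) auto
    qed
  qed
qed

lemma smooth_on_cong:
  "open S \<Longrightarrow> smooth_on S f \<Longrightarrow> (\<And>x. x \<in> S \<Longrightarrow> f x = g x) \<Longrightarrow> smooth_on S g"
  unfolding smooth_on_def using Ck_on_cong by blast

lemma smooth_on_subset: "smooth_on S f \<Longrightarrow> T \<subseteq> S \<Longrightarrow> smooth_on T f"
  unfolding smooth_on_def using Ck_on_subset by blast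

lemma smooth_on_const: "open S \<Longrightarrow> smooth_on S (\<lambda>x. c)"
  unfolding smooth_on_def using Ck_on_const by blast

lemma smooth_on_ident: "open S \<Longrightarrow> smooth_on S (\<lambda>x. x)"
  unfolding smooth_on_def using Ck_on_ident by blast

lemma smooth_on_bounded_linear:
  "open S \<Longrightarrow> bounded_linear h \<Longrightarrow> smooth_on S f \<Longrightarrow> smooth_on S (\<lambda>x. h (f x))"
  unfolding smooth_on_def using Ck_on_bounded_linear by blast

lemma smooth_on_add:
  "open S \<Longrightarrow> smooth_on S f \<Longrightarrow> smooth_on S g \<Longrightarrow> smooth_on S (\<lambda>x. f x + g x)"
  unfolding smooth_on_def using Ck_on_add by blast

lemma smooth_on_minus: "open S \<Longrightarrow> smooth_on S f \<Longrightarrow> smooth_on S (\<lambda>x. - f x)"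
  using smooth_on_bounded_linear[OF _ bounded_linear_minus[OF bounded_linear_ident]] .

lemma smooth_on_diff:
  "open S \<Longrightarrow> smooth_on S f \<Longrightarrow> smooth_on S g \<Longrightarrow> smooth_on S (\<lambda>x. f x - g x)"
  using smooth_on_add[of S f "\<lambda>x. - g x"] smooth_on_minus[of S g] by simp

lemma smooth_on_sum:
  "open S \<Longrightarrow> (\<And>i. i \<in> I \<Longrightarrow> smooth_on S (f i)) \<Longrightarrow> smooth_on S (\<lambda>x. \<Sum>i\<in>I. f i x)"
  by (simp add: smooth_on_def Ck_on_sum)

lemma smooth_on_scaleR:
  "open S \<Longrightarrow> smooth_on S f \<Longrightarrow> smooth_on S g \<Longrightarrow> smooth_on S (\<lambda>x. f x *\<^sub>R g x)"
  unfolding smooth_on_def using Ck_on_scaleR by blast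

lemma smooth_on_compose:
  "open S \<Longrightarrow> open T \<Longrightarrow> f ` S \<subseteq> T \<Longrightarrow> smooth_on S f \<Longrightarrow> smooth_on T g \<Longrightarrow> smooth_on S (\<lambda>x. g (f x))"
  unfolding smooth_on_def using Ck_on_compose by blast

lemma smooth_on_inner_left: "open S \<Longrightarrow> smooth_on S f \<Longrightarrow> smooth_on S (\<lambda>x. f x \<bullet> b)"
  by (rule smooth_on_bounded_linear[OF _ bounded_linear_inner_left])

lemma smooth_on_fst: "open S \<Longrightarrow> smooth_on S f \<Longrightarrow> smooth_on S (\<lambda>x. fst (f x))"
  by (rule smooth_on_bounded_linear[OF _ bounded_linear_fst])

lemma smooth_on_snd: "open S \<Longrightarrow> smooth_on S f \<Longrightarrow> smooth_on S (\<lambda>x. snd (f x))"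
  by (rule smooth_on_bounded_linear[OF _ bounded_linear_snd])

lemma smooth_on_Pair:
  assumes "open S" "smooth_on S f" "smooth_on S g"
  shows "smooth_on S (\<lambda>x. (f x, g x))"
proof -
  have "bounded_linear (\<lambda>y. (y, 0))" "bounded_linear (\<lambda>y. (0, y))"
    by (intro bounded_linear_Pair bounded_linear_ident bounded_linear_zero)+
  from smooth_on_add[OF assms(1) smooth_on_bounded_linear[OF assms(1) this(1) assms(2)]
      smooth_on_bounded_linear[OF assms(1) this(2) assms(3)]]
  show ?thesis by simp
qed

lemma smooth_on_frechet_derivative:
  assumes "smooth_on S f" shows "smooth_on S (\<lambda>x. frechet_derivative f (at x) v)"
  unfolding smooth_on_def
proof
  fix k show "Ck_on k (\<lambda>x. frechet_derivative f (at x) v) S"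
    using assms[unfolded smooth_on_def, rule_format, of "Suc k"] by simp
qed

lemma smooth_on_has_derivative:
  "smooth_on S f \<Longrightarrow> x \<in> S \<Longrightarrow> (f has_derivative frechet_derivative f (at x)) (at x)"
  unfolding smooth_on_def using Ck_on_has_derivative by blast

lemma smooth_on_differentiable: "smooth_on S f \<Longrightarrow> x \<in> S \<Longrightarrow> f differentiable (at x)"
  using smooth_on_has_derivative differentiable_def by blast

lemma smooth_on_continuous: "smooth_on S f \<Longrightarrow> continuous_on S f"
  unfolding smooth_on_def using Ck_on.simps(1) by blast

lemma smooth_on_linear_family:
  fixes \<Phi> :: "'a::euclidean_space \<Rightarrow> 'b::euclidean_space \<Rightarrow> 'c::real_normed_vector"
  assumes "open S" "\<And>x. x \<in> S \<Longrightarrow> linear (\<Phi> x)" "\<And>e. smooth_on S (\<lambda>x. \<Phi> x e)" "smooth_on S f"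
  shows "smooth_on S (\<lambda>x. \<Phi> x (f x))"
proof (rule smooth_on_cong[OF assms(1)])
  show "smooth_on S (\<lambda>x. \<Sum>b\<in>Basis. (f x \<bullet> b) *\<^sub>R \<Phi> x b)"
    by (intro smooth_on_sum smooth_on_scaleR smooth_on_inner_left assms)
qed (rule linear_euclidean_sum[symmetric, OF assms(2)])

text \<open>Finite dimension of the linear argument lets differentiability in \<open>x\<close> for
  each fixed \<open>e\<close> suffice: after expansion of \<open>e\<close> over the basis the
  product rule applies to each summand.\<close>

lemma has_derivative_linear_family:
  fixes \<Phi> :: "'a::real_normed_vector \<Rightarrow> 'b::euclidean_space \<Rightarrow> 'c::real_normed_vector"
  assumes S: "open S" "x0 \<in> S" and lin: "\<And>x. x \<in> S \<Longrightarrow> linear (\<Phi> x)"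
    and d: "\<And>e. (\<lambda>x. \<Phi> x e) differentiable (at x0)"
  shows "((\<lambda>z. \<Phi> (fst z) (snd z)) has_derivative
     (\<lambda>z. frechet_derivative (\<lambda>x. \<Phi> x e0) (at x0) (fst z) + \<Phi> x0 (snd z))) (at (x0, e0))"
proof -
  let ?D = "\<lambda>e. frechet_derivative (\<lambda>x. \<Phi> x e) (at x0)"
  have D: "((\<lambda>x. \<Phi> x e) has_derivative ?D e) (at x0)" for e
    by (rule frechet_derivative_works[THEN iffD1, OF d])
  have "((\<lambda>x. \<Sum>b\<in>Basis. (e0 \<bullet> b) *\<^sub>R \<Phi> x b) has_derivative (\<lambda>a. \<Sum>b\<in>Basis. (e0 \<bullet> b) *\<^sub>R ?D b a)) (at x0)"
    by (intro has_derivative_sum has_derivative_scaleR_right D)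
  then have "((\<lambda>x. \<Phi> x e0) has_derivative (\<lambda>a. \<Sum>b\<in>Basis. (e0 \<bullet> b) *\<^sub>R ?D b a)) (at x0)"
    by (rule has_derivative_transform_within_open[OF _ S]) (rule linear_euclidean_sum[symmetric, OF lin])
  \<comment> \<open>The derivative in \<open>x\<close> inherits linearity in \<open>e\<close>,
    because the expanded sum can be differentiated term by term and derivatives are unique.\<close>
  then have e0: "?D e0 a = (\<Sum>b\<in>Basis. (e0 \<bullet> b) *\<^sub>R ?D b a)" for a
    using frechet_derivative_eq by metis
  have "((\<lambda>z. \<Sum>b\<in>Basis. (snd z \<bullet> b) *\<^sub>R \<Phi> (fst z) b) has_derivative
      (\<lambda>z. \<Sum>b\<in>Basis. (snd (x0, e0) \<bullet> b) *\<^sub>R ?D b (fst z) + (snd z \<bullet> b) *\<^sub>R \<Phi> (fst (x0, e0)) b)) (at (x0, e0))"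
  proof (intro has_derivative_sum has_derivative_scaleR has_derivative_inner_left has_derivative_snd has_derivative_ident)
    fix b
    have "(fst has_derivative fst) (at (x0, e0))" by (rule bounded_linear_imp_has_derivative[OF bounded_linear_fst])
    from has_derivative_compose[OF this, of "\<lambda>x. \<Phi> x b" "?D b"]
    show "((\<lambda>z. \<Phi> (fst z) b) has_derivative (\<lambda>z. ?D b (fst z))) (at (x0, e0))" using D by simp
  qed
  then have "((\<lambda>z. \<Phi> (fst z) (snd z)) has_derivative
      (\<lambda>z. \<Sum>b\<in>Basis. (snd (x0, e0) \<bullet> b) *\<^sub>R ?D b (fst z) + (snd z \<bullet> b) *\<^sub>R \<Phi> (fst (x0, e0)) b)) (at (x0, e0))"
    by (rule has_derivative_transform_within_open[of _ _ _ _ "S \<times> UNIV"])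
      (use S in \<open>auto intro: open_Times linear_euclidean_sum[OF lin, symmetric]\<close>)
  moreover have "(\<lambda>z. \<Sum>b\<in>Basis. (snd (x0, e0) \<bullet> b) *\<^sub>R ?D b (fst z) + (snd z \<bullet> b) *\<^sub>R \<Phi> (fst (x0, e0)) b)
     = (\<lambda>z. ?D e0 (fst z) + \<Phi> x0 (snd z))"
    by (simp add: fun_eq_iff sum.distrib e0 flip: linear_euclidean_sum[OF lin[OF S(2)]])
  ultimately show ?thesis by simp
qed

lemma has_derivative_linear_family_compose:
  fixes \<Phi> :: "'a::real_normed_vector \<Rightarrow> 'b::euclidean_space \<Rightarrow> 'c::real_normed_vector"
  assumes "open S" "g y \<in> S" and "\<And>x. x \<in> S \<Longrightarrow> linear (\<Phi> x)"
    and "\<And>e. (\<lambda>x. \<Phi> x e) differentiable (at (g y))"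
    and "(g has_derivative g') (at y within T)" "(f has_derivative f') (at y within T)"
  shows "((\<lambda>y. \<Phi> (g y) (f y)) has_derivative
     (\<lambda>a. frechet_derivative (\<lambda>x. \<Phi> x (f y)) (at (g y)) (g' a) + \<Phi> (g y) (f' a))) (at y within T)"
proof -
  note fam = has_derivative_linear_family[of S "g y" \<Phi> "f y", OF assms(1-4)]
  show ?thesis
    using has_derivative_compose[OF has_derivative_Pair[OF assms(5,6)] fam] by simp
qed

section \<open>Symmetry of second derivatives and local Lipschitz bounds\<close>

lemma line_has_vector_derivative:
  assumes "f differentiable (at (y + s *\<^sub>R v))"
  shows "((\<lambda>s. f (y + s *\<^sub>R v)) has_vector_derivative frechet_derivative f (at (y + s *\<^sub>R v)) v) (at s)"
proof -
  have f: "(f has_derivative frechet_derivative f (at (y + s *\<^sub>R v))) (at (y + s *\<^sub>R v))"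
    using assms frechet_derivative_works by blast
  have "((\<lambda>s. y + s *\<^sub>R v) has_derivative (\<lambda>h. h *\<^sub>R v)) (at s)"
    by (auto intro!: derivative_eq_intros)
  from has_derivative_compose[OF this f] show ?thesis
    by (simp add: has_vector_derivative_def linear_cmul[OF has_derivative_linear[OF f]])
qed

text \<open>Two applications of the mean value theorem: in direction \<open>v\<close> to the
  difference of \<open>f\<close> in direction \<open>w\<close>, then in direction \<open>w\<close>
  to the derivative just obtained. The left-hand side is symmetric in \<open>v\<close> and
  \<open>w\<close>, which is what forces the mixed second derivatives to agree.\<close>

lemma second_difference:
  fixes f :: "'e::euclidean_space \<Rightarrow> real"
  assumes f: "smooth_on S f" and h: "h > 0"
    and seg: "\<And>s t. 0 \<le> s \<Longrightarrow> s \<le> h \<Longrightarrow> 0 \<le> t \<Longrightarrow> t \<le> h \<Longrightarrow> x + s *\<^sub>R v + t *\<^sub>R w \<in> S"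
  shows "\<exists>s t. 0 \<le> s \<and> s \<le> h \<and> 0 \<le> t \<and> t \<le> h \<and>
    f (x + h *\<^sub>R v + h *\<^sub>R w) - f (x + h *\<^sub>R v) - f (x + h *\<^sub>R w) + f x =
      h * h * frechet_derivative (\<lambda>y. frechet_derivative f (at y) v) (at (x + s *\<^sub>R v + t *\<^sub>R w)) w"
proof -
  let ?A = "\<lambda>y. frechet_derivative f (at y) v"
  have A: "smooth_on S ?A" by (rule smooth_on_frechet_derivative[OF f])
  have d: "((\<lambda>s. f (x + s *\<^sub>R v + t *\<^sub>R w)) has_real_derivative ?A (x + s *\<^sub>R v + t *\<^sub>R w)) (at s)"
    if "0 \<le> s" "s \<le> h" "0 \<le> t" "t \<le> h" for s t
    using line_has_vector_derivative[of f "x + t *\<^sub>R w" s v] smooth_on_differentiable[OF f seg[OF that]]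
    by (simp add: has_real_derivative_iff_has_vector_derivative algebra_simps)
  have "\<exists>s>0. s < h \<and> (f (x + h *\<^sub>R v + h *\<^sub>R w) - f (x + h *\<^sub>R v + 0 *\<^sub>R w))
      - (f (x + 0 *\<^sub>R v + h *\<^sub>R w) - f (x + 0 *\<^sub>R v + 0 *\<^sub>R w))
      = (h - 0) * (?A (x + s *\<^sub>R v + h *\<^sub>R w) - ?A (x + s *\<^sub>R v + 0 *\<^sub>R w))"
    by (rule MVT2[OF h]) (intro DERIV_diff d; use h in simp)
  then obtain s where s: "0 < s" "s < h"
    "f (x + h *\<^sub>R v + h *\<^sub>R w) - f (x + h *\<^sub>R v) - f (x + h *\<^sub>R w) + f x
      = h * (?A (x + s *\<^sub>R v + h *\<^sub>R w) - ?A (x + s *\<^sub>R v + 0 *\<^sub>R w))"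
    by auto
  have "\<exists>t>0. t < h \<and> ?A (x + s *\<^sub>R v + h *\<^sub>R w) - ?A (x + s *\<^sub>R v + 0 *\<^sub>R w)
      = (h - 0) * frechet_derivative ?A (at (x + s *\<^sub>R v + t *\<^sub>R w)) w"
  proof (rule MVT2[OF h])
    fix t assume "0 \<le> t" "t \<le> h"
    then show "((\<lambda>t. ?A (x + s *\<^sub>R v + t *\<^sub>R w)) has_real_derivative frechet_derivative ?A (at (x + s *\<^sub>R v + t *\<^sub>R w)) w) (at t)"
      using line_has_vector_derivative[of ?A "x + s *\<^sub>R v" t w] smooth_on_differentiable[OF A seg] s
      by (simp add: has_real_derivative_iff_has_vector_derivative)
  qed
  then obtain t where "t > 0" "t < h" "?A (x + s *\<^sub>R v + h *\<^sub>R w) - ?A (x + s *\<^sub>R v + 0 *\<^sub>R w)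
      = h * frechet_derivative ?A (at (x + s *\<^sub>R v + t *\<^sub>R w)) w"
    by auto
  with s show ?thesis by (intro exI[of _ s] exI[of _ t]) auto
qed

text \<open>If the mixed derivatives differed at \<open>x\<close>, continuity would keep each of
  them within half of the gap near \<open>x\<close>, so they could not take a common value at any
  two nearby points. The second difference, evaluated in both orders, produces such points.\<close>

lemma second_derivative_symmetric:
  fixes f :: "'e::euclidean_space \<Rightarrow> real"
  assumes f: "smooth_on S f" and S: "open S" "x \<in> S"
  shows "frechet_derivative (\<lambda>y. frechet_derivative f (at y) v) (at x) w =
    frechet_derivative (\<lambda>y. frechet_derivative f (at y) w) (at x) v"
proof (rule ccontr)
  define P where "P = (\<lambda>v w x. frechet_derivative (\<lambda>y. frechet_derivative f (at y) v) (at x) w)"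
  have cont: "continuous_on S (P v w)" for v w
    unfolding P_def by (intro smooth_on_continuous smooth_on_frechet_derivative f)
  assume "\<not> ?thesis"
  then have e: "\<bar>P v w x - P w v x\<bar> / 2 > 0" (is "?e > 0") by (simp add: P_def)
  obtain d1 where d1: "d1 > 0" "\<And>y. y \<in> S \<Longrightarrow> dist y x < d1 \<Longrightarrow> \<bar>P v w y - P v w x\<bar> < ?e"
    using cont[of v w, unfolded continuous_on_iff] S(2) e by (metis dist_real_def)
  obtain d2 where d2: "d2 > 0" "\<And>y. y \<in> S \<Longrightarrow> dist y x < d2 \<Longrightarrow> \<bar>P w v y - P w v x\<bar> < ?e"
    using cont[of w v, unfolded continuous_on_iff] S(2) e by (metis dist_real_def)
  obtain d3 where d3: "d3 > 0" "ball x d3 \<subseteq> S" using S open_contains_ball by blast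
  define d where "d = min d1 (min d2 d3)"
  \<comment> \<open>Chosen so that the parallelogram spanned by \<open>h *\<^sub>R v\<close> and
    \<open>h *\<^sub>R w\<close> stays within distance \<open>d\<close> of \<open>x\<close>; the
    added 1 keeps the denominator positive.\<close>
  define h where "h = d / (2 * (norm v + norm w + 1))"
  have h: "h > 0" using d1 d2 d3 by (simp add: d_def h_def divide_pos_pos add_nonneg_pos)
  have near: "dist (x + s *\<^sub>R v + t *\<^sub>R w) x < d" if "0 \<le> s" "s \<le> h" "0 \<le> t" "t \<le> h" for s t
  proof -
    have "norm (s *\<^sub>R v + t *\<^sub>R w) \<le> h * norm v + h * norm w"
      using that by (intro norm_triangle_le add_mono) (auto intro: mult_right_mono)
    also have "\<dots> < h * (2 * (norm v + norm w + 1))"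
      using h by (simp add: algebra_simps add_strict_increasing add_nonneg_pos)
    also have "\<dots> = d" by (simp add: h_def add_nonneg_eq_0_iff)
    finally show ?thesis by (simp add: dist_norm add.assoc)
  qed
  have inS: "x + s *\<^sub>R v + t *\<^sub>R w \<in> S" if "0 \<le> s" "s \<le> h" "0 \<le> t" "t \<le> h" for s t
    using near[OF that] d3 by (auto simp: d_def dist_commute)
  obtain s t where st: "0 \<le> s" "s \<le> h" "0 \<le> t" "t \<le> h"
    "f (x + h *\<^sub>R v + h *\<^sub>R w) - f (x + h *\<^sub>R v) - f (x + h *\<^sub>R w) + f x = h * h * P v w (x + s *\<^sub>R v + t *\<^sub>R w)"
    using second_difference[OF f h inS] unfolding P_def by auto
  have "x + t *\<^sub>R w + s *\<^sub>R v \<in> S" if "0 \<le> s" "s \<le> h" "0 \<le> t" "t \<le> h" for s t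
    using inS[OF that] by (simp add: ac_simps)
  from second_difference[OF f h this]
  obtain s' t' where st': "0 \<le> s'" "s' \<le> h" "0 \<le> t'" "t' \<le> h"
    "f (x + h *\<^sub>R w + h *\<^sub>R v) - f (x + h *\<^sub>R w) - f (x + h *\<^sub>R v) + f x = h * h * P w v (x + t' *\<^sub>R w + s' *\<^sub>R v)"
    unfolding P_def by blast
  have "P v w (x + s *\<^sub>R v + t *\<^sub>R w) = P w v (x + s' *\<^sub>R v + t' *\<^sub>R w)"
  proof -
    have eq: "x + h *\<^sub>R w + h *\<^sub>R v = x + h *\<^sub>R v + h *\<^sub>R w"
      "x + t' *\<^sub>R w + s' *\<^sub>R v = x + s' *\<^sub>R v + t' *\<^sub>R w" by simp_all
    have "h * h * P v w (x + s *\<^sub>R v + t *\<^sub>R w) = h * h * P w v (x + s' *\<^sub>R v + t' *\<^sub>R w)"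
      using st(5) st'(5) unfolding eq by linarith
    then show ?thesis using h by simp
  qed
  moreover have "\<bar>P v w (x + s *\<^sub>R v + t *\<^sub>R w) - P v w x\<bar> < ?e"
    using near[OF st(1-4)] by (intro d1 inS st) (simp add: d_def)
  moreover have "\<bar>P w v (x + s' *\<^sub>R v + t' *\<^sub>R w) - P w v x\<bar> < ?e"
    using near[OF st'(1-4)] by (intro d2 inS st') (simp add: d_def)
  ultimately show False by (simp add: abs_if split: if_splits)
qed

text \<open>The derivative in each basis direction is bounded on a compact ball, and the sum of
  these bounds dominates the operator norm there. Convexity of the ball then gives the Lipschitz
  estimate.\<close>

lemma smooth_on_locally_lipschitz:
  fixes f :: "'e::euclidean_space \<Rightarrow> 'f::real_normed_vector"
  assumes f: "smooth_on S f" and S: "open S" "x \<in> S"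
  obtains r L where "r > 0" "L \<ge> 0" "cball x r \<subseteq> S"
    "\<And>y z. y \<in> cball x r \<Longrightarrow> z \<in> cball x r \<Longrightarrow> norm (f y - f z) \<le> L * norm (y - z)"
proof -
  obtain r where r: "r > 0" "cball x r \<subseteq> S" using S open_contains_cball by blast
  let ?D = "\<lambda>y. frechet_derivative f (at y)"
  have "\<exists>M. \<forall>y\<in>cball x r. norm (?D y b) \<le> M" for b
  proof -
    have "continuous_on (cball x r) (\<lambda>y. ?D y b)"
      using smooth_on_continuous[OF smooth_on_frechet_derivative[OF f]] r(2) continuous_on_subset by blast
    then have "bounded ((\<lambda>y. ?D y b) ` cball x r)"
      by (intro compact_imp_bounded compact_continuous_image compact_cball)
    then show ?thesis unfolding bounded_iff by auto
  qed
  then obtain M where M: "\<And>b y. y \<in> cball x r \<Longrightarrow> norm (?D y b) \<le> M b" by metis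
  have M0: "M b \<ge> 0" for b
    using M[of x b] r(1) norm_ge_zero[of "?D x b"] by (simp add: order_trans[OF norm_ge_zero])
  have on: "onorm (?D y) \<le> (\<Sum>b\<in>Basis. M b)" if y: "y \<in> cball x r" for y
  proof (rule onorm_le)
    fix v :: 'e
    have "linear (?D y)" using f r(2) y has_derivative_linear smooth_on_has_derivative by blast
    then have "norm (?D y v) = norm (\<Sum>b\<in>Basis. (v \<bullet> b) *\<^sub>R ?D y b)"
      using linear_euclidean_sum by metis
    also have "\<dots> \<le> (\<Sum>b\<in>Basis. norm v * M b)"
    proof (rule sum_norm_le)
      fix b :: 'e assume "b \<in> Basis"
      then show "norm ((v \<bullet> b) *\<^sub>R ?D y b) \<le> norm v * M b"
        using M[OF y, of b] Basis_le_norm[of b v] by (simp add: mult_mono)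
    qed
    also have "\<dots> = (\<Sum>b\<in>Basis. M b) * norm v" by (subst sum_distrib_right) (simp add: mult.commute)
    finally show "norm (?D y v) \<le> (\<Sum>b\<in>Basis. M b) * norm v" .
  qed
  show ?thesis
  proof (rule that[OF r(1) _ r(2)])
    show "0 \<le> (\<Sum>b\<in>Basis. M b)" using M0 by (simp add: sum_nonneg)
    show "norm (f y - f z) \<le> (\<Sum>b\<in>Basis. M b) * norm (y - z)" if "y \<in> cball x r" "z \<in> cball x r" for y z
      by (rule differentiable_bound[OF convex_cball _ on that])
        (use f r(2) smooth_on_has_derivative has_derivative_at_withinI in blast)
  qed
qed

section \<open>Ordinary differential equations\<close>

lemma has_vector_derivative_norm_bound:
  fixes f :: "real \<Rightarrow> 'a::real_normed_vector"
  assumes "\<And>t. t \<in> {a..b} \<Longrightarrow> (f has_vector_derivative f' t) (at t within {a..b})"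
    and "\<And>t. t \<in> {a..b} \<Longrightarrow> norm (f' t) \<le> B" and "s \<in> {a..b}" "t \<in> {a..b}"
  shows "norm (f s - f t) \<le> B * \<bar>s - t\<bar>"
proof -
  have "onorm (\<lambda>h. h *\<^sub>R f' t) \<le> B" if "t \<in> {a..b}" for t
    by (rule onorm_le) (use assms(2)[OF that] in \<open>auto simp: mult.commute[of B] intro: mult_left_mono\<close>)
  then show ?thesis
    using differentiable_bound[of "{a..b}" f "\<lambda>t h. h *\<^sub>R f' t" B s t] assms
    by (simp add: has_vector_derivative_def)
qed

text \<open>Gronwall's argument: weighted by \<open>exp (- 2 * L * t)\<close>, the squared norm of
  \<open>z\<close> has nonpositive derivative, so it cannot rise above its initial value 0.\<close>

lemma ode_zero:
  fixes z :: "real \<Rightarrow> 'a::real_inner"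
  assumes z: "\<And>t. t \<in> {a..b} \<Longrightarrow> (z has_vector_derivative z' t) (at t within {a..b})"
    and L: "\<And>t. t \<in> {a..b} \<Longrightarrow> norm (z' t) \<le> L * norm (z t)" and "z a = 0" and s: "s \<in> {a..b}"
  shows "z s = 0"
proof (cases "a = s")
  case False
  let ?f = "\<lambda>t. exp (- 2 * L * t) * (z t \<bullet> z t)"
  let ?f' = "\<lambda>t. exp (- 2 * L * t) * (2 * (z t \<bullet> z' t) - 2 * L * (z t \<bullet> z t))"
  have "\<exists>t\<in>{a<..<s}. ?f s - ?f a = (\<lambda>h. h * ?f' t) (s - a)"
  proof (rule mvt_simple)
    show "a < s" using False s by simp
    fix t assume t: "a \<le> t" "t \<le> s"
    then have zt: "(z has_derivative (\<lambda>h. h *\<^sub>R z' t)) (at t within {a..s})"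
      using z[of t] s by (auto simp: has_vector_derivative_def intro: has_derivative_subset)
    show "(?f has_derivative (\<lambda>h. h * ?f' t)) (at t within {a..s})"
      by (rule derivative_eq_intros zt refl | simp add: fun_eq_iff algebra_simps inner_commute)+
  qed
  then obtain t where t: "a < t" "t < s" "?f s - ?f a = (s - a) * ?f' t" by auto
  have "z t \<bullet> z' t \<le> norm (z t) * norm (z' t)" by (rule norm_cauchy_schwarz)
  also have "\<dots> \<le> norm (z t) * (L * norm (z t))" using L[of t] t s by (intro mult_left_mono) auto
  also have "\<dots> = L * (z t \<bullet> z t)" by (simp add: dot_square_norm power2_eq_square)
  finally have "?f' t \<le> 0" by (simp add: mult_le_0_iff)
  then have "?f s \<le> 0" using t \<open>z a = 0\<close> mult_nonneg_nonpos[of "s - a" "?f' t"] by simp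
  then have "z s \<bullet> z s \<le> 0" by (simp add: mult_le_0_iff)
  then show ?thesis by (metis inner_eq_zero_iff inner_ge_zero order_antisym)
qed (use \<open>z a = 0\<close> in simp)

text \<open>The Lipschitz bound is asked only along the two solutions. This fits right-hand sides
  that are Lipschitz merely on a ball which the solutions are known not to leave.\<close>

lemma ode_unique:
  fixes y z :: "real \<Rightarrow> 'a::real_inner"
  assumes "\<And>t. t \<in> {a..b} \<Longrightarrow> (y has_vector_derivative F t (y t)) (at t within {a..b})"
    and "\<And>t. t \<in> {a..b} \<Longrightarrow> (z has_vector_derivative F t (z t)) (at t within {a..b})"
    and "\<And>t. t \<in> {a..b} \<Longrightarrow> norm (F t (y t) - F t (z t)) \<le> L * norm (y t - z t)"
    and "y a = z a" and "s \<in> {a..b}"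
  shows "y s = z s"
  using ode_zero[of a b "\<lambda>t. y t - z t" "\<lambda>t. F t (y t) - F t (z t)" L s] assms
  by (auto intro: has_vector_derivative_diff)

text \<open>Picard iteration as a Banach fixed point. The bound 1/2 on \<open>L t\<close> over an
  interval of length one makes the integral operator a contraction in the supremum norm; the
  transport equation meets it once \<open>w\<close> is small.\<close>

lemma linear_ode_exists:
  fixes L :: "real \<Rightarrow> 'e::euclidean_space \<Rightarrow> 'e"
  assumes lin: "\<And>t. t \<in> {0..1} \<Longrightarrow> linear (L t)"
    and bound: "\<And>t v. t \<in> {0..1} \<Longrightarrow> norm (L t v) \<le> 1 / 2 * norm v"
    and cont: "\<And>v. continuous_on {0..1} (\<lambda>t. L t v)"
  shows "\<exists>V. V 0 = y \<and> (\<forall>t\<in>{0..1}. (V has_vector_derivative L t (V t)) (at t within {0..1}))"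
proof -
  \<comment> \<open>Elements of the type of bounded continuous functions live on the whole real
    line; clamping the time to \<open>{0..1}\<close> lets the Picard operator act on them and
    changes nothing on the interval.\<close>
  let ?c = "\<lambda>t::real. max 0 (min 1 t)"
  have contL: "continuous_on {0..1} (\<lambda>s. L s (f s))" if "continuous_on {0..1} f" for f
  proof -
    have "continuous_on {0..1} (\<lambda>s. \<Sum>b\<in>Basis. (f s \<bullet> b) *\<^sub>R L s b)"
      by (intro continuous_intros that cont)
    then show ?thesis
      by (rule continuous_on_eq) (rule linear_euclidean_sum[OF lin, symmetric])
  qed
  have bc: "continuous_on A (apply_bcontfun f)" for f :: "real \<Rightarrow>\<^sub>C 'e" and A
    using apply_bcontfun[of f] by (auto simp: bcontfun_def intro: continuous_on_subset)
  define G where "G = (\<lambda>(f :: real \<Rightarrow>\<^sub>C 'e) t. y + integral {0..?c t} (\<lambda>s. L s (f s)))"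
  have G: "G f \<in> bcontfun" for f
  proof -
    let ?h = "\<lambda>t. y + integral {0..t} (\<lambda>s. L s (f s))"
    have h: "continuous_on {0..1} ?h"
      by (intro continuous_intros indefinite_integral_continuous_1 integrable_continuous_real contL bc)
    have "continuous_on UNIV (\<lambda>t. ?h (?c t))"
      by (rule continuous_on_compose2[OF h]) (auto intro!: continuous_intros)
    moreover have "bounded (?h ` {0..1})"
      by (intro compact_imp_bounded compact_continuous_image h) simp
    then have "bounded (range (\<lambda>t. ?h (?c t)))" by (rule bounded_subset) auto
    ultimately show ?thesis by (simp add: bcontfun_def G_def)
  qed
  have "\<exists>!f. Bcontfun (G f) = f"
  proof (rule banach_fix_type[of "1/2"])
    show "\<forall>f g. dist (Bcontfun (G f)) (Bcontfun (G g)) \<le> 1 / 2 * dist f g"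
    proof (intro allI dist_bound)
      fix f g :: "real \<Rightarrow>\<^sub>C 'e" and t
      have int: "(\<lambda>s. L s (f s)) integrable_on {0..?c t}" for f :: "real \<Rightarrow>\<^sub>C 'e"
        by (rule integrable_continuous_real, rule continuous_on_subset[OF contL[OF bc]]) auto
      have "dist (apply_bcontfun (Bcontfun (G f)) t) (apply_bcontfun (Bcontfun (G g)) t)
          = norm (integral {0..?c t} (\<lambda>s. L s (f s) - L s (g s)))"
        by (simp add: Bcontfun_inverse G dist_norm) (simp add: G_def integral_diff int)
      also have "\<dots> \<le> 1 / 2 * dist f g * (?c t - 0)"
      proof (rule integral_bound)
        show "continuous_on {0..?c t} (\<lambda>s. L s (f s) - L s (g s))"
          by (intro continuous_on_diff; rule continuous_on_subset[OF contL[OF bc]]) auto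
        fix s assume "s \<in> {0..?c t}"
        then have s: "s \<in> {0..1}" by auto
        have "norm (L s (f s) - L s (g s)) \<le> 1 / 2 * dist (f s) (g s)"
          using bound[OF s, of "f s - g s"] by (simp add: linear_diff[OF lin[OF s]] dist_norm)
        also have "\<dots> \<le> 1 / 2 * dist f g" using dist_bounded[of f s g] by simp
        finally show "norm (L s (f s) - L s (g s)) \<le> 1 / 2 * dist f g" .
      qed simp
      also have "\<dots> \<le> 1 / 2 * dist f g" by (simp add: mult_left_le)
      finally show "dist (apply_bcontfun (Bcontfun (G f)) t) (apply_bcontfun (Bcontfun (G g)) t) \<le> 1 / 2 * dist f g" .
    qed
  qed auto
  then obtain f where "Bcontfun (G f) = f" by blast
  then have f: "apply_bcontfun f t = G f t" for t by (metis Bcontfun_inverse G)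
  have ft: "f t = y + integral {0..t} (\<lambda>s. L s (f s))" if "t \<in> {0..1}" for t
    using f[of t] that by (simp add: G_def)
  have "(apply_bcontfun f has_vector_derivative L t (f t)) (at t within {0..1})" if t: "t \<in> {0..1}" for t
  proof (rule has_vector_derivative_transform[OF t])
    show "((\<lambda>t. y + integral {0..t} (\<lambda>s. L s (f s))) has_vector_derivative L t (f t)) (at t within {0..1})"
      using has_vector_derivative_add[OF has_vector_derivative_const integral_has_vector_derivative[OF contL[OF bc] t]]
      by simp
  qed (rule ft)
  moreover have "f 0 = y" using ft[of 0] by simp
  ultimately show ?thesis by blast
qed

section \<open>The transport equation near the centre of a normal neighbourhood\<close>

lemma bilinear_euclidean_sum:
  assumes "bilinear f"
  shows "f v w = (\<Sum>i\<in>Basis. \<Sum>j\<in>Basis. ((v \<bullet> i) * (w \<bullet> j)) *\<^sub>R f i j)"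
proof -
  have l: "linear (\<lambda>v. f v w)" "linear (f i)" for i using assms by (auto simp: bilinear_def)
  have "f v w = (\<Sum>i\<in>Basis. (v \<bullet> i) *\<^sub>R f i w)" by (rule linear_euclidean_sum[OF l(1)])
  also have "\<dots> = (\<Sum>i\<in>Basis. (v \<bullet> i) *\<^sub>R (\<Sum>j\<in>Basis. (w \<bullet> j) *\<^sub>R f i j))"
    by (rule sum.cong[OF refl]) (subst linear_euclidean_sum[OF l(2), of _ w], rule refl)
  finally show ?thesis by (simp add: scaleR_sum_right)
qed

text \<open>A bilinear map is determined by its coefficients on pairs of basis vectors. Continuity
  of these finitely many coefficients gives an estimate uniform in \<open>a\<close> and
  \<open>e\<close>, with the tolerance divided by the number of pairs.\<close>

lemma bilinear_family_near:
  fixes B :: "'a::topological_space \<Rightarrow> 'e::euclidean_space \<Rightarrow> 'e \<Rightarrow> 'f::real_normed_vector"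
  assumes S: "open S" "x0 \<in> S" and bil: "\<And>x. x \<in> S \<Longrightarrow> bilinear (B x)"
    and cont: "\<And>a e. continuous_on S (\<lambda>x. B x a e)" and "\<epsilon> > 0"
  shows "\<forall>\<^sub>F x in nhds x0. \<forall>a e. norm (B x a e - B x0 a e) \<le> \<epsilon> * norm a * norm e"
proof -
  let ?n = "real DIM('e)"
  let ?e = "\<epsilon> / (?n * ?n)"
  have e: "?e > 0" using \<open>\<epsilon> > 0\<close> by simp
  have "\<forall>\<^sub>F x in nhds x0. norm (B x i j - B x0 i j) < ?e" for i j
  proof -
    have "((\<lambda>x. B x i j) \<longlongrightarrow> B x0 i j) (at x0)"
      using cont[of i j] S by (metis continuous_on_def at_within_open)
    then have "((\<lambda>x. B x i j) \<longlongrightarrow> B x0 i j) (nhds x0)" by (simp add: tendsto_nhds_iff)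
    from tendstoD[OF this e] show ?thesis by (simp add: dist_norm)
  qed
  then have "\<forall>\<^sub>F x in nhds x0. \<forall>i\<in>Basis. \<forall>j\<in>Basis. norm (B x i j - B x0 i j) < ?e"
    by (simp add: eventually_ball_finite)
  moreover have "\<forall>\<^sub>F x in nhds x0. x \<in> S" using S eventually_nhds by blast
  ultimately show ?thesis
  proof eventually_elim
    case (elim x)
    show ?case
    proof (intro allI)
      fix a e :: 'e
      have "norm (B x a e - B x0 a e) =
        norm (\<Sum>i\<in>Basis. \<Sum>j\<in>Basis. ((a \<bullet> i) * (e \<bullet> j)) *\<^sub>R (B x i j - B x0 i j))"
        by (subst bilinear_euclidean_sum[OF bil[OF elim(2)]], subst bilinear_euclidean_sum[OF bil[OF S(2)]])
          (simp add: sum_subtractf scaleR_diff_right)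
      also have "\<dots> \<le> (\<Sum>i::'e\<in>Basis. \<Sum>j::'e\<in>Basis. (norm a * norm e) * ?e)"
      proof (intro sum_norm_le)
        fix i j :: 'e assume ij: "i \<in> Basis" "j \<in> Basis"
        have "\<bar>a \<bullet> i\<bar> * \<bar>e \<bullet> j\<bar> \<le> norm a * norm e"
          using Basis_le_norm ij by (intro mult_mono) auto
        then show "norm (((a \<bullet> i) * (e \<bullet> j)) *\<^sub>R (B x i j - B x0 i j)) \<le> (norm a * norm e) * ?e"
          using elim(1) ij unfolding norm_scaleR abs_mult
          by (intro mult_mono[of "\<bar>a \<bullet> i\<bar> * \<bar>e \<bullet> j\<bar>"]) (auto intro: less_imp_le)
      qed
      also have "\<dots> = \<epsilon> * norm a * norm e" by simp
      finally show "norm (B x a e - B x0 a e) \<le> \<epsilon> * norm a * norm e" .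
    qed
  qed
qed

text \<open>
  In normal coordinates with radial vector \<open>w\<close>, parallel fields along the geodesic running back to
  the centre solve this linear equation, with \<open>B x\<close> the pullback of the Christoffel symbols.
\<close>

definition linear_transport ::
  "('e \<Rightarrow> 'e \<Rightarrow> 'e \<Rightarrow> 'e) \<Rightarrow> 'e::real_normed_vector \<Rightarrow> (real \<Rightarrow> 'e) \<Rightarrow> bool" where
  "linear_transport B w V \<longleftrightarrow>
     (\<forall>t\<in>{0..1}. (V has_vector_derivative B ((1 - t) *\<^sub>R w) w (V t)) (at t within {0..1}))"

text \<open>Up to a time \<open>m\<close> where the norm is maximal, the field moves by at most
  \<open>C * norm w * norm (V m)\<close>, hence by at most half of \<open>norm (V m)\<close>. This
  forces \<open>norm (V m) \<le> 2 * norm (V 0)\<close>, and feeding that back gives the second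
  estimate.\<close>

lemma linear_transport_bound:
  fixes B :: "'e::real_normed_vector \<Rightarrow> 'e \<Rightarrow> 'e \<Rightarrow> 'e"
  assumes B: "\<And>x a e. x \<in> ball 0 \<delta> \<Longrightarrow> norm (B x a e) \<le> C * norm a * norm e"
    and w: "w \<in> ball 0 \<delta>" "C * norm w \<le> 1 / 2" and C: "C \<ge> 0"
    and V: "linear_transport B w V" and t: "t \<in> {0..1}"
  shows "norm (V t) \<le> 2 * norm (V 0)" "norm (V t - V 0) \<le> 2 * C * norm w * norm (V 0)"
proof -
  have d: "(V has_vector_derivative B ((1 - t) *\<^sub>R w) w (V t)) (at t within {0..1})" if "t \<in> {0..1}" for t
    using V that unfolding linear_transport_def by blast
  have "continuous_on {0..1} V"
    using d continuous_on_eq_continuous_within has_vector_derivative_continuous by blast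
  then have "continuous_on {0..1} (\<lambda>t. norm (V t))" by (rule continuous_on_norm)
  from continuous_attains_sup[OF _ _ this]
  obtain m where m: "m \<in> {0..1}" "\<And>t. t \<in> {0..1} \<Longrightarrow> norm (V t) \<le> norm (V m)" by auto
  have *: "norm (V s - V 0) \<le> C * norm w * norm (V m) * \<bar>s - 0\<bar>" if "s \<in> {0..1}" for s
  proof (rule has_vector_derivative_norm_bound[OF d])
    fix t :: real assume t: "t \<in> {0..1}"
    have "norm ((1 - t) *\<^sub>R w) \<le> norm w" using t by (simp add: mult_left_le_one_le)
    then have "norm (B ((1 - t) *\<^sub>R w) w (V t)) \<le> C * norm w * norm (V t)" using w(1) by (intro B) auto
    also have "\<dots> \<le> C * norm w * norm (V m)" using m(2)[OF t] C by (intro mult_left_mono) auto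
    finally show "norm (B ((1 - t) *\<^sub>R w) w (V t)) \<le> C * norm w * norm (V m)" .
  qed (use that in auto)
  have le: "norm (V s - V 0) \<le> C * norm w * norm (V m)" if "s \<in> {0..1}" for s
    using order_trans[OF *[OF that] mult_left_le] that C by simp
  have "C * norm w * norm (V m) \<le> 1 / 2 * norm (V m)" using w(2) by (intro mult_right_mono) auto
  with le[OF m(1)] have "norm (V m - V 0) \<le> 1 / 2 * norm (V m)" by linarith
  then have m2: "norm (V m) \<le> 2 * norm (V 0)"
    using norm_triangle_sub[of "V m" "V 0"] by linarith
  show "norm (V t) \<le> 2 * norm (V 0)" using m(2)[OF t] m2 by linarith
  have "C * norm w * norm (V m) \<le> C * norm w * (2 * norm (V 0))" using C m2 by (intro mult_left_mono) auto
  with le[OF t] show "norm (V t - V 0) \<le> 2 * C * norm w * norm (V 0)" by simp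
qed

text \<open>The right-hand side is linear in \<open>w\<close>, so it is already small of first
  order; freezing the base point at 0 and the field at \<open>u\<close> changes the solution only by
  terms of higher order. The time-one map is represented by any \<open>\<Phi>\<close> that agrees
  with it for small \<open>w\<close>, so that the map arising from actual parallel transport can be
  inserted directly.\<close>

lemma linear_transport_derivative:
  fixes B :: "'e::euclidean_space \<Rightarrow> 'e \<Rightarrow> 'e \<Rightarrow> 'e"
  assumes r: "r > 0" and bil: "\<And>x. x \<in> ball 0 r \<Longrightarrow> bilinear (B x)"
    and cont: "\<And>a e. continuous_on (ball 0 r) (\<lambda>x. B x a e)"
  obtains \<delta> where "0 < \<delta>" "\<delta> \<le> r"
    "\<And>w y. w \<in> ball 0 \<delta> \<Longrightarrow> \<exists>V. linear_transport B w V \<and> V 0 = y"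
    "\<And>w V W t. w \<in> ball 0 \<delta> \<Longrightarrow> linear_transport B w V \<Longrightarrow> linear_transport B w W \<Longrightarrow>
       V 0 = W 0 \<Longrightarrow> t \<in> {0..1} \<Longrightarrow> V t = W t"
    "\<And>\<Phi> u. \<forall>w\<in>ball 0 \<delta>. \<forall>V. linear_transport B w V \<longrightarrow> \<Phi> (w, V 0) = V 1 \<Longrightarrow>
       (\<Phi> has_derivative (\<lambda>z. snd z + B 0 (fst z) u)) (at (0, u))"
proof -
  have 0: "0 \<in> ball (0::'e) r" using r by simp
  note near = bilinear_family_near[where B = B and S = "ball 0 r" and ?x0.0 = 0, OF open_ball 0 bil cont]
  obtain C0 where C0: "C0 > 0" "\<And>a e. norm (B 0 a e) \<le> C0 * norm a * norm e"
    using bilinear_bounded_pos[OF bil[OF 0]] by auto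
  \<comment> \<open>\<open>C0\<close> bounds \<open>B 0\<close>; the added 1 pays for moving the
    base point within \<open>\<delta>1\<close>, where \<open>B x\<close> differs from
    \<open>B 0\<close> by at most 1.\<close>
  define C where "C = C0 + 1"
  have C: "C > 0" "C \<ge> 0" using C0 by (auto simp: C_def)
  obtain \<delta>1 where \<delta>1: "\<delta>1 > 0" "\<And>x a e. x \<in> ball 0 \<delta>1 \<Longrightarrow> norm (B x a e - B 0 a e) \<le> 1 * norm a * norm e"
    using near[of 1] unfolding eventually_nhds_metric by (auto simp: dist_commute)
  \<comment> \<open>The last entry gives \<open>C * norm w \<le> 1 / 2\<close>, the smallness that
    both the existence result and the a priori bounds require.\<close>
  define \<delta> where "\<delta> = min (min \<delta>1 r) (1 / (2 * C))"
  have "C * \<delta> \<le> C * (1 / (2 * C))" using C by (intro mult_left_mono) (auto simp: \<delta>_def)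
  then have \<delta>: "\<delta> > 0" "\<delta> \<le> \<delta>1" "\<delta> \<le> r" "C * \<delta> \<le> 1 / 2"
    using \<delta>1(1) r C by (auto simp: \<delta>_def)
  have BC: "norm (B x a e) \<le> C * norm a * norm e" if "x \<in> ball 0 \<delta>" for x a e
  proof -
    have "norm (B x a e - B 0 a e) \<le> 1 * norm a * norm e" using \<delta>1(2)[of x] that \<delta>(2) by auto
    then show ?thesis
      using norm_triangle_sub[of "B x a e" "B 0 a e"] C0(2)[of a e]
      by (simp add: C_def algebra_simps)
  qed
  have Cw: "C * norm w \<le> 1 / 2" if "w \<in> ball 0 \<delta>" for w
  proof -
    have "C * norm w \<le> C * \<delta>" using that C by (intro mult_left_mono) auto
    with \<delta>(4) show ?thesis by linarith
  qed
  have tw: "(1 - t) *\<^sub>R w \<in> ball 0 \<delta>" if "t \<in> {0..1}" "w \<in> ball 0 \<delta>" for t and w :: 'e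
    using that le_less_trans[OF mult_left_le_one_le[of "norm w" "1 - t"]] by auto
  note bd = linear_transport_bound[where B = B and C = C and \<delta> = \<delta>, OF BC _ Cw C(2)]
  have ex: "\<exists>V. linear_transport B w V \<and> V 0 = y" if w: "w \<in> ball 0 \<delta>" for w y
      unfolding linear_transport_def
    proof (subst conj_commute, rule linear_ode_exists)
      fix t :: real assume t: "t \<in> {0..1}"
      show "linear (B ((1 - t) *\<^sub>R w) w)" using bil[of "(1 - t) *\<^sub>R w"] tw[OF t w] \<delta>(3) by (auto simp: bilinear_def)
      fix v
      have "norm (B ((1 - t) *\<^sub>R w) w v) \<le> C * norm w * norm v" using tw[OF t w] by (rule BC)
      also have "\<dots> \<le> 1 / 2 * norm v" using Cw[OF w] by (intro mult_right_mono) auto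
      finally show "norm (B ((1 - t) *\<^sub>R w) w v) \<le> 1 / 2 * norm v" .
    next
      fix v show "continuous_on {0..1} (\<lambda>t. B ((1 - t) *\<^sub>R w) w v)"
      proof (rule continuous_on_compose2[OF cont])
        have "ball 0 \<delta> \<subseteq> ball (0::'e) r" using \<delta>(3) by (rule subset_ball)
        then show "(\<lambda>t. (1 - t) *\<^sub>R w) ` {0..1} \<subseteq> ball 0 r" using tw[OF _ w] by blast
      qed (intro continuous_intros)
    qed
  show ?thesis
  proof (rule that[OF \<delta>(1) \<delta>(3) ex])
    fix w V W and t :: real
    assume w: "w \<in> ball 0 \<delta>" and V: "linear_transport B w V" "linear_transport B w W" "V 0 = W 0" and t: "t \<in> {0..1}"
    show "V t = W t"
    proof (rule ode_unique[where y = V and z = W and a = 0 and b = 1 and F = "\<lambda>t. B ((1 - t) *\<^sub>R w) w" and L = "C * norm w", OF _ _ _ V(3) t])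
      fix t :: real assume t: "t \<in> {0..1}"
      have "linear (B ((1 - t) *\<^sub>R w) w)" using bil[of "(1 - t) *\<^sub>R w"] tw[OF t w] \<delta>(3) by (auto simp: bilinear_def)
      then show "norm (B ((1 - t) *\<^sub>R w) w (V t) - B ((1 - t) *\<^sub>R w) w (W t)) \<le> C * norm w * norm (V t - W t)"
        using BC[OF tw[OF t w], of w "V t - W t"] by (simp add: linear_diff)
    qed (use V in \<open>auto simp: linear_transport_def\<close>)
  next
    fix \<Phi> u assume "\<forall>w\<in>ball 0 \<delta>. \<forall>V. linear_transport B w V \<longrightarrow> \<Phi> (w, V 0) = V 1"
    then have \<Phi>: "\<And>w V. w \<in> ball 0 \<delta> \<Longrightarrow> linear_transport B w V \<Longrightarrow> \<Phi> (w, V 0) = V 1" by blast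
    have sol: "\<exists>V. linear_transport B w V \<and> V 0 = y \<and> \<Phi> (w, y) = V 1" if wb: "w \<in> ball 0 \<delta>" for w y
    proof -
      obtain V where "linear_transport B w V" "V 0 = y" using ex[OF wb] by blast
      then show ?thesis using \<Phi>[OF wb, of V] by auto
    qed
    have lin: "linear (\<lambda>a. B 0 a u)" "linear (B 0 a)" for a using bil[OF 0] by (auto simp: bilinear_def)
    \<comment> \<open>For \<open>w = 0\<close> the right-hand side vanishes, so constant fields are
      solutions.\<close>
    have "linear_transport B 0 (\<lambda>t. u)"
      by (simp add: linear_transport_def linear_0[OF lin(1)])
    from \<Phi>[OF _ this] have \<Phi>0: "\<Phi> (0, u) = u" using \<delta>(1) by simp
    show "(\<Phi> has_derivative (\<lambda>z. snd z + B 0 (fst z) u)) (at (0, u))"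
      unfolding has_derivative_at_alt
    proof (intro conjI allI impI)
      have "bounded_linear (\<lambda>a. B 0 a u)" using lin(1) linear_conv_bounded_linear by blast
      then show "bounded_linear (\<lambda>z. snd z + B 0 (fst z) u)"
        by (rule bounded_linear_add[OF bounded_linear_snd bounded_linear_compose[OF _ bounded_linear_fst]])
      fix \<epsilon> :: real assume \<epsilon>: "\<epsilon> > 0"
      define U where "U = norm u + 1"
      have U: "U > 0" by (simp add: U_def add_nonneg_pos)
      \<comment> \<open>Solutions stay below \<open>2 * U\<close> in norm, so a deviation
        \<open>\<epsilon> / (4 * U)\<close> of \<open>B\<close> from \<open>B 0\<close> contributes
        at most half of \<open>\<epsilon> * norm w\<close>.\<close>
      obtain \<delta>2 where \<delta>2: "\<delta>2 > 0"
        "\<And>x a e. x \<in> ball 0 \<delta>2 \<Longrightarrow> norm (B x a e - B 0 a e) \<le> \<epsilon> / (4 * U) * norm a * norm e"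
        using near[of "\<epsilon> / (4 * U)"] \<epsilon> U unfolding eventually_nhds_metric by (auto simp: dist_commute)
      \<comment> \<open>The entry 1 keeps \<open>norm y\<close> below \<open>U\<close>. The last
        entry bounds the other half of the error, which comes from replacing \<open>V t\<close> by
        \<open>u\<close> in \<open>B 0 w\<close>: their distance is at most
        \<open>(2 * C * U + 1) * d\<close>.\<close>
      define d where "d = min (min \<delta> \<delta>2) (min 1 (\<epsilon> / (2 * (C * (2 * C * U + 1)))))"
      have K: "C * (2 * C * U + 1) > 0" using C U by (simp add: add_pos_pos)
      have d: "d > 0" "d \<le> \<delta>" "d \<le> \<delta>2" "d \<le> 1" using \<delta>(1) \<delta>2(1) \<epsilon> K by (auto simp: d_def)
      have d2: "C * (2 * C * U + 1) * d \<le> \<epsilon> / 2"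
      proof -
        have "d \<le> \<epsilon> / (2 * (C * (2 * C * U + 1)))" by (simp add: d_def)
        moreover have "k * (\<epsilon> / (2 * k)) = \<epsilon> / 2" if "k > 0" for k :: real using that by simp
        ultimately show ?thesis using mult_left_mono[OF _ less_imp_le[OF K]] K by metis
      qed
      have "norm (\<Phi> z - \<Phi> (0, u) - (snd (z - (0, u)) + B 0 (fst (z - (0, u))) u)) \<le> \<epsilon> * norm (z - (0, u))"
        if z: "norm (z - (0, u)) < d" for z
      proof -
        obtain w y where zw: "z = (w, y)" by (cases z)
        have w: "norm w < d" and y: "norm (y - u) < d"
          using norm_fst_le[of "w" "y - u"] norm_snd_le[of "y - u" w] z unfolding zw by auto
        have wb: "w \<in> ball 0 \<delta>" using w d by simp
        obtain V where V: "linear_transport B w V" "V 0 = y" "\<Phi> (w, y) = V 1" using sol[OF wb] by blast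
        have yU: "norm y \<le> U" using norm_triangle_sub[of y u] y d(4) by (simp add: U_def)
        \<comment> \<open>Subtracting the expected first-order term
          \<open>t *\<^sub>R B 0 w u\<close> from the solution leaves a curve whose derivative is
          small on all of \<open>{0..1}\<close>.\<close>
        have "norm ((V 1 - 1 *\<^sub>R B 0 w u) - (V 0 - 0 *\<^sub>R B 0 w u)) \<le> \<epsilon> * norm w * \<bar>1 - 0\<bar>"
        proof (rule has_vector_derivative_norm_bound)
          fix t :: real assume t: "t \<in> {0..1}"
          show "((\<lambda>t. V t - t *\<^sub>R B 0 w u) has_vector_derivative B ((1 - t) *\<^sub>R w) w (V t) - B 0 w u) (at t within {0..1})"
          proof (rule has_vector_derivative_diff)
            show "(V has_vector_derivative B ((1 - t) *\<^sub>R w) w (V t)) (at t within {0..1})"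
              using V(1) t unfolding linear_transport_def by blast
            show "((\<lambda>t. t *\<^sub>R B 0 w u) has_vector_derivative B 0 w u) (at t within {0..1})"
              using has_vector_derivative_scaleR[OF DERIV_ident has_vector_derivative_const] by simp
          qed
          have "(1 - t) *\<^sub>R w \<in> ball 0 \<delta>2"
            using t w d(3) mult_left_le_one_le[of "norm w" "1 - t"] by auto
          then have 1: "norm (B ((1 - t) *\<^sub>R w) w (V t) - B 0 w (V t)) \<le> \<epsilon> / (4 * U) * norm w * norm (V t)"
            by (rule \<delta>2(2))
          have "norm (V t) \<le> 2 * U" using bd(1)[OF _ wb wb V(1) t] yU V(2) by simp
          then have "\<epsilon> / (4 * U) * norm w * norm (V t) \<le> \<epsilon> / (4 * U) * norm w * (2 * U)"
            using \<epsilon> U by (intro mult_left_mono) auto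
          then have 1: "norm (B ((1 - t) *\<^sub>R w) w (V t) - B 0 w (V t)) \<le> \<epsilon> / 2 * norm w"
          proof -
            have "\<epsilon> / (4 * U) * norm w * (2 * U) = \<epsilon> / 2 * norm w" using U by (simp add: field_simps)
            with 1 \<open>\<epsilon> / (4 * U) * norm w * norm (V t) \<le> _\<close> show ?thesis by linarith
          qed
          have "norm (V t - u) \<le> norm (V t - y) + norm (y - u)"
            using norm_triangle_ineq[of "V t - y" "y - u"] by simp
          also have "\<dots> \<le> 2 * C * d * U + d"
          proof (intro add_mono)
            have "norm (V t - y) \<le> 2 * C * norm w * norm y" using bd(2)[OF _ wb wb V(1) t] V(2) by simp
            also have "\<dots> \<le> 2 * C * d * U" using C w yU d(1) by (intro mult_mono) auto
            finally show "norm (V t - y) \<le> 2 * C * d * U" .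
          qed (use y in simp)
          finally have Vu: "norm (V t - u) \<le> (2 * C * U + 1) * d" by (simp add: algebra_simps)
          have "B 0 w (V t) - B 0 w u = B 0 w (V t - u)" by (simp add: linear_diff[OF lin(2)])
          then have "norm (B 0 w (V t) - B 0 w u) \<le> C * norm w * norm (V t - u)"
            using BC[of 0 w "V t - u"] \<delta>(1) by simp
          also have "\<dots> \<le> C * norm w * ((2 * C * U + 1) * d)" using C Vu by (intro mult_left_mono) auto
          also have "\<dots> = (C * (2 * C * U + 1) * d) * norm w" by simp
          also have "\<dots> \<le> \<epsilon> / 2 * norm w" using d2 by (intro mult_right_mono) auto
          finally have 2: "norm (B 0 w (V t) - B 0 w u) \<le> \<epsilon> / 2 * norm w" .
          have "norm (B ((1 - t) *\<^sub>R w) w (V t) - B 0 w u) \<le>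
              norm (B ((1 - t) *\<^sub>R w) w (V t) - B 0 w (V t)) + norm (B 0 w (V t) - B 0 w u)"
            using norm_triangle_ineq[of "B ((1 - t) *\<^sub>R w) w (V t) - B 0 w (V t)" "B 0 w (V t) - B 0 w u"] by simp
          with 1 2 show "norm (B ((1 - t) *\<^sub>R w) w (V t) - B 0 w u) \<le> \<epsilon> * norm w" by simp
        qed auto
        then have "norm (V 1 - y - B 0 w u) \<le> \<epsilon> * norm w" using V(2) by (simp add: algebra_simps)
        also have "\<dots> \<le> \<epsilon> * norm (z - (0, u))" using norm_fst_le[of w "y - u"] \<epsilon> by (simp add: zw)
        finally show ?thesis by (simp add: zw V(3) \<Phi>0 algebra_simps)
      qed
      with d(1) show "\<exists>d>0. \<forall>z. norm (z - (0, u)) < d \<longrightarrow>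
          norm (\<Phi> z - \<Phi> (0, u) - (snd (z - (0, u)) + B 0 (fst (z - (0, u))) u)) \<le> \<epsilon> * norm (z - (0, u))"
        by blast
    qed
  qed
qed

section \<open>Charts and tangent vectors\<close>

lemma chart_inv_right: "x \<in> snd c ` fst c \<Longrightarrow> snd c (chart_inv c x) = x"
  and chart_inv_in: "x \<in> snd c ` fst c \<Longrightarrow> chart_inv c x \<in> fst c"
  by (simp_all add: chart_inv_def f_inv_into_f inv_into_into)

context
  fixes A :: "('a, 'e::euclidean_space) chart set"
  assumes atlas: "smooth_atlas A"
begin

lemma chart_inj: "c \<in> A \<Longrightarrow> inj_on (snd c) (fst c)"
  using atlas by (auto simp: smooth_atlas_def)

lemma chart_inv_left: "c \<in> A \<Longrightarrow> p \<in> fst c \<Longrightarrow> chart_inv c (snd c p) = p"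
  using chart_inj by (simp add: chart_inv_def)

lemma open_chart_image: "c \<in> A \<Longrightarrow> open (snd c ` fst c)"
  using atlas by (auto simp: smooth_atlas_def)

lemma open_chart_overlap: "c \<in> A \<Longrightarrow> d \<in> A \<Longrightarrow> open (snd c ` (fst c \<inter> fst d))"
  using atlas by (auto simp: smooth_atlas_def)

lemma smooth_transition:
  "c \<in> A \<Longrightarrow> d \<in> A \<Longrightarrow> smooth_on (snd c ` (fst c \<inter> fst d)) (snd d \<circ> chart_inv c)"
  using atlas by (auto simp: smooth_atlas_def)

lemma chart_image_Int:
  assumes c: "c \<in> A" shows "snd c ` (fst c \<inter> W) = {x \<in> snd c ` fst c. chart_inv c x \<in> W}"
proof (intro set_eqI iffI)
  fix x assume "x \<in> {x \<in> snd c ` fst c. chart_inv c x \<in> W}"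
  then show "x \<in> snd c ` (fst c \<inter> W)"
    by (intro image_eqI[of x _ "chart_inv c x"]) (simp_all add: chart_inv_right chart_inv_in)
qed (auto simp: chart_inv_left[OF c])

text \<open>Injectivity of the charts makes images commute with intersections; this is how the
  family in the definition is seen to be a topology.\<close>

lemma openin_manifold:
  "openin (manifold_topology A) W \<longleftrightarrow> W \<subseteq> carrier A \<and> (\<forall>c\<in>A. open (snd c ` (fst c \<inter> W)))"
proof -
  have "istopology (\<lambda>S. S \<subseteq> carrier A \<and> (\<forall>c\<in>A. open (snd c ` (fst c \<inter> S))))"
    unfolding istopology_def
  proof (intro conjI allI impI ballI)
    fix S T c assume *: "S \<subseteq> carrier A \<and> (\<forall>c\<in>A. open (snd c ` (fst c \<inter> S)))"
      "T \<subseteq> carrier A \<and> (\<forall>c\<in>A. open (snd c ` (fst c \<inter> T)))" and c: "c \<in> A"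
    have "snd c ` (fst c \<inter> (S \<inter> T)) = snd c ` (fst c \<inter> S) \<inter> snd c ` (fst c \<inter> T)"
      by (auto simp: chart_image_Int[OF c])
    with * c show "open (snd c ` (fst c \<inter> (S \<inter> T)))" by (simp add: open_Int)
  next
    fix \<K> c assume *: "\<forall>S\<in>\<K>. S \<subseteq> carrier A \<and> (\<forall>c\<in>A. open (snd c ` (fst c \<inter> S)))" and c: "c \<in> A"
    have "snd c ` (fst c \<inter> \<Union>\<K>) = (\<Union>S\<in>\<K>. snd c ` (fst c \<inter> S))" by blast
    with * c show "open (snd c ` (fst c \<inter> \<Union>\<K>))" by (simp add: open_UN)
  qed blast+
  then show ?thesis unfolding manifold_topology_def by (simp add: topology_inverse')
qed

lemma chart_subset_carrier: "c \<in> A \<Longrightarrow> fst c \<subseteq> carrier A"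
  by (auto simp: carrier_def)

lemma openin_chart_image: "openin (manifold_topology A) W \<Longrightarrow> c \<in> A \<Longrightarrow> open (snd c ` (fst c \<inter> W))"
  by (simp add: openin_manifold)

lemma openin_carrier: "openin (manifold_topology A) (carrier A)"
  unfolding openin_manifold using chart_subset_carrier open_chart_image
  by (metis inf.absorb1 order_refl)

lemma topspace_manifold: "topspace (manifold_topology A) = carrier A"
  using openin_carrier openin_manifold by (metis openin_subset openin_topspace subset_antisym)

lemma openin_chart: "c \<in> A \<Longrightarrow> openin (manifold_topology A) (fst c)"
  unfolding openin_manifold using chart_subset_carrier open_chart_overlap by auto

lemma openin_chart_preimage:
  assumes c: "c \<in> A" and S: "open S"
  shows "openin (manifold_topology A) {p \<in> fst c. snd c p \<in> S}"
  unfolding openin_manifold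
proof (intro conjI ballI)
  show "{p \<in> fst c. snd c p \<in> S} \<subseteq> carrier A" using chart_subset_carrier[OF c] by blast
  fix d assume d: "d \<in> A"
  have eq: "snd d ` (fst d \<inter> {p \<in> fst c. snd c p \<in> S})
      = snd d ` (fst d \<inter> fst c) \<inter> (snd c \<circ> chart_inv d) -` S"
    by (auto simp: chart_inv_left[OF d])
  have "continuous_on (snd d ` (fst d \<inter> fst c)) (snd c \<circ> chart_inv d)"
    by (rule smooth_on_continuous[OF smooth_transition[OF d c]])
  then show "open (snd d ` (fst d \<inter> {p \<in> fst c. snd c p \<in> S}))"
    unfolding eq using open_chart_overlap[OF d c] S by (rule continuous_open_preimage)
qed

lemma transition_differentiable:
  assumes "c \<in> A" "d \<in> A" "p \<in> fst c" "p \<in> fst d"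
  shows "(snd d \<circ> chart_inv c) differentiable (at (snd c p))"
  using smooth_on_differentiable[OF smooth_transition] assms by blast

lemma transition_linear:
  assumes "c \<in> A" "d \<in> A" "p \<in> fst c" "p \<in> fst d"
  shows "linear (frechet_derivative (snd d \<circ> chart_inv c) (at (snd c p)))"
  using linear_frechet_derivative[OF transition_differentiable[OF assms]] .

text \<open>The chain rule through a change of chart, for arbitrary \<open>g\<close> on the
  manifold. With \<open>g\<close> a coordinate map it yields the cocycle rule; for other
  \<open>g\<close> it yields the independence of directional derivatives and differentials from the
  chart.\<close>

lemma frechet_derivative_change_chart:
  assumes c: "c \<in> A" "p \<in> fst c" and d: "d \<in> A" "p \<in> fst d"
    and g: "(g \<circ> chart_inv d) differentiable (at (snd d p))"
  shows "((g \<circ> chart_inv c) has_derivative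
      (\<lambda>v. frechet_derivative (g \<circ> chart_inv d) (at (snd d p))
         (frechet_derivative (snd d \<circ> chart_inv c) (at (snd c p)) v))) (at (snd c p))"
proof -
  have "(snd d \<circ> chart_inv c) (snd c p) = snd d p" using chart_inv_left c by simp
  then have "((g \<circ> chart_inv d) \<circ> (snd d \<circ> chart_inv c) has_derivative
      (frechet_derivative (g \<circ> chart_inv d) (at (snd d p)) \<circ>
         frechet_derivative (snd d \<circ> chart_inv c) (at (snd c p)))) (at (snd c p))"
    using transition_differentiable[OF c(1) d(1) c(2) d(2)] g
    by (intro diff_chain_at) (simp_all flip: frechet_derivative_works)
  then have "((g \<circ> chart_inv c) has_derivative
      (frechet_derivative (g \<circ> chart_inv d) (at (snd d p)) \<circ>
         frechet_derivative (snd d \<circ> chart_inv c) (at (snd c p)))) (at (snd c p))"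
    by (rule has_derivative_transform_within_open[OF _ open_chart_overlap[OF c(1) d(1)]])
      (use c d in \<open>auto simp: chart_inv_left\<close>)
  then show ?thesis by (simp add: o_def)
qed

text \<open>Consistency of the passage through \<open>c\<close> is what makes the values of
  \<open>coordinate_field\<close> in all charts form one tangent vector.\<close>

lemma transition_cocycle:
  assumes "b \<in> A" "c \<in> A" "d \<in> A" "p \<in> fst b" "p \<in> fst c" "p \<in> fst d"
  shows "frechet_derivative (snd d \<circ> chart_inv c) (at (snd c p))
      (frechet_derivative (snd c \<circ> chart_inv b) (at (snd b p)) v) =
    frechet_derivative (snd d \<circ> chart_inv b) (at (snd b p)) v"
  using frechet_derivative_eq[OF frechet_derivative_change_chart] transition_differentiable assms by metis

lemma transition_same:
  assumes c: "c \<in> A" "p \<in> fst c"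
  shows "frechet_derivative (snd c \<circ> chart_inv c) (at (snd c p)) v = v"
proof -
  have "((snd c \<circ> chart_inv c) has_derivative (\<lambda>v. v)) (at (snd c p))"
    by (rule has_derivative_transform_within_open[OF has_derivative_ident open_chart_image[OF c(1)]])
      (use c in \<open>simp_all add: chart_inv_right\<close>)
  then show ?thesis by (simp add: frechet_derivative_eq)
qed

section \<open>The linear structure of tangent spaces and their identification with coordinate
  vectors\<close>

lemma tangent_spaceI:
  assumes "\<And>c. c \<notin> A \<or> p \<notin> fst c \<Longrightarrow> v c = 0"
    and "\<And>c d. c \<in> A \<Longrightarrow> d \<in> A \<Longrightarrow> p \<in> fst c \<Longrightarrow> p \<in> fst d \<Longrightarrow>
      v d = frechet_derivative (snd d \<circ> chart_inv c) (at (snd c p)) (v c)"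
  shows "v \<in> tangent_space A p"
  unfolding tangent_space_def using assms by blast

lemma tangent_change_chart:
  "v \<in> tangent_space A p \<Longrightarrow> c \<in> A \<Longrightarrow> d \<in> A \<Longrightarrow> p \<in> fst c \<Longrightarrow> p \<in> fst d \<Longrightarrow>
    v d = frechet_derivative (snd d \<circ> chart_inv c) (at (snd c p)) (v c)"
  unfolding tangent_space_def by blast

lemma tangent_outside: "v \<in> tangent_space A p \<Longrightarrow> c \<notin> A \<or> p \<notin> fst c \<Longrightarrow> v c = 0"
  unfolding tangent_space_def by blast

lemma coordinate_field_tangent:
  assumes "c \<in> A" "p \<in> fst c" shows "coordinate_field A c v p \<in> tangent_space A p"
  by (rule tangent_spaceI) (use assms in \<open>auto simp: coordinate_field_def transition_cocycle\<close>)

lemma coordinate_field_same: "c \<in> A \<Longrightarrow> p \<in> fst c \<Longrightarrow> coordinate_field A c v p c = v"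
  by (simp add: coordinate_field_def transition_same)

text \<open>A tangent vector can be recovered from a single chart, so an equation between tangent
  vectors may be checked in whichever chart is convenient. Nearly all later identities are proved in
  this way.\<close>

lemma tangent_eq_coordinate_field:
  assumes "v \<in> tangent_space A p" "c \<in> A" "p \<in> fst c"
  shows "v = coordinate_field A c (v c) p"
proof
  fix d show "v d = coordinate_field A c (v c) p d"
    using assms tangent_change_chart[OF assms(1,2), of d] tangent_outside[OF assms(1), of d]
    by (simp add: coordinate_field_def)
qed

lemma tangent_eqI:
  "v \<in> tangent_space A p \<Longrightarrow> w \<in> tangent_space A p \<Longrightarrow> c \<in> A \<Longrightarrow> p \<in> fst c \<Longrightarrow> v c = w c \<Longrightarrow> v = w"
  using tangent_eq_coordinate_field by metis

lemma tangent_add: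
  assumes "v \<in> tangent_space A p" "w \<in> tangent_space A p" shows "v + w \<in> tangent_space A p"
proof (rule tangent_spaceI)
  fix c d assume "c \<in> A" "d \<in> A" "p \<in> fst c" "p \<in> fst d"
  then show "(v + w) d = frechet_derivative (snd d \<circ> chart_inv c) (at (snd c p)) ((v + w) c)"
    by (simp add: linear_add[OF transition_linear] tangent_change_chart[OF assms(1), of c d] tangent_change_chart[OF assms(2), of c d])
qed (simp add: tangent_outside[OF assms(1)] tangent_outside[OF assms(2)])

lemma tangent_scaleR: 
  assumes "v \<in> tangent_space A p" shows "r *\<^sub>R v \<in> tangent_space A p"
proof (rule tangent_spaceI)
  fix c d assume "c \<in> A" "d \<in> A" "p \<in> fst c" "p \<in> fst d"
  then show "(r *\<^sub>R v) d = frechet_derivative (snd d \<circ> chart_inv c) (at (snd c p)) ((r *\<^sub>R v) c)"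
    by (simp add: scaleR_fun_def linear_cmul[OF transition_linear] tangent_change_chart[OF assms(1), of c d])
qed (simp add: scaleR_fun_def tangent_outside[OF assms(1)])

lemma tangent_zero: "0 \<in> tangent_space A p"
  by (rule tangent_spaceI) (simp_all add: linear_0[OF transition_linear])

lemma tangent_minus: "v \<in> tangent_space A p \<Longrightarrow> - v \<in> tangent_space A p"
  using tangent_scaleR[of v p "-1"] by simp

lemma tangent_diff:
  "v \<in> tangent_space A p \<Longrightarrow> w \<in> tangent_space A p \<Longrightarrow> v - w \<in> tangent_space A p"
  using tangent_add[of v p "- w"] tangent_minus by simp

lemma tangent_sum:
  "(\<And>i. i \<in> I \<Longrightarrow> v i \<in> tangent_space A p) \<Longrightarrow> (\<Sum>i\<in>I. v i) \<in> tangent_space A p"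
  by (induction I rule: infinite_finite_induct) (auto intro: tangent_zero tangent_add)

lemma chart_at: 
  assumes "p \<in> carrier A" shows "chart_at A p \<in> A" "p \<in> fst (chart_at A p)"
proof -
  have "\<exists>c. c \<in> A \<and> p \<in> fst c" using assms by (auto simp: carrier_def)
  from someI_ex[OF this] show "chart_at A p \<in> A" "p \<in> fst (chart_at A p)" by (simp_all add: chart_at_def)
qed

text \<open>Differentials and directional derivatives are defined through the chart selected by
  \<open>chart_at\<close>; the transformation of the vector and that of the derivative compensate
  each other, so any chart may be used instead.\<close>

lemma frechet_derivative_tangent:
  assumes v: "v \<in> tangent_space A p" and c: "c \<in> A" "p \<in> fst c"
    and g: "(g \<circ> chart_inv c) differentiable (at (snd c p))"
  shows "frechet_derivative (g \<circ> chart_inv (chart_at A p)) (at (snd (chart_at A p) p)) (v (chart_at A p)) =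
    frechet_derivative (g \<circ> chart_inv c) (at (snd c p)) (v c)"
proof -
  have "p \<in> carrier A" using c chart_subset_carrier by blast
  note a = chart_at[OF this]
  show ?thesis
    using frechet_derivative_eq[OF frechet_derivative_change_chart[OF a c g]]
      tangent_change_chart[OF v a(1) c(1) a(2) c(2)] by simp
qed

lemma directional_derivative_chart:
  assumes "v \<in> tangent_space A p" "c \<in> A" "p \<in> fst c" "(f \<circ> chart_inv c) differentiable (at (snd c p))"
  shows "directional_derivative A p v f = frechet_derivative (f \<circ> chart_inv c) (at (snd c p)) (v c)"
  using frechet_derivative_tangent[OF assms] by (simp add: directional_derivative_def Let_def)

lemma differential_chart:
  assumes "v \<in> tangent_space A p" "c \<in> A" "p \<in> fst c" "d \<in> B" "f p \<in> fst d"
    and "((snd d \<circ> f \<circ> chart_inv c) has_derivative f') (at (snd c p))"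
  shows "differential A B f p v d = f' (v c)"
  using frechet_derivative_tangent[OF assms(1-3), of "snd d \<circ> f"] frechet_derivative_eq[OF assms(6)] assms(4-6)
  by (auto simp: differential_def Let_def differentiable_def o_assoc)

section \<open>Smooth functions and vector fields\<close>

lemma smooth_on_change_chart:
  assumes c: "c \<in> A" and d: "d \<in> A" and W: "openin (manifold_topology A) W" "W \<subseteq> fst c"
    and f: "smooth_on (snd c ` W) f"
  shows "smooth_on (snd d ` (fst d \<inter> W)) (\<lambda>y. f (snd c (chart_inv d y)))"
proof (rule smooth_on_compose[OF _ _ _ _ f])
  show "open (snd d ` (fst d \<inter> W))" "open (snd c ` W)"
    using openin_chart_image[OF W(1) c] openin_chart_image[OF W(1) d] W(2) by (simp_all add: Int_absorb1)
  show "(\<lambda>y. snd c (chart_inv d y)) ` snd d ` (fst d \<inter> W) \<subseteq> snd c ` W"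
    using chart_inv_left[OF d] by auto
  have "smooth_on (snd d ` (fst d \<inter> W)) (snd c \<circ> chart_inv d)"
    by (rule smooth_on_subset[OF smooth_transition[OF d c]]) (use W(2) in auto)
  then show "smooth_on (snd d ` (fst d \<inter> W)) (\<lambda>y. snd c (chart_inv d y))" by (simp add: o_def)
qed

lemma smooth_functionI:
  assumes c: "c \<in> A" and W: "openin (manifold_topology A) W" "W \<subseteq> fst c"
    and f: "smooth_on (snd c ` W) (\<lambda>x. f (chart_inv c x))"
  shows "smooth_function A W f"
  unfolding smooth_function_def
proof
  fix d assume d: "d \<in> A"
  show "smooth_on (snd d ` (fst d \<inter> W)) (f \<circ> chart_inv d)"
    by (rule smooth_on_cong[OF openin_chart_image[OF W(1) d] smooth_on_change_chart[OF c d W f]])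
      (use W(2) c d in \<open>auto simp: chart_inv_left subset_iff\<close>)
qed

text \<open>Smoothness in one chart covering \<open>W\<close> is enough: the components in another
  chart arise by applying the derivative of the transition, which depends smoothly on the point and
  linearly on the vector.\<close>

lemma smooth_vector_fieldI:
  assumes c: "c \<in> A" and W: "openin (manifold_topology A) W" "W \<subseteq> fst c"
    and X: "\<And>p. p \<in> W \<Longrightarrow> X p \<in> tangent_space A p"
    and f: "smooth_on (snd c ` W) (\<lambda>x. X (chart_inv c x) c)"
  shows "smooth_vector_field A W X"
  unfolding smooth_vector_field_def
proof (intro conjI ballI X)
  fix d assume d: "d \<in> A"
  have Wd: "openin (manifold_topology A) (W \<inter> fst d)" using W(1) openin_chart[OF d] by (rule openin_Int)
  have Wd': "W \<inter> fst d \<subseteq> fst c" using W(2) by blast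
  have o: "open (snd c ` (W \<inter> fst d))" using openin_chart_image[OF Wd c] Wd' by (simp add: Int_absorb1)
  let ?D = "\<lambda>x. frechet_derivative (snd d \<circ> chart_inv c) (at x)"
  have tr: "smooth_on (snd c ` (W \<inter> fst d)) (snd d \<circ> chart_inv c)"
    by (rule smooth_on_subset[OF smooth_transition[OF c d]]) (use W(2) in auto)
  have "smooth_on (snd c ` (W \<inter> fst d)) (\<lambda>x. ?D x (X (chart_inv c x) c))"
  proof (rule smooth_on_linear_family[OF o, where \<Phi> = ?D])
    show "smooth_on (snd c ` (W \<inter> fst d)) (\<lambda>x. X (chart_inv c x) c)"
      by (rule smooth_on_subset[OF f]) blast
    show "smooth_on (snd c ` (W \<inter> fst d)) (\<lambda>x. ?D x e)" for e
      by (rule smooth_on_frechet_derivative[OF tr])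
    show "linear (?D x)" if "x \<in> snd c ` (W \<inter> fst d)" for x
      using transition_linear[OF c d] that W(2) by blast
  qed
  from smooth_on_change_chart[OF c d Wd Wd' this]
  have *: "smooth_on (snd d ` (fst d \<inter> W))
     (\<lambda>y. ?D (snd c (chart_inv d y)) (X (chart_inv c (snd c (chart_inv d y))) c))"
    by (simp add: Int_ac)
  show "smooth_on (snd d ` (fst d \<inter> W)) (\<lambda>x. X (chart_inv d x) d)"
  proof (rule smooth_on_cong[OF openin_chart_image[OF W(1) d] *])
    fix y assume "y \<in> snd d ` (fst d \<inter> W)"
    then obtain q where "q \<in> fst d" "q \<in> W" "y = snd d q" by blast
    then show "?D (snd c (chart_inv d y)) (X (chart_inv c (snd c (chart_inv d y))) c) = X (chart_inv d y) d"
      using chart_inv_left[OF d] chart_inv_left[OF c] W(2) tangent_change_chart[OF X c d] by auto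
  qed
qed

lemma smooth_vector_fieldD:
  assumes "smooth_vector_field A W X"
  shows "p \<in> W \<Longrightarrow> X p \<in> tangent_space A p"
    and "c \<in> A \<Longrightarrow> smooth_on (snd c ` (fst c \<inter> W)) (\<lambda>x. X (chart_inv c x) c)"
  using assms by (auto simp: smooth_vector_field_def)

lemma smooth_vector_field_subset:
  "smooth_vector_field A W X \<Longrightarrow> V \<subseteq> W \<Longrightarrow> smooth_vector_field A V X"
  unfolding smooth_vector_field_def by (meson Int_mono image_mono order_refl smooth_on_subset subsetD)

lemma smooth_vector_field_cong:
  assumes X: "smooth_vector_field A W X" and W: "openin (manifold_topology A) W"
    and eq: "\<And>p. p \<in> W \<Longrightarrow> X p = Y p"
  shows "smooth_vector_field A W Y"
  unfolding smooth_vector_field_def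
proof (intro conjI ballI)
  fix p assume "p \<in> W"
  then show "Y p \<in> tangent_space A p" using eq smooth_vector_fieldD(1)[OF X] by metis
next
  fix c assume c: "c \<in> A"
  show "smooth_on (snd c ` (fst c \<inter> W)) (\<lambda>x. Y (chart_inv c x) c)"
    by (rule smooth_on_cong[OF openin_chart_image[OF W c] smooth_vector_fieldD(2)[OF X c]])
      (use eq in \<open>auto simp: chart_inv_left[OF c]\<close>)
qed

lemma smooth_vector_field_add:
  assumes "smooth_vector_field A W X" "smooth_vector_field A W Y" "openin (manifold_topology A) W"
  shows "smooth_vector_field A W (\<lambda>p. X p + Y p)"
  using assms openin_chart_image[OF assms(3)] unfolding smooth_vector_field_def
  by (auto intro: tangent_add smooth_on_add)

lemma smooth_vector_field_diff:
  assumes "smooth_vector_field A W X" "smooth_vector_field A W Y" "openin (manifold_topology A) W"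
  shows "smooth_vector_field A W (\<lambda>p. X p - Y p)"
  using assms openin_chart_image[OF assms(3)] unfolding smooth_vector_field_def
  by (auto intro: tangent_diff smooth_on_diff)

lemma smooth_vector_field_zero:
  assumes "openin (manifold_topology A) W" shows "smooth_vector_field A W (\<lambda>p. 0)"
  using openin_chart_image[OF assms] unfolding smooth_vector_field_def
  by (auto intro: tangent_zero smooth_on_const)

lemma smooth_vector_field_scaleR:
  assumes "smooth_function A W f" "smooth_vector_field A W X" "openin (manifold_topology A) W"
  shows "smooth_vector_field A W (\<lambda>p. f p *\<^sub>R X p)"
  unfolding smooth_vector_field_def
proof (intro conjI ballI)
  show "f p *\<^sub>R X p \<in> tangent_space A p" if "p \<in> W" for p
    using tangent_scaleR smooth_vector_fieldD(1)[OF assms(2) that] .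
  show "smooth_on (snd c ` (fst c \<inter> W)) (\<lambda>x. (f (chart_inv c x) *\<^sub>R X (chart_inv c x)) c)" if "c \<in> A" for c
    using smooth_on_scaleR[OF openin_chart_image[OF assms(3) that] _ smooth_vector_fieldD(2)[OF assms(2) that]] 
      assms(1) that by (simp add: scaleR_fun_def smooth_function_def o_def)
qed

lemma smooth_vector_field_sum:
  assumes "\<And>i. i \<in> I \<Longrightarrow> smooth_vector_field A W (X i)" "openin (manifold_topology A) W"
  shows "smooth_vector_field A W (\<lambda>p. \<Sum>i\<in>I. X i p)"
  using assms(1)
proof (induction I rule: infinite_finite_induct)
  case (insert i I)
  then have "smooth_vector_field A W (\<lambda>p. X i p + (\<Sum>i\<in>I. X i p))"
    by (intro smooth_vector_field_add assms(2)) auto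
  then show ?case by (simp only: sum.insert[OF insert.hyps])
qed (simp_all add: smooth_vector_field_zero[OF assms(2)])

lemma smooth_coordinate_field:
  assumes c: "c \<in> A" shows "smooth_vector_field A (fst c) (coordinate_field A c v)"
proof (rule smooth_vector_fieldI[OF c openin_chart[OF c]])
  show "smooth_on (snd c ` fst c) (\<lambda>x. coordinate_field A c v (chart_inv c x) c)"
    by (rule smooth_on_cong[OF open_chart_image[OF c] smooth_on_const[OF open_chart_image[OF c], of v]])
      (simp add: coordinate_field_same[OF c] chart_inv_in)
qed (use coordinate_field_tangent[OF c] in auto)

end

section \<open>Families of bilinear maps\<close>

lemma smooth_on_bilinear_family:
  fixes \<Gamma> :: "'a::euclidean_space \<Rightarrow> 'b::euclidean_space \<Rightarrow> 'b \<Rightarrow> 'c::real_normed_vector"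
  assumes S: "open S" and bil: "\<And>x. x \<in> S \<Longrightarrow> bilinear (\<Gamma> x)"
    and sm: "\<And>v w. smooth_on S (\<lambda>x. \<Gamma> x v w)" "smooth_on S f" "smooth_on S g"
  shows "smooth_on S (\<lambda>x. \<Gamma> x (f x) (g x))"
proof (rule smooth_on_linear_family[OF S, where \<Phi> = "\<lambda>x. \<Gamma> x (f x)", OF _ _ sm(3)])
  show "linear (\<Gamma> x (f x))" if "x \<in> S" for x using bil[OF that] by (simp add: bilinear_def)
  show "smooth_on S (\<lambda>x. \<Gamma> x (f x) e)" for e
    by (rule smooth_on_linear_family[OF S, where \<Phi> = "\<lambda>x v. \<Gamma> x v e", OF _ _ sm(2)])
      (use bil sm(1) in \<open>auto simp: bilinear_def\<close>)
qed

text \<open>The rule for linear families is used twice: for \<open>v\<close> with parameter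
  \<open>x\<close>, and then for the last argument with the pair of \<open>x\<close> and
  \<open>v\<close> as the parameter.\<close>

lemma has_derivative_bilinear_family:
  fixes \<Gamma> :: "'a::real_normed_vector \<Rightarrow> 'b::euclidean_space \<Rightarrow> 'b \<Rightarrow> 'c::real_normed_vector"
  assumes S: "open S" "h y \<in> S" and bil: "\<And>x. x \<in> S \<Longrightarrow> bilinear (\<Gamma> x)"
    and d: "\<And>v w. (\<lambda>x. \<Gamma> x v w) differentiable (at (h y))"
    and h: "(h has_derivative h') (at y)" and f: "(f has_derivative f') (at y)"
    and g: "(g has_derivative g') (at y)"
  shows "((\<lambda>y. \<Gamma> (h y) (f y) (g y)) has_derivative
     (\<lambda>a. frechet_derivative (\<lambda>x. \<Gamma> x (f y) (g y)) (at (h y)) (h' a) + \<Gamma> (h y) (f' a) (g y) + \<Gamma> (h y) (f y) (g' a))) (at y)"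
proof -
  have T: "open ((\<lambda>z::'a \<times> 'b. fst z) -` S)"
    by (intro open_vimage S continuous_intros)
  let ?\<Phi> = "\<lambda>z. \<Gamma> (fst z) (snd z)"
  have dv: "((\<lambda>z. \<Gamma> (fst z) (snd z) e) has_derivative
     (\<lambda>z. frechet_derivative (\<lambda>x. \<Gamma> x (f y) e) (at (h y)) (fst z) + \<Gamma> (h y) (snd z) e)) (at (h y, f y))" for e
    by (rule has_derivative_linear_family[OF S, where \<Phi> = "\<lambda>x v. \<Gamma> x v e"])
      (use bil d in \<open>auto simp: bilinear_def\<close>)
  have "((\<lambda>y. \<Gamma> (fst (h y, f y)) (snd (h y, f y)) (g y)) has_derivative
     (\<lambda>a. frechet_derivative (\<lambda>z. \<Gamma> (fst z) (snd z) (g y)) (at (h y, f y)) (h' a, f' a) + \<Gamma> (fst (h y, f y)) (snd (h y, f y)) (g' a))) (at y)"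
  proof (rule has_derivative_linear_family_compose[OF T, where \<Phi> = ?\<Phi>])
    show "linear (\<Gamma> (fst z) (snd z))" if "z \<in> (\<lambda>z. fst z) -` S" for z
      using bil[of "fst z"] that by (auto simp: bilinear_def)
    show "(\<lambda>z. \<Gamma> (fst z) (snd z) e) differentiable at (h y, f y)" for e
      using dv differentiable_def by blast
  qed (use S in \<open>auto intro: has_derivative_Pair h f g\<close>)
  then show ?thesis by (simp add: frechet_derivative_eq[OF dv])
qed

lemma bilinearD:
  assumes "bilinear f"
  shows "f (x + y) z = f x z + f y z" "f z (x + y) = f z x + f z y"
    "f (x - y) z = f x z - f y z" "f z (x - y) = f z x - f z y"
    "f (- x) z = - f x z" "f z (- x) = - f z x" "f 0 z = 0" "f z 0 = 0"
    "f (r *\<^sub>R x) z = r *\<^sub>R f x z" "f z (r *\<^sub>R x) = r *\<^sub>R f z x"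
  using assms by (auto simp: bilinear_ladd bilinear_radd bilinear_lsub bilinear_rsub bilinear_lneg
      bilinear_rneg bilinear_lzero bilinear_rzero bilinear_lmul bilinear_rmul)

lemma second_derivative_symmetric_vector:
  fixes f :: "'e::euclidean_space \<Rightarrow> 'f::euclidean_space"
  assumes f: "smooth_on S f" and S: "open S" "x \<in> S"
  shows "frechet_derivative (\<lambda>y. frechet_derivative f (at y) v) (at x) w =
    frechet_derivative (\<lambda>y. frechet_derivative f (at y) w) (at x) v"
proof (rule euclidean_eqI)
  fix b :: 'f
  have 1: "frechet_derivative (\<lambda>y. f y \<bullet> b) (at y) v = frechet_derivative f (at y) v \<bullet> b" if "y \<in> S" for y v
    using has_derivative_inner_left[OF smooth_on_has_derivative[OF f that], of b] by (simp add: frechet_derivative_eq)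
  have "frechet_derivative (\<lambda>y. frechet_derivative (\<lambda>y. f y \<bullet> b) (at y) v) (at x) w
      = frechet_derivative (\<lambda>y. frechet_derivative f (at y) v) (at x) w \<bullet> b" for v w
  proof -
    have "((\<lambda>y. frechet_derivative f (at y) v \<bullet> b) has_derivative
        (\<lambda>w. frechet_derivative (\<lambda>y. frechet_derivative f (at y) v) (at x) w \<bullet> b)) (at x)"
      by (intro has_derivative_inner_left smooth_on_has_derivative[OF smooth_on_frechet_derivative[OF f] S(2)])
    from has_derivative_transform_within_open[OF this S]
    have "((\<lambda>y. frechet_derivative (\<lambda>y. f y \<bullet> b) (at y) v) has_derivative
        (\<lambda>w. frechet_derivative (\<lambda>y. frechet_derivative f (at y) v) (at x) w \<bullet> b)) (at x)"
      using 1 by simp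
    then show ?thesis by (simp add: frechet_derivative_eq)
  qed
  with second_derivative_symmetric[OF smooth_on_inner_left[OF S(1) f] S, of b v w]
  show "frechet_derivative (\<lambda>y. frechet_derivative f (at y) v) (at x) w \<bullet> b =
    frechet_derivative (\<lambda>y. frechet_derivative f (at y) w) (at x) v \<bullet> b" by simp
qed

section \<open>The atlas of the tangent bundle\<close>

text \<open>The part of \<open>TM\<close> lying over \<open>W\<close>: the domain of the induced
  chart when \<open>W = fst c\<close>, and the open set on which lifts are treated as vector
  fields.\<close>

definition tb_over :: "('a, 'e::euclidean_space) chart set \<Rightarrow> 'a set \<Rightarrow> ('a \<times> ('a, 'e) tvec) set" where
  "tb_over A W = {(p, v). p \<in> W \<and> v \<in> tangent_space A p}"

definition tb_chart :: "('a, 'e::euclidean_space) chart set \<Rightarrow> ('a, 'e) chart \<Rightarrow>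
    ('a \<times> ('a, 'e) tvec, 'e \<times> 'e) chart" where
  "tb_chart A c = (tb_over A (fst c), \<lambda>(p, v). (snd c p, v c))"

lemma tangent_bundle_eq: "tangent_bundle A = tb_chart A ` A"
  by (simp add: tangent_bundle_def tb_chart_def tb_over_def)

lemma fst_tb_chart: "fst (tb_chart A c) = tb_over A (fst c)"
  by (simp add: tb_chart_def)

lemma snd_tb_chart: "snd (tb_chart A c) P = (snd c (fst P), snd P c)"
  by (simp add: tb_chart_def split: prod.split)

lemma mem_tb_over: "P \<in> tb_over A W \<longleftrightarrow> fst P \<in> W \<and> snd P \<in> tangent_space A (fst P)"
  by (cases P) (simp add: tb_over_def)

lemma carrier_tangent_bundle: "carrier (tangent_bundle A) = tb_over A (carrier A)"
  by (simp add: carrier_def tangent_bundle_eq set_eq_iff fst_tb_chart mem_tb_over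
      del: split_paired_All split_paired_Ex)

context
  fixes A :: "('a, 'e::euclidean_space) chart set"
  assumes atlas: "smooth_atlas A"
begin

lemma tb_chart_image:
  assumes c: "c \<in> A"
  shows "snd (tb_chart A c) ` (tb_over A (fst c \<inter> W)) = snd c ` (fst c \<inter> W) \<times> UNIV"
proof (intro set_eqI iffI)
  fix z :: "'e \<times> 'e" assume "z \<in> snd c ` (fst c \<inter> W) \<times> UNIV"
  then obtain p where p: "p \<in> fst c" "p \<in> W" "fst z = snd c p" by (cases z) auto
  show "z \<in> snd (tb_chart A c) ` (tb_over A (fst c \<inter> W))"
    by (rule image_eqI[of _ _ "(p, coordinate_field A c (snd z) p)"])
      (use p in \<open>simp_all add: snd_tb_chart mem_tb_over coordinate_field_tangent[OF atlas c] coordinate_field_same[OF atlas c] prod_eq_iff\<close>)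
qed (auto simp: snd_tb_chart mem_tb_over)

lemma tb_chart_inj: assumes c: "c \<in> A" shows "inj_on (snd (tb_chart A c)) (tb_over A (fst c))"
proof (rule inj_onI)
  fix P Q assume *: "P \<in> tb_over A (fst c)" "Q \<in> tb_over A (fst c)" "snd (tb_chart A c) P = snd (tb_chart A c) Q"
  then have p: "fst P = fst Q"
    using chart_inj[OF atlas c] by (auto simp: snd_tb_chart mem_tb_over dest: inj_onD)
  have "snd P = snd Q"
    by (rule tangent_eqI[OF atlas _ _ c, of _ "fst Q"]) (use * p in \<open>auto simp: snd_tb_chart mem_tb_over\<close>)
  with p show "P = Q" by (simp add: prod_eq_iff)
qed

lemma chart_inv_tb:
  assumes c: "c \<in> A" and x: "x \<in> snd c ` fst c"
  shows "chart_inv (tb_chart A c) (x, e) = (chart_inv c x, coordinate_field A c e (chart_inv c x))"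
  unfolding chart_inv_def[of "tb_chart A c"] fst_tb_chart
proof (rule inv_into_f_eq[OF tb_chart_inj[OF c]])
  note q = chart_inv_in[OF x]
  show "(chart_inv c x, coordinate_field A c e (chart_inv c x)) \<in> tb_over A (fst c)"
    using coordinate_field_tangent[OF atlas c q] q by (simp add: mem_tb_over)
  show "snd (tb_chart A c) (chart_inv c x, coordinate_field A c e (chart_inv c x)) = (x, e)"
    using coordinate_field_same[OF atlas c q] by (simp add: snd_tb_chart chart_inv_right[OF x])
qed

text \<open>A transition map of the bundle is the old transition together with its derivative
  applied to the fibre coordinate. Joint smoothness of the second component in base point and fibre
  uses linearity in the fibre.\<close>

lemma smooth_atlas_tangent_bundle: "smooth_atlas (tangent_bundle A)"
proof -
  have "open (snd (tb_chart A c) ` (fst (tb_chart A c) \<inter> fst (tb_chart A d))) \<and>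
      smooth_on (snd (tb_chart A c) ` (fst (tb_chart A c) \<inter> fst (tb_chart A d)))
        (snd (tb_chart A d) \<circ> chart_inv (tb_chart A c))" if c: "c \<in> A" and d: "d \<in> A" for c d
  proof -
    let ?S = "snd c ` (fst c \<inter> fst d)" and ?t = "snd d \<circ> chart_inv c"
    have "fst (tb_chart A c) \<inter> fst (tb_chart A d) = tb_over A (fst c \<inter> fst d)"
      by (auto simp: fst_tb_chart mem_tb_over)
    then have im: "snd (tb_chart A c) ` (fst (tb_chart A c) \<inter> fst (tb_chart A d)) = ?S \<times> UNIV"
      using tb_chart_image[OF c] by simp
    have oS: "open ?S" by (rule open_chart_overlap[OF atlas c d])
    have o: "open (?S \<times> (UNIV :: 'e set))" by (intro open_Times oS open_UNIV)
    have S: "fst ` (?S \<times> (UNIV :: 'e set)) \<subseteq> ?S" by auto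
    note tr = smooth_transition[OF atlas c d]
    note id = smooth_on_ident[OF o]
    note f = smooth_on_fst[OF o id]
    have 1: "smooth_on (?S \<times> (UNIV :: 'e set)) (\<lambda>z. ?t (fst z))"
      by (rule smooth_on_compose[where f = fst and g = ?t, OF o oS S f tr])
    have 2: "smooth_on (?S \<times> UNIV) (\<lambda>z. frechet_derivative ?t (at (fst z)) (snd z))"
    proof (rule smooth_on_linear_family[OF o, where \<Phi> = "\<lambda>z. frechet_derivative ?t (at (fst z))", OF _ _ smooth_on_snd[OF o id]])
      show "linear (frechet_derivative ?t (at (fst z)))" if "z \<in> ?S \<times> UNIV" for z :: "'e \<times> 'e"
        using transition_linear[OF atlas c d] that by auto
      show "smooth_on (?S \<times> (UNIV :: 'e set)) (\<lambda>z. frechet_derivative ?t (at (fst z)) e)" for e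
        by (rule smooth_on_compose[where f = fst, OF o oS S f smooth_on_frechet_derivative[OF tr]])
    qed
    have "smooth_on (?S \<times> UNIV) (snd (tb_chart A d) \<circ> chart_inv (tb_chart A c))"
    proof (rule smooth_on_cong[OF o smooth_on_Pair[OF o 1 2]])
      fix z :: "'e \<times> 'e" assume z: "z \<in> ?S \<times> UNIV"
      then obtain p e where p: "p \<in> fst c" "p \<in> fst d" and ze: "z = (snd c p, e)" by auto
      show "(?t (fst z), frechet_derivative ?t (at (fst z)) (snd z)) = (snd (tb_chart A d) \<circ> chart_inv (tb_chart A c)) z"
        using p by (simp add: ze chart_inv_tb[OF c] snd_tb_chart chart_inv_left[OF atlas c] coordinate_field_def d)
    qed
    with o show ?thesis by (simp add: im)
  qed
  moreover have "open (snd (tb_chart A c) ` fst (tb_chart A c))" if "c \<in> A" for c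
    using tb_chart_image[OF that, of "fst c"] open_chart_image[OF atlas that] by (simp add: fst_tb_chart open_Times)
  ultimately show ?thesis
    unfolding smooth_atlas_def tangent_bundle_eq using tb_chart_inj by (auto simp: fst_tb_chart)
qed

lemma openin_tb_over:
  assumes W: "openin (manifold_topology A) W"
  shows "openin (manifold_topology (tangent_bundle A)) (tb_over A W)"
  unfolding openin_manifold[OF smooth_atlas_tangent_bundle]
proof (intro conjI ballI)
  show "tb_over A W \<subseteq> carrier (tangent_bundle A)"
    using openin_manifold[OF atlas] W by (auto simp: carrier_tangent_bundle mem_tb_over)
  fix C assume "C \<in> tangent_bundle A"
  then obtain c where c: "c \<in> A" and C: "C = tb_chart A c" by (auto simp: tangent_bundle_eq)
  have "fst C \<inter> tb_over A W = tb_over A (fst c \<inter> W)" by (auto simp: C fst_tb_chart mem_tb_over)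
  then show "open (snd C ` (fst C \<inter> tb_over A W))"
    using tb_chart_image[OF c] openin_chart_image[OF atlas W c] by (simp add: C open_Times)
qed

end

section \<open>Christoffel symbols\<close>

lemma sum_fun_eval: "(\<Sum>i\<in>I. f i) x = (\<Sum>i\<in>I. f i x)"
  by (induction I rule: infinite_finite_induct) auto

lemma scaleR_fun_eval: "(r *\<^sub>R f) x = r *\<^sub>R f x"
  by (simp add: scaleR_fun_def)

lemma plus_fun_abs: "f + g = (\<lambda>x. f x + g x)"
  by (rule ext) (rule plus_fun_apply)

context
  fixes A :: "('a, 'e::euclidean_space) chart set" and nab :: "('a, 'e) connection"
  assumes atlas: "smooth_atlas A" and affine: "affine_connection A nab"
begin

section \<open>The defining rules of an affine connection and their extension to finite sums\<close>

lemma smooth_function_const: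
  "openin (manifold_topology A) W \<Longrightarrow> smooth_function A W (\<lambda>_. r)"
  using openin_chart_image[OF atlas] by (simp add: smooth_function_def o_def smooth_on_const)

lemma connection_smooth:
  assumes "openin (manifold_topology A) W" "smooth_vector_field A W X" "smooth_vector_field A W Y"
  shows "smooth_vector_field A W (nab X Y)"
  using affine[unfolded affine_connection_def, rule_format, OF assms(1,2,2,3,3) smooth_function_const[OF assms(1)]]
  by blast

text \<open>Locality: a field may be replaced by an expansion that represents it only on
  \<open>W\<close>, although both are total functions.\<close>

lemma connection_cong:
  assumes "openin (manifold_topology A) W" "smooth_vector_field A W X" "smooth_vector_field A W Y"
    and "\<And>q. q \<in> W \<Longrightarrow> X q = X' q" "\<And>q. q \<in> W \<Longrightarrow> Y q = Y' q" "p \<in> W"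
  shows "nab X Y p = nab X' Y' p"
  using affine[unfolded affine_connection_def, rule_format, OF assms(1,2)
      smooth_vector_field_cong[OF atlas assms(2,1,4)] assms(3) smooth_vector_field_cong[OF atlas assms(3,1,5)]
      smooth_function_const[OF assms(1)]] assms(4-6)
  by simp

lemma connection_add_left:
  assumes "openin (manifold_topology A) W" "smooth_vector_field A W X" "smooth_vector_field A W X'"
    "smooth_vector_field A W Y" "p \<in> W"
  shows "nab (\<lambda>q. X q + X' q) Y p = nab X Y p + nab X' Y p"
  using affine[unfolded affine_connection_def, rule_format, OF assms(1-4,4) smooth_function_const[OF assms(1)]] assms(5)
  unfolding plus_fun_abs[of X X'] by blast

lemma connection_scaleR_left:
  assumes "openin (manifold_topology A) W" "smooth_vector_field A W X" "smooth_vector_field A W Y"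
    "smooth_function A W f" "p \<in> W"
  shows "nab (\<lambda>q. f q *\<^sub>R X q) Y p = f p *\<^sub>R nab X Y p"
  using affine[unfolded affine_connection_def, rule_format, OF assms(1,2,2,3,3,4)] assms(5) by blast

lemma connection_add_right:
  assumes "openin (manifold_topology A) W" "smooth_vector_field A W X" "smooth_vector_field A W Y"
    "smooth_vector_field A W Y'" "p \<in> W"
  shows "nab X (\<lambda>q. Y q + Y' q) p = nab X Y p + nab X Y' p"
  using affine[unfolded affine_connection_def, rule_format, OF assms(1,2,2,3,4) smooth_function_const[OF assms(1)]] assms(5)
  unfolding plus_fun_abs[of Y Y'] by blast

lemma connection_scaleR_right:
  assumes "openin (manifold_topology A) W" "smooth_vector_field A W X" "smooth_vector_field A W Y"
    "smooth_function A W f" "p \<in> W"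
  shows "nab X (\<lambda>q. f q *\<^sub>R Y q) p = directional_derivative A p (X p) f *\<^sub>R Y p + f p *\<^sub>R nab X Y p"
  using affine[unfolded affine_connection_def, rule_format, OF assms(1,2,2,3,3,4)] assms(5) by blast

lemma connection_zero_left:
  assumes "openin (manifold_topology A) W" "smooth_vector_field A W Y" "p \<in> W"
  shows "nab (\<lambda>q. 0) Y p = 0"
  using connection_scaleR_left[OF assms(1) smooth_vector_field_zero[OF atlas assms(1)] assms(2)
      smooth_function_const[OF assms(1), of 0] assms(3)] by simp

lemma connection_zero_right:
  assumes "openin (manifold_topology A) W" "smooth_vector_field A W X" "p \<in> W"
  shows "nab X (\<lambda>q. 0) p = 0"
proof -
  have z: "smooth_vector_field A W (\<lambda>q. 0)" by (rule smooth_vector_field_zero[OF atlas assms(1)])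
  show ?thesis using connection_add_right[OF assms(1,2) z z assms(3)] by simp
qed

lemma connection_sum_left:
  assumes W: "openin (manifold_topology A) W" and Y: "smooth_vector_field A W Y" and p: "p \<in> W"
    and X: "\<And>i. i \<in> I \<Longrightarrow> smooth_vector_field A W (X i)" and f: "\<And>i. i \<in> I \<Longrightarrow> smooth_function A W (f i)"
  shows "nab (\<lambda>q. \<Sum>i\<in>I. f i q *\<^sub>R X i q) Y p = (\<Sum>i\<in>I. f i p *\<^sub>R nab (X i) Y p)"
  using X f
proof (induction I rule: infinite_finite_induct)
  case (insert i I)
  have s: "smooth_vector_field A W (\<lambda>q. f i q *\<^sub>R X i q)"
    "smooth_vector_field A W (\<lambda>q. \<Sum>i\<in>I. f i q *\<^sub>R X i q)"
    using insert.prems by (auto intro!: smooth_vector_field_sum[OF atlas] smooth_vector_field_scaleR[OF atlas] W)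
  have "nab (\<lambda>q. f i q *\<^sub>R X i q + (\<Sum>i\<in>I. f i q *\<^sub>R X i q)) Y p
      = f i p *\<^sub>R nab (X i) Y p + (\<Sum>i\<in>I. f i p *\<^sub>R nab (X i) Y p)"
    using connection_add_left[OF W s Y p] connection_scaleR_left[OF W _ Y _ p, of "X i" "f i"] insert by simp
  then show ?case unfolding sum.insert[OF insert.hyps] .
qed (simp_all add: connection_zero_left[OF W Y p])

lemma connection_sum_right:
  assumes W: "openin (manifold_topology A) W" and X: "smooth_vector_field A W X" and p: "p \<in> W"
    and Y: "\<And>i. i \<in> I \<Longrightarrow> smooth_vector_field A W (Y i)" and f: "\<And>i. i \<in> I \<Longrightarrow> smooth_function A W (f i)"
  shows "nab X (\<lambda>q. \<Sum>i\<in>I. f i q *\<^sub>R Y i q) p =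
    (\<Sum>i\<in>I. directional_derivative A p (X p) (f i) *\<^sub>R Y i p + f i p *\<^sub>R nab X (Y i) p)"
  using Y f
proof (induction I rule: infinite_finite_induct)
  case (insert i I)
  have s: "smooth_vector_field A W (\<lambda>q. f i q *\<^sub>R Y i q)"
    "smooth_vector_field A W (\<lambda>q. \<Sum>i\<in>I. f i q *\<^sub>R Y i q)"
    using insert.prems by (auto intro!: smooth_vector_field_sum[OF atlas] smooth_vector_field_scaleR[OF atlas] W)
  have "nab X (\<lambda>q. f i q *\<^sub>R Y i q + (\<Sum>i\<in>I. f i q *\<^sub>R Y i q)) p
      = (directional_derivative A p (X p) (f i) *\<^sub>R Y i p + f i p *\<^sub>R nab X (Y i) p) +
        (\<Sum>i\<in>I. directional_derivative A p (X p) (f i) *\<^sub>R Y i p + f i p *\<^sub>R nab X (Y i) p)"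
    unfolding connection_add_right[OF W X s p]
  proof (rule arg_cong2[where f = plus])
    show "nab X (\<lambda>q. f i q *\<^sub>R Y i q) p = directional_derivative A p (X p) (f i) *\<^sub>R Y i p + f i p *\<^sub>R nab X (Y i) p"
      by (rule connection_scaleR_right[OF W X _ _ p]) (use insert.prems in auto)
    show "nab X (\<lambda>q. \<Sum>i\<in>I. f i q *\<^sub>R Y i q) p =
        (\<Sum>i\<in>I. directional_derivative A p (X p) (f i) *\<^sub>R Y i p + f i p *\<^sub>R nab X (Y i) p)"
      by (rule insert.IH) (use insert.prems in auto)
  qed
  then show ?case unfolding sum.insert[OF insert.hyps] .
qed (simp_all add: connection_zero_right[OF W X p])

lemma tangent_expand:
  assumes "c \<in> A" "p \<in> fst c" "v \<in> tangent_space A p"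
  shows "v = (\<Sum>i\<in>Basis. (v c \<bullet> i) *\<^sub>R coordinate_field A c i p)"
proof (rule tangent_eqI[OF atlas assms(3) _ assms(1,2)])
  show "(\<Sum>i\<in>Basis. (v c \<bullet> i) *\<^sub>R coordinate_field A c i p) \<in> tangent_space A p"
    by (intro tangent_sum[OF atlas] tangent_scaleR[OF atlas] coordinate_field_tangent[OF atlas] assms)
  show "v c = (\<Sum>i\<in>Basis. (v c \<bullet> i) *\<^sub>R coordinate_field A c i p) c"
    by (simp add: sum_fun_eval scaleR_fun_eval coordinate_field_same[OF atlas assms(1,2)] euclidean_representation)
qed

text \<open>Near \<open>p\<close> both fields are replaced by their expansions in coordinate fields.
  Tensoriality in the first slot extracts the coefficients of \<open>X\<close>; the Leibniz rule in
  the second slot differentiates the coefficients of \<open>Y\<close>, and these derivatives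
  reassemble to the derivative of its coordinate representation.\<close>

lemma connection_chart_basis:
  assumes W: "openin (manifold_topology A) W" "p \<in> W" and c: "c \<in> A" "p \<in> fst c"
    and X: "smooth_vector_field A W X" and Y: "smooth_vector_field A W Y"
  shows "nab X Y p c = frechet_derivative (\<lambda>x. Y (chart_inv c x) c) (at (snd c p)) (X p c) +
    (\<Sum>i\<in>Basis. \<Sum>j\<in>Basis. ((X p c \<bullet> i) * (Y p c \<bullet> j)) *\<^sub>R christoffel A nab c p i j)"
proof -
  define V where "V = W \<inter> fst c"
  have V: "openin (manifold_topology A) V" "V \<subseteq> fst c" "p \<in> V" "V \<subseteq> W"
    using W c openin_chart[OF atlas c(1)] by (auto simp: V_def intro: openin_Int)
  note XV = smooth_vector_field_subset[OF atlas X V(4)] and YV = smooth_vector_field_subset[OF atlas Y V(4)]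
  have cV: "snd c ` (fst c \<inter> V) = snd c ` V" using V(2) by (simp add: Int_absorb1)
  have oV: "open (snd c ` V)" using openin_chart_image[OF atlas V(1) c(1)] cV by simp
  have \<partial>: "smooth_vector_field A V (coordinate_field A c i)" for i
    by (rule smooth_vector_field_subset[OF atlas smooth_coordinate_field[OF atlas c(1)] V(2)])
  have comp: "smooth_function A V (\<lambda>q. Z q c \<bullet> i)" if "smooth_vector_field A V Z" for Z i
    by (rule smooth_functionI[OF atlas c(1) V(1,2)])
      (use smooth_vector_fieldD(2)[OF atlas that c(1)] in \<open>auto intro!: smooth_on_inner_left oV simp: cV\<close>)
  have expand: "Z q = (\<Sum>i\<in>Basis. (Z q c \<bullet> i) *\<^sub>R coordinate_field A c i q)"
    if "smooth_vector_field A V Z" "q \<in> V" for Z q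
    by (rule tangent_expand[OF c(1) subsetD[OF V(2) that(2)] smooth_vector_fieldD(1)[OF atlas that]])
  let ?X = "\<lambda>q. \<Sum>i\<in>Basis. (X q c \<bullet> i) *\<^sub>R coordinate_field A c i q"
  let ?Y = "\<lambda>q. \<Sum>i\<in>Basis. (Y q c \<bullet> i) *\<^sub>R coordinate_field A c i q"
  let ?DY = "frechet_derivative (\<lambda>x. Y (chart_inv c x) c) (at (snd c p))"
  have pc: "snd c p \<in> snd c ` (fst c \<inter> V)" using V(3) c by blast
  have dY: "((\<lambda>x. Y (chart_inv c x) c) has_derivative ?DY) (at (snd c p))"
    by (rule smooth_on_has_derivative[OF smooth_vector_fieldD(2)[OF atlas YV c(1)] pc])
  have dd: "directional_derivative A p (coordinate_field A c i p) (\<lambda>q. Y q c \<bullet> j) = ?DY i \<bullet> j" for i j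
  proof -
    have d: "((\<lambda>q. Y q c \<bullet> j) \<circ> chart_inv c has_derivative (\<lambda>v. ?DY v \<bullet> j)) (at (snd c p))"
      using has_derivative_inner_left[OF dY] by (simp add: o_def)
    have "((\<lambda>q. Y q c \<bullet> j) \<circ> chart_inv c) differentiable (at (snd c p))" using d by (rule differentiableI)
    from directional_derivative_chart[OF atlas coordinate_field_tangent[OF atlas c] c this]
    show ?thesis by (simp add: frechet_derivative_eq[OF d] coordinate_field_same[OF atlas c])
  qed
  have "nab X Y p = nab ?X ?Y p"
    by (rule connection_cong[OF V(1) XV YV expand[OF XV] expand[OF YV] V(3)])
  also have "\<dots> = nab ?X Y p"
    by (rule connection_cong[OF V(1) _ _ _ _ V(3), symmetric])
      (use expand[OF YV] smooth_vector_field_cong[OF atlas XV V(1) expand[OF XV]] YV in auto)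
  also have "\<dots> = (\<Sum>i\<in>Basis. (X p c \<bullet> i) *\<^sub>R nab (coordinate_field A c i) Y p)"
    by (rule connection_sum_left[OF V(1) YV V(3) \<partial> comp[OF XV]])
  finally have 1: "nab X Y p = (\<Sum>i\<in>Basis. (X p c \<bullet> i) *\<^sub>R nab (coordinate_field A c i) Y p)" .
  have 2: "nab (coordinate_field A c i) Y p c = ?DY i + (\<Sum>j\<in>Basis. (Y p c \<bullet> j) *\<^sub>R christoffel A nab c p i j)" for i
  proof -
    have "nab (coordinate_field A c i) Y p = nab (coordinate_field A c i) ?Y p"
      by (rule connection_cong[OF V(1) \<partial> YV refl expand[OF YV] V(3)])
    also have "\<dots> = (\<Sum>j\<in>Basis. (?DY i \<bullet> j) *\<^sub>R coordinate_field A c j p + (Y p c \<bullet> j) *\<^sub>R nab (coordinate_field A c i) (coordinate_field A c j) p)"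
      by (subst connection_sum_right[OF V(1) \<partial> V(3) \<partial> comp[OF YV]]) (simp add: dd)
    finally show ?thesis
      by (simp add: sum_fun_eval scaleR_fun_eval coordinate_field_same[OF atlas c] sum.distrib euclidean_representation christoffel_def)
  qed
  have "linear ?DY" using dY by (rule has_derivative_linear)
  then show ?thesis
    unfolding 1 by (simp add: sum_fun_eval scaleR_fun_eval 2 scaleR_add_right sum.distrib scaleR_sum_right
        linear_euclidean_sum[of ?DY "X p c"])
qed

text \<open>The basis formula is applied to coordinate fields, whose coordinates are constant, so
  its derivative term vanishes. Bilinearity of \<open>christoffel\<close> in arbitrary vectors is
  read off from the resulting expansion.\<close>

lemma christoffel_expand:
  assumes c: "c \<in> A" "p \<in> fst c"
  shows "christoffel A nab c p v w = (\<Sum>i\<in>Basis. \<Sum>j\<in>Basis. ((v \<bullet> i) * (w \<bullet> j)) *\<^sub>R christoffel A nab c p i j)"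
proof -
  have "((\<lambda>x. coordinate_field A c w (chart_inv c x) c) has_derivative (\<lambda>_. 0)) (at (snd c p))"
    by (rule has_derivative_transform_within_open[OF has_derivative_const[of w] open_chart_image[OF atlas c(1)]])
      (use c in \<open>simp_all add: coordinate_field_same[OF atlas] chart_inv_in\<close>)
  then show ?thesis
    using connection_chart_basis[OF openin_chart[OF atlas c(1)] c(2) c smooth_coordinate_field[OF atlas c(1), of v] smooth_coordinate_field[OF atlas c(1), of w]]
    unfolding christoffel_def[of _ _ _ _ v w]
    by (simp add: frechet_derivative_eq coordinate_field_same[OF atlas c])
qed

lemma christoffel_bilinear:
  assumes c: "c \<in> A" "p \<in> fst c"
  shows "bilinear (christoffel A nab c p)"
proof -
  obtain G where "christoffel A nab c p = (\<lambda>v w. \<Sum>i\<in>Basis. \<Sum>j\<in>Basis. ((v \<bullet> i) * (w \<bullet> j)) *\<^sub>R G i j)"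
    using christoffel_expand[OF c] by (metis (no_types, lifting) ext)
  then show ?thesis
    by (auto simp: bilinear_def inner_add_left distrib_left distrib_right scaleR_add_left sum.distrib
        scaleR_sum_right ac_simps intro!: linearI)
qed

lemma connection_chart:
  assumes W: "openin (manifold_topology A) W" "p \<in> W" and c: "c \<in> A" "p \<in> fst c"
    and X: "smooth_vector_field A W X" and Y: "smooth_vector_field A W Y"
  shows "nab X Y p c = frechet_derivative (\<lambda>x. Y (chart_inv c x) c) (at (snd c p)) (X p c) +
    christoffel A nab c p (X p c) (Y p c)"
  using connection_chart_basis[OF assms] christoffel_expand[OF c, of "X p c" "Y p c"] by simp

lemma christoffel_smooth:
  assumes c: "c \<in> A"
  shows "smooth_on (snd c ` fst c) (\<lambda>x. christoffel A nab c (chart_inv c x) v w)"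
  using smooth_vector_fieldD(2)[OF atlas connection_smooth[OF openin_chart[OF atlas c]
        smooth_coordinate_field[OF atlas c] smooth_coordinate_field[OF atlas c]] c]
  by (simp add: christoffel_def)

text \<open>The inhomogeneous transformation law, obtained by evaluating the covariant derivative of
  two coordinate fields of \<open>c\<close> in the chart \<open>d\<close>. The second-derivative
  term later balances the change of the transition derivative along a curve.\<close>

lemma christoffel_change_chart:
  assumes c: "c \<in> A" "p \<in> fst c" and d: "d \<in> A" "p \<in> fst d"
  defines "D \<equiv> frechet_derivative (snd d \<circ> chart_inv c)"
  shows "D (at (snd c p)) (christoffel A nab c p v w) =
    frechet_derivative (\<lambda>x. D (at x) w) (at (snd c p)) v +
    christoffel A nab d p (D (at (snd c p)) v) (D (at (snd c p)) w)"
proof -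
  let ?v = "coordinate_field A c v" and ?w = "coordinate_field A c w"
  have vw: "smooth_vector_field A (fst c) ?v" "smooth_vector_field A (fst c) ?w"
    by (rule smooth_coordinate_field[OF atlas c(1)])+
  have cd: "coordinate_field A c e q d = D (at (snd c q)) e" if "q \<in> fst c" "q \<in> fst d" for e q
    using that d by (simp add: coordinate_field_def D_def)
  have T: "nab ?v ?w p \<in> tangent_space A p"
    using smooth_vector_fieldD(1)[OF atlas connection_smooth[OF openin_chart[OF atlas c(1)] vw] c(2)] .
  have pd: "snd d p \<in> snd d ` (fst d \<inter> fst c)" using c d by blast
  have dd: "((\<lambda>q. ?w q d) \<circ> chart_inv d) differentiable (at (snd d p))"
    using smooth_on_differentiable[OF smooth_vector_fieldD(2)[OF atlas vw(2) d(1)] pd] by (simp add: o_def)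
  note h = frechet_derivative_change_chart[OF atlas c d dd]
  have "((\<lambda>x. D (at x) w) has_derivative
      (\<lambda>a. frechet_derivative ((\<lambda>q. ?w q d) \<circ> chart_inv d) (at (snd d p)) (D (at (snd c p)) a))) (at (snd c p))"
    by (rule has_derivative_transform_within_open[OF h[folded D_def] open_chart_overlap[OF atlas c(1) d(1)]])
      (use c d in \<open>auto simp: chart_inv_left[OF atlas c(1)] cd\<close>)
  then have fd: "frechet_derivative (\<lambda>x. ?w (chart_inv d x) d) (at (snd d p)) (?v p d) = frechet_derivative (\<lambda>x. D (at x) w) (at (snd c p)) v"
    by (simp add: frechet_derivative_eq cd c d o_def)
  have "D (at (snd c p)) (christoffel A nab c p v w) = nab ?v ?w p d"
    using tangent_change_chart[OF atlas T c(1) d(1) c(2) d(2)] by (simp add: D_def christoffel_def)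
  also have "\<dots> = frechet_derivative (\<lambda>x. ?w (chart_inv d x) d) (at (snd d p)) (?v p d) + christoffel A nab d p (?v p d) (?w p d)"
    by (rule connection_chart[OF openin_chart[OF atlas c(1)] c(2) d vw])
  finally show ?thesis unfolding fd unfolding cd[OF c(2) d(2)] .
qed

end

section \<open>Levi-Civita connections and curvature\<close>

text \<open>The classical combination of four instances of the Bianchi identity, one for each choice
  of the vector left out of the cyclic sum; the two skew symmetries make all other terms
  cancel.\<close>

lemma curvature_pair_symmetry:
  fixes r :: "'v \<Rightarrow> 'v \<Rightarrow> 'v \<Rightarrow> 'v \<Rightarrow> real"
  assumes skew: "\<And>x y z w. x \<in> T \<Longrightarrow> y \<in> T \<Longrightarrow> z \<in> T \<Longrightarrow> w \<in> T \<Longrightarrow> r x y z w = - r y x z w"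
    and skew': "\<And>x y z w. x \<in> T \<Longrightarrow> y \<in> T \<Longrightarrow> z \<in> T \<Longrightarrow> w \<in> T \<Longrightarrow> r x y z w = - r x y w z"
    and bianchi: "\<And>x y z w. x \<in> T \<Longrightarrow> y \<in> T \<Longrightarrow> z \<in> T \<Longrightarrow> w \<in> T \<Longrightarrow>
      r x y z w + r y z x w + r z x y w = 0"
    and T: "x \<in> T" "y \<in> T" "z \<in> T" "w \<in> T"
  shows "r x y z w = r z w x y"
proof -
  have "r x y z w + r y z x w + r z x y w = 0" "r y z w x + r z w y x + r w y z x = 0"
    "r z w x y + r w x z y + r x z w y = 0" "r w x y z + r x y w z + r y w x z = 0"
    by (simp_all add: bianchi T)
  moreover have "r y z x w = - r y z w x" "r z x y w = - r x z y w" "r x z y w = - r x z w y"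
    "r z w y x = - r z w x y" "r w y z x = - r y w z x" "r y w z x = - r y w x z"
    "r w x z y = - r w x y z" "r x y w z = - r x y z w"
    using T skew skew' by blast+
  ultimately show ?thesis by linarith
qed

text \<open>The coordinate expression of the curvature tensor, with the Christoffel symbols
  differentiated at frozen vector arguments. Only the values of the three vectors at
  \<open>p\<close> enter, which exhibits tensoriality.\<close>

definition riemann_chart :: "('a, 'e::euclidean_space) chart set \<Rightarrow> ('a, 'e) connection \<Rightarrow>
    ('a, 'e) chart \<Rightarrow> 'a \<Rightarrow> 'e \<Rightarrow> 'e \<Rightarrow> 'e \<Rightarrow> 'e" where
  "riemann_chart A nab c p v w z =
     frechet_derivative (\<lambda>x. christoffel A nab c (chart_inv c x) w z) (at (snd c p)) v -
     frechet_derivative (\<lambda>x. christoffel A nab c (chart_inv c x) v z) (at (snd c p)) w +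
     christoffel A nab c p v (christoffel A nab c p w z) - christoffel A nab c p w (christoffel A nab c p v z)"

context
  fixes A :: "('a, 'e::euclidean_space) chart set" and g :: "('a, 'e) metric" and nab :: "('a, 'e) connection"
  assumes atlas: "smooth_atlas A" and riem: "riemannian_metric A g" and lc: "levi_civita_connection A g nab"
begin

lemma levi_civita_affine: "affine_connection A nab"
  using lc by (simp add: levi_civita_connection_def)

context
  fixes p assumes p: "p \<in> carrier A"
begin

section \<open>Algebra of the metric at a point, and the Koszul formula\<close>

lemma metric_properties:
  assumes "x \<in> tangent_space A p" "y \<in> tangent_space A p" "z \<in> tangent_space A p"
  shows "g p x y = g p y x \<and> g p (x + y) z = g p x z + g p y z \<and> g p (r *\<^sub>R x) y = r * g p x y \<and>
        (x \<noteq> 0 \<longrightarrow> g p x x > 0)"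
  using riem[unfolded riemannian_metric_def, THEN conjunct1, rule_format, OF p assms] by simp

lemma metric_sym: "x \<in> tangent_space A p \<Longrightarrow> y \<in> tangent_space A p \<Longrightarrow> g p x y = g p y x"
  using metric_properties by blast

lemma metric_add_left:
  "x \<in> tangent_space A p \<Longrightarrow> y \<in> tangent_space A p \<Longrightarrow> z \<in> tangent_space A p \<Longrightarrow>
    g p (x + y) z = g p x z + g p y z"
  using metric_properties by blast

lemma metric_scaleR_left:
  "x \<in> tangent_space A p \<Longrightarrow> y \<in> tangent_space A p \<Longrightarrow> g p (r *\<^sub>R x) y = r * g p x y"
  using metric_properties by blast

lemma metric_minus_left:
  "x \<in> tangent_space A p \<Longrightarrow> y \<in> tangent_space A p \<Longrightarrow> g p (- x) y = - g p x y"
  using metric_scaleR_left[of x y "-1"] by simp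

lemma metric_diff_left:
  "x \<in> tangent_space A p \<Longrightarrow> y \<in> tangent_space A p \<Longrightarrow> z \<in> tangent_space A p \<Longrightarrow>
    g p (x - y) z = g p x z - g p y z"
  using metric_add_left[of x "- y" z] metric_minus_left[of y z] tangent_minus[OF atlas] by simp

lemma metric_zero_left: "x \<in> tangent_space A p \<Longrightarrow> g p 0 x = 0"
  using metric_scaleR_left[of x x 0] by simp

lemma metric_diff_right:
  "x \<in> tangent_space A p \<Longrightarrow> y \<in> tangent_space A p \<Longrightarrow> z \<in> tangent_space A p \<Longrightarrow>
    g p z (x - y) = g p z x - g p z y"
  using metric_diff_left[of x y z] metric_sym tangent_diff[OF atlas] by metis

lemma metric_eqI:
  assumes "x \<in> tangent_space A p" "y \<in> tangent_space A p" "\<And>z. z \<in> tangent_space A p \<Longrightarrow> g p x z = g p y z"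
  shows "x = y"
proof -
  have d: "x - y \<in> tangent_space A p" by (rule tangent_diff[OF atlas assms(1,2)])
  then have "g p (x - y) (x - y) = 0" using metric_diff_left[OF assms(1,2) d] assms(3)[OF d] by simp
  then show ?thesis using metric_properties[OF d d d] by (metis eq_iff_diff_eq_0 less_irrefl)
qed

end

lemma smooth_metric_function:
  assumes "openin (manifold_topology A) W" "smooth_vector_field A W Y" "smooth_vector_field A W Z"
  shows "smooth_function A W (\<lambda>q. g q (Y q) (Z q))"
  using riem[unfolded riemannian_metric_def, THEN conjunct2, rule_format, OF assms] .

lemma torsion_free:
  assumes "openin (manifold_topology A) W" "smooth_vector_field A W X" "smooth_vector_field A W Y" "p \<in> W"
  shows "nab X Y p - nab Y X p = lie_bracket A X Y p"
  using lc[unfolded levi_civita_connection_def, THEN conjunct2, rule_format, OF assms(1-3,3)] assms(4) by blast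

lemma metric_compatible:
  assumes "openin (manifold_topology A) W" "smooth_vector_field A W X" "smooth_vector_field A W Y"
    "smooth_vector_field A W Z" "p \<in> W"
  shows "directional_derivative A p (X p) (\<lambda>q. g q (Y q) (Z q)) = g p (nab X Y p) (Z p) + g p (Y p) (nab X Z p)"
  using lc[unfolded levi_civita_connection_def, THEN conjunct2, rule_format, OF assms(1-4)] assms(5) by blast

lemma openin_subset_carrier: "openin (manifold_topology A) W \<Longrightarrow> p \<in> W \<Longrightarrow> p \<in> carrier A"
  using openin_manifold[OF atlas] by blast

text \<open>Metric compatibility expands the three derivatives and vanishing torsion the three
  brackets. By symmetry of the metric all terms cancel except two copies of the product of
  \<open>nab X Y p\<close> with \<open>Z p\<close>.\<close>

lemma koszul:
  assumes W: "openin (manifold_topology A) W" "p \<in> W" and X: "smooth_vector_field A W X"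
    and Y: "smooth_vector_field A W Y" and Z: "smooth_vector_field A W Z"
  shows "2 * g p (nab X Y p) (Z p) =
    directional_derivative A p (X p) (\<lambda>q. g q (Y q) (Z q)) + directional_derivative A p (Y p) (\<lambda>q. g q (X q) (Z q))
    - directional_derivative A p (Z p) (\<lambda>q. g q (X q) (Y q)) + g p (lie_bracket A X Y p) (Z p)
    - g p (lie_bracket A X Z p) (Y p) - g p (lie_bracket A Y Z p) (X p)"
proof -
  have p: "p \<in> carrier A" using openin_subset_carrier W by blast
  have T: "nab U V p \<in> tangent_space A p" if "smooth_vector_field A W U" "smooth_vector_field A W V" for U V
    by (rule smooth_vector_fieldD(1)[OF atlas connection_smooth[OF atlas levi_civita_affine W(1) that] W(2)])
  have F: "U p \<in> tangent_space A p" if "smooth_vector_field A W U" for U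
    by (rule smooth_vector_fieldD(1)[OF atlas that W(2)])
  have b: "g p (lie_bracket A U V p) (Q p) = g p (nab U V p) (Q p) - g p (nab V U p) (Q p)"
    if "smooth_vector_field A W U" "smooth_vector_field A W V" "smooth_vector_field A W Q" for U V Q
    unfolding torsion_free[OF W(1) that(1,2) W(2), symmetric]
    by (rule metric_diff_left[OF p T[OF that(1,2)] T[OF that(2,1)] F[OF that(3)]])
  show ?thesis
    unfolding metric_compatible[OF W(1) X Y Z W(2)] metric_compatible[OF W(1) Y X Z W(2)]
      metric_compatible[OF W(1) Z X Y W(2)] b[OF X Y Z] b[OF X Z Y] b[OF Y Z X]
      metric_sym[OF p F[OF Y] T[OF X Z]] metric_sym[OF p F[OF X] T[OF Y Z]] metric_sym[OF p F[OF X] T[OF Z Y]]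
    by simp
qed

text \<open>Being a difference of two covariant derivatives, the bracket inherits tangency and
  smoothness from the connection.\<close>

lemma lie_bracket_smooth:
  assumes W: "openin (manifold_topology A) W" and X: "smooth_vector_field A W X" and Y: "smooth_vector_field A W Y"
  shows "smooth_vector_field A W (lie_bracket A X Y)"
  by (rule smooth_vector_field_cong[OF atlas smooth_vector_field_diff[OF atlas
        connection_smooth[OF atlas levi_civita_affine W X Y] connection_smooth[OF atlas levi_civita_affine W Y X] W] W])
    (rule torsion_free[OF W X Y])

section \<open>Coordinate fields, iterated covariant derivatives and curvature in a chart\<close>

lemma coordinate_field_derivative:
  assumes c: "c \<in> A" "p \<in> fst c"
  shows "frechet_derivative (\<lambda>x. coordinate_field A c w (chart_inv c x) c) (at (snd c p)) = (\<lambda>_. 0)"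
proof (rule frechet_derivative_eq)
  show "((\<lambda>x. coordinate_field A c w (chart_inv c x) c) has_derivative (\<lambda>_. 0)) (at (snd c p))"
    by (rule has_derivative_transform_within_open[OF has_derivative_const[of w] open_chart_image[OF atlas c(1)]])
      (use c in \<open>simp_all add: coordinate_field_same[OF atlas] chart_inv_in\<close>)
qed

lemma lie_bracket_coordinate_fields:
  assumes c: "c \<in> A" "p \<in> fst c"
  shows "lie_bracket A (coordinate_field A c v) (coordinate_field A c w) p = 0"
proof -
  note s = smooth_coordinate_field[OF atlas c(1)]
  show ?thesis
    by (rule tangent_eqI[OF atlas smooth_vector_fieldD(1)[OF atlas lie_bracket_smooth[OF openin_chart[OF atlas c(1)] s s] c(2)] tangent_zero[OF atlas] c])
      (simp add: lie_bracket_def coordinate_field_derivative c)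
qed

lemma christoffel_sym:
  assumes c: "c \<in> A" "p \<in> fst c"
  shows "christoffel A nab c p v w = christoffel A nab c p w v"
  using torsion_free[OF openin_chart[OF atlas c(1)] smooth_coordinate_field[OF atlas c(1)] smooth_coordinate_field[OF atlas c(1)] c(2), of v w]
  unfolding lie_bracket_coordinate_fields[OF c] by (simp add: christoffel_def)

text \<open>\<open>Y\<close> enters the coordinates of \<open>nab Y Z\<close> both as a direction of
  differentiation and as an argument of \<open>\<Gamma>\<close>, hence the number of terms. In the
  curvature the first term is symmetric in \<open>X\<close> and \<open>Y\<close>, and those with
  \<open>DY\<close> combine with their counterparts into the bracket.\<close>

lemma connection_twice_chart:
  assumes W: "openin (manifold_topology A) W" "p \<in> W" and c: "c \<in> A" "p \<in> fst c"
    and X: "smooth_vector_field A W X" and Y: "smooth_vector_field A W Y" and Z: "smooth_vector_field A W Z"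
  defines "\<Gamma> \<equiv> christoffel A nab c"
    and "DY \<equiv> frechet_derivative (\<lambda>x. Y (chart_inv c x) c)"
    and "DZ \<equiv> frechet_derivative (\<lambda>x. Z (chart_inv c x) c)"
  shows "nab X (nab Y Z) p c =
    frechet_derivative (\<lambda>x. DZ (at x) (Y p c)) (at (snd c p)) (X p c) + DZ (at (snd c p)) (DY (at (snd c p)) (X p c)) +
    frechet_derivative (\<lambda>x. \<Gamma> (chart_inv c x) (Y p c) (Z p c)) (at (snd c p)) (X p c) +
    \<Gamma> p (DY (at (snd c p)) (X p c)) (Z p c) + \<Gamma> p (Y p c) (DZ (at (snd c p)) (X p c)) +
    \<Gamma> p (X p c) (DZ (at (snd c p)) (Y p c) + \<Gamma> p (Y p c) (Z p c))"
proof -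
  let ?S = "snd c ` (fst c \<inter> W)" and ?x = "snd c p"
  have S: "open ?S" "?x \<in> ?S" using openin_chart_image[OF atlas W(1) c(1)] W(2) c(2) by auto
  have S': "?S \<subseteq> snd c ` fst c" by blast
  note Yc = smooth_vector_fieldD(2)[OF atlas Y c(1)] and Zc = smooth_vector_fieldD(2)[OF atlas Z c(1)]
  note YD = smooth_on_has_derivative[OF Yc S(2), folded DY_def] and ZD = smooth_on_has_derivative[OF Zc, folded DZ_def]
  have ip: "chart_inv c ?x = p" by (rule chart_inv_left[OF atlas c])
  have eq: "nab Y Z (chart_inv c x) c = DZ (at x) (Y (chart_inv c x) c) + \<Gamma> (chart_inv c x) (Y (chart_inv c x) c) (Z (chart_inv c x) c)"
    if x: "x \<in> ?S" for x
  proof -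
    obtain q where q: "q \<in> fst c" "q \<in> W" "x = snd c q" using x by blast
    show ?thesis
      using connection_chart[OF atlas levi_civita_affine W(1) q(2) c(1) q(1) Y Z]
      by (simp add: q(3) chart_inv_left[OF atlas c(1) q(1)] DZ_def \<Gamma>_def)
  qed
  have 1: "((\<lambda>x. DZ (at x) (Y (chart_inv c x) c)) has_derivative
      (\<lambda>a. frechet_derivative (\<lambda>x. DZ (at x) (Y (chart_inv c ?x) c)) (at ?x) a + DZ (at ?x) (DY (at ?x) a))) (at ?x)"
  proof (rule has_derivative_linear_family_compose[where y = ?x and \<Phi> = "\<lambda>x. DZ (at x)" and g = "\<lambda>x. x", OF S _ _ has_derivative_ident YD])
    show "linear (DZ (at x))" if "x \<in> ?S" for x using ZD[OF that] has_derivative_linear by blast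
    show "(\<lambda>x. DZ (at x) e) differentiable at ?x" for e
      unfolding DZ_def by (rule smooth_on_differentiable[OF smooth_on_frechet_derivative[OF Zc] S(2)])
  qed
  have 2: "((\<lambda>x. \<Gamma> (chart_inv c x) (Y (chart_inv c x) c) (Z (chart_inv c x) c)) has_derivative
      (\<lambda>a. frechet_derivative (\<lambda>x. \<Gamma> (chart_inv c x) (Y (chart_inv c ?x) c) (Z (chart_inv c ?x) c)) (at ?x) a
         + \<Gamma> (chart_inv c ?x) (DY (at ?x) a) (Z (chart_inv c ?x) c) + \<Gamma> (chart_inv c ?x) (Y (chart_inv c ?x) c) (DZ (at ?x) a))) (at ?x)"
  proof (rule has_derivative_bilinear_family[where y = ?x and \<Gamma> = "\<lambda>x. \<Gamma> (chart_inv c x)" and h = "\<lambda>x. x", OF S _ _ has_derivative_ident YD ZD[OF S(2)]])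
    show "bilinear (\<Gamma> (chart_inv c x))" if "x \<in> ?S" for x
      unfolding \<Gamma>_def by (rule christoffel_bilinear[OF atlas levi_civita_affine c(1) chart_inv_in[OF subsetD[OF S' that]]])
    show "(\<lambda>x. \<Gamma> (chart_inv c x) v w) differentiable at ?x" for v w
      unfolding \<Gamma>_def using smooth_on_differentiable[OF christoffel_smooth[OF atlas levi_civita_affine c(1)]] c(2) by blast
  qed
  have "((\<lambda>x. nab Y Z (chart_inv c x) c) has_derivative
      (\<lambda>a. frechet_derivative (\<lambda>x. DZ (at x) (Y p c)) (at ?x) a + DZ (at ?x) (DY (at ?x) a) +
        (frechet_derivative (\<lambda>x. \<Gamma> (chart_inv c x) (Y p c) (Z p c)) (at ?x) a
         + \<Gamma> p (DY (at ?x) a) (Z p c) + \<Gamma> p (Y p c) (DZ (at ?x) a)))) (at ?x)"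
    by (rule has_derivative_transform_within_open[OF has_derivative_add[OF 1 2, unfolded ip] S]) (rule eq[symmetric])
  then have d: "frechet_derivative (\<lambda>x. nab Y Z (chart_inv c x) c) (at ?x) (X p c) =
      frechet_derivative (\<lambda>x. DZ (at x) (Y p c)) (at ?x) (X p c) + DZ (at ?x) (DY (at ?x) (X p c)) +
        (frechet_derivative (\<lambda>x. \<Gamma> (chart_inv c x) (Y p c) (Z p c)) (at ?x) (X p c)
         + \<Gamma> p (DY (at ?x) (X p c)) (Z p c) + \<Gamma> p (Y p c) (DZ (at ?x) (X p c)))"
    by (simp add: frechet_derivative_eq)
  show ?thesis
    using connection_chart[OF atlas levi_civita_affine W c X connection_smooth[OF atlas levi_civita_affine W(1) Y Z]] eq[OF S(2)]
    unfolding d ip \<Gamma>_def[symmetric] by (simp add: add.assoc)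
qed

lemma curvature_field_apply:
  "curvature_field A nab X Y Z p = nab X (nab Y Z) p - nab Y (nab X Z) p - nab (lie_bracket A X Y) Z p"
  by (simp only: curvature_field_def minus_apply)

text \<open>Second derivatives of \<open>Z\<close> cancel by symmetry, mixed terms cancel between
  the two orders of differentiation, and first derivatives of \<open>X\<close> and \<open>Y\<close>
  are absorbed by the bracket term.\<close>

lemma curvature_field_chart:
  assumes W: "openin (manifold_topology A) W" "p \<in> W" and c: "c \<in> A" "p \<in> fst c"
    and X: "smooth_vector_field A W X" and Y: "smooth_vector_field A W Y" and Z: "smooth_vector_field A W Z"
  shows "curvature_field A nab X Y Z p c = riemann_chart A nab c p (X p c) (Y p c) (Z p c)"
proof -
  note B = lie_bracket_smooth[OF W(1) X Y]
  note bil = bilinearD[OF christoffel_bilinear[OF atlas levi_civita_affine c]]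
  have S: "open (snd c ` (fst c \<inter> W))" "snd c p \<in> snd c ` (fst c \<inter> W)"
    using openin_chart_image[OF atlas W(1) c(1)] W(2) c(2) by auto
  note Zc = smooth_vector_fieldD(2)[OF atlas Z c(1)]
  have lin: "linear (frechet_derivative (\<lambda>x. Z (chart_inv c x) c) (at (snd c p)))"
    using smooth_on_has_derivative[OF Zc S(2)] has_derivative_linear by blast
  have bc: "lie_bracket A X Y p c = frechet_derivative (\<lambda>x. Y (chart_inv c x) c) (at (snd c p)) (X p c) -
      frechet_derivative (\<lambda>x. X (chart_inv c x) c) (at (snd c p)) (Y p c)"
    using c by (simp add: lie_bracket_def)
  show ?thesis
    by (simp add: curvature_field_apply connection_twice_chart[OF W c X Y Z] connection_twice_chart[OF W c Y X Z]
      connection_chart[OF atlas levi_civita_affine W c B Z] bc linear_diff[OF lin] bil riemann_chart_def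
      second_derivative_symmetric_vector[OF Zc S, of "X p c" "Y p c"])
qed

lemma curvature_field_tangent:
  assumes W: "openin (manifold_topology A) W" "p \<in> W"
    and X: "smooth_vector_field A W X" and Y: "smooth_vector_field A W Y" and Z: "smooth_vector_field A W Z"
  shows "curvature_field A nab X Y Z p \<in> tangent_space A p"
proof -
  note n = connection_smooth[OF atlas levi_civita_affine W(1)] and F = smooth_vector_fieldD(1)[OF atlas _ W(2)]
  show ?thesis
    unfolding curvature_field_apply
    by (rule tangent_diff[OF atlas tangent_diff[OF atlas F[OF n[OF X n[OF Y Z]]] F[OF n[OF Y n[OF X Z]]]]
          F[OF n[OF lie_bracket_smooth[OF W(1) X Y] Z]]])
qed

text \<open>The definite description is legitimate: two triples of extensions with the same values
  at \<open>p\<close> give tangent vectors with the same coordinates, since the chart formula sees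
  only those values.\<close>

lemma curvature_field_eq:
  assumes W: "openin (manifold_topology A) W" "p \<in> W"
    and X: "smooth_vector_field A W X" and Y: "smooth_vector_field A W Y" and Z: "smooth_vector_field A W Z"
  shows "curvature A nab p (X p) (Y p) (Z p) = curvature_field A nab X Y Z p"
  unfolding curvature_def
proof (rule the_equality)
  show "\<exists>W' X' Y' Z'. openin (manifold_topology A) W' \<and> p \<in> W' \<and>
        smooth_vector_field A W' X' \<and> smooth_vector_field A W' Y' \<and> smooth_vector_field A W' Z' \<and>
        X' p = X p \<and> Y' p = Y p \<and> Z' p = Z p \<and> curvature_field A nab X Y Z p = curvature_field A nab X' Y' Z' p"
    using assms by blast
next
  fix w assume "\<exists>W' X' Y' Z'. openin (manifold_topology A) W' \<and> p \<in> W' \<and>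
        smooth_vector_field A W' X' \<and> smooth_vector_field A W' Y' \<and> smooth_vector_field A W' Z' \<and>
        X' p = X p \<and> Y' p = Y p \<and> Z' p = Z p \<and> w = curvature_field A nab X' Y' Z' p"
  then obtain W' X' Y' Z' where W': "openin (manifold_topology A) W'" "p \<in> W'"
    and s: "smooth_vector_field A W' X'" "smooth_vector_field A W' Y'" "smooth_vector_field A W' Z'"
    and eq: "X' p = X p" "Y' p = Y p" "Z' p = Z p" and w: "w = curvature_field A nab X' Y' Z' p"
    by blast
  note c = chart_at[OF atlas openin_subset_carrier[OF W]]
  show "w = curvature_field A nab X Y Z p"
    unfolding w
    by (rule tangent_eqI[OF atlas curvature_field_tangent[OF W' s] curvature_field_tangent[OF W X Y Z] c])
      (simp add: curvature_field_chart[OF W' c s] curvature_field_chart[OF W c X Y Z] eq)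
qed

section \<open>Symmetries of the curvature tensor at a point\<close>

context
  fixes c p assumes c: "c \<in> A" "p \<in> fst c"
begin

lemma chart_point_carrier: "p \<in> carrier A"
  using openin_subset_carrier[OF openin_chart[OF atlas c(1)] c(2)] .

lemma curvature_coordinate_fields:
  assumes T: "x \<in> tangent_space A p" "y \<in> tangent_space A p" "z \<in> tangent_space A p"
  shows "curvature A nab p x y z = curvature_field A nab (coordinate_field A c (x c)) (coordinate_field A c (y c)) (coordinate_field A c (z c)) p"
  using curvature_field_eq[OF openin_chart[OF atlas c(1)] c(2) smooth_coordinate_field[OF atlas c(1)]
      smooth_coordinate_field[OF atlas c(1)] smooth_coordinate_field[OF atlas c(1)], of "x c" "y c" "z c"]
    tangent_eq_coordinate_field[OF atlas T(1) c] tangent_eq_coordinate_field[OF atlas T(2) c]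
    tangent_eq_coordinate_field[OF atlas T(3) c] by simp

lemma curvature_tangent:
  assumes "x \<in> tangent_space A p" "y \<in> tangent_space A p" "z \<in> tangent_space A p"
  shows "curvature A nab p x y z \<in> tangent_space A p"
  unfolding curvature_coordinate_fields[OF assms]
  by (rule curvature_field_tangent[OF openin_chart[OF atlas c(1)] c(2)]) (rule smooth_coordinate_field[OF atlas c(1)])+

lemma curvature_chart:
  assumes "x \<in> tangent_space A p" "y \<in> tangent_space A p" "z \<in> tangent_space A p"
  shows "curvature A nab p x y z c = riemann_chart A nab c p (x c) (y c) (z c)"
  unfolding curvature_coordinate_fields[OF assms]
  by (subst curvature_field_chart[OF openin_chart[OF atlas c(1)] c(2) c])
    (simp_all add: smooth_coordinate_field[OF atlas c(1)] coordinate_field_same[OF atlas c])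

lemma curvature_skew:
  assumes T: "x \<in> tangent_space A p" "y \<in> tangent_space A p" "z \<in> tangent_space A p"
  shows "curvature A nab p x y z = - curvature A nab p y x z"
  by (rule tangent_eqI[OF atlas curvature_tangent[OF T] tangent_minus[OF atlas curvature_tangent[OF T(2,1,3)]] c])
    (simp add: curvature_chart[OF T] curvature_chart[OF T(2,1,3)] riemann_chart_def)

lemma curvature_bianchi:
  assumes T: "x \<in> tangent_space A p" "y \<in> tangent_space A p" "z \<in> tangent_space A p"
  shows "curvature A nab p x y z + curvature A nab p y z x + curvature A nab p z x y = 0"
proof (rule tangent_eqI[OF atlas _ tangent_zero[OF atlas] c])
  \<comment> \<open>The symbols are symmetric on the whole chart domain, hence so are their
    derivatives; with this the nine differences in the cyclic sum cancel.\<close>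
  have s: "frechet_derivative (\<lambda>x. christoffel A nab c (chart_inv c x) v w) (at (snd c p)) =
      frechet_derivative (\<lambda>x. christoffel A nab c (chart_inv c x) w v) (at (snd c p))" for v w
    by (rule frechet_derivative_transform_within_open[OF smooth_on_differentiable[OF christoffel_smooth[OF atlas levi_civita_affine c(1)]]
          open_chart_image[OF atlas c(1)]])
      (use c in \<open>auto intro: christoffel_sym chart_inv_in\<close>)
  show "(curvature A nab p x y z + curvature A nab p y z x + curvature A nab p z x y) c = 0 c"
    using s[of "x c" "y c"] s[of "y c" "z c"] s[of "x c" "z c"]
    by (simp add: curvature_chart T riemann_chart_def christoffel_sym[OF c, of "y c" "x c"] 
       christoffel_sym[OF c, of "z c" "x c"] christoffel_sym[OF c, of "z c" "y c"])
qed (intro tangent_add[OF atlas] curvature_tangent T)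

lemma directional_derivative_add:
  assumes v: "v \<in> tangent_space A p" and W: "openin (manifold_topology A) W" "p \<in> W"
    and f: "smooth_function A W f" and h: "smooth_function A W h"
  shows "directional_derivative A p v (\<lambda>q. f q + h q) = directional_derivative A p v f + directional_derivative A p v h"
proof -
  have pc: "snd c p \<in> snd c ` (fst c \<inter> W)" using c W by blast
  have d: "((k \<circ> chart_inv c) has_derivative frechet_derivative (k \<circ> chart_inv c) (at (snd c p))) (at (snd c p))"
    if "smooth_function A W k" for k
    using smooth_on_has_derivative[OF _ pc] that c(1) unfolding smooth_function_def by blast
  have s: "((\<lambda>q. f q + h q) \<circ> chart_inv c has_derivative
     (\<lambda>v. frechet_derivative (f \<circ> chart_inv c) (at (snd c p)) v + frechet_derivative (h \<circ> chart_inv c) (at (snd c p)) v)) (at (snd c p))"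
    using has_derivative_add[OF d[OF f] d[OF h]] by (simp add: o_def)
  show ?thesis
    using directional_derivative_chart[OF atlas v c differentiableI[OF s]]
      directional_derivative_chart[OF atlas v c differentiableI[OF d[OF f]]]
      directional_derivative_chart[OF atlas v c differentiableI[OF d[OF h]]]
    by (simp add: frechet_derivative_eq[OF s])
qed

text \<open>The function obtained by pairing the extensions of \<open>z\<close> and \<open>w\<close>
  has symmetric second derivatives. Expanding them in both orders and subtracting leaves the pairing
  of \<open>R(x, y)z\<close> with \<open>w\<close> plus that of \<open>z\<close> with
  \<open>R(x, y)w\<close>, which must therefore vanish.\<close>

lemma curvature_metric_skew:
  assumes T: "x \<in> tangent_space A p" "y \<in> tangent_space A p" "z \<in> tangent_space A p" "w \<in> tangent_space A p"
  shows "g p (curvature A nab p x y z) w = - g p (curvature A nab p x y w) z"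
proof -
  let ?W = "fst c" and ?F = "\<lambda>v. coordinate_field A c (v c)"
  have W: "openin (manifold_topology A) ?W" by (rule openin_chart[OF atlas c(1)])
  note s = smooth_coordinate_field[OF atlas c(1)]
  have sn: "smooth_vector_field A ?W (nab (?F a) (?F b))" for a b
    by (rule connection_smooth[OF atlas levi_civita_affine W s s])
  have Fp: "?F v p = v" if "v \<in> tangent_space A p" for v
    using tangent_eq_coordinate_field[OF atlas that c] by simp
  have dd: "directional_derivative A q (?F a q) f = frechet_derivative (f \<circ> chart_inv c) (at (snd c q)) (a c)"
    if "q \<in> fst c" "smooth_function A ?W f" for a q f
  proof -
    have "(f \<circ> chart_inv c) differentiable (at (snd c q))"
      using smooth_on_differentiable[of _ "f \<circ> chart_inv c"] that c(1) unfolding smooth_function_def by blast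
    from directional_derivative_chart[OF atlas coordinate_field_tangent[OF atlas c(1) that(1)] c(1) that(1) this]
    show ?thesis by (simp add: coordinate_field_same[OF atlas c(1) that(1)])
  qed
  let ?f = "\<lambda>q. g q (?F z q) (?F w q)"
  have f: "smooth_function A ?W ?f" by (rule smooth_metric_function[OF W s s])
  have fc: "smooth_on (snd c ` fst c) (?f \<circ> chart_inv c)" using f c(1) unfolding smooth_function_def by force
  \<comment> \<open>Metric compatibility applied twice. The two products of first covariant
    derivatives are interchanged when \<open>a\<close> and \<open>b\<close> are, so they disappear
    on antisymmetrising.\<close>
  have second: "g p (nab (?F a) (nab (?F b) (?F z)) p) w + g p (nab (?F b) (?F z) p) (nab (?F a) (?F w) p) +
      (g p (nab (?F a) (?F z) p) (nab (?F b) (?F w) p) + g p z (nab (?F a) (nab (?F b) (?F w)) p)) =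
     frechet_derivative (\<lambda>x. frechet_derivative (?f \<circ> chart_inv c) (at x) (b c)) (at (snd c p)) (a c)" for a b
  proof -
    let ?h1 = "\<lambda>q. g q (nab (?F b) (?F z) q) (?F w q)" and ?h2 = "\<lambda>q. g q (?F z q) (nab (?F b) (?F w) q)"
    have h1: "smooth_function A ?W ?h1" by (rule smooth_metric_function[OF W sn s])
    have h2: "smooth_function A ?W ?h2" by (rule smooth_metric_function[OF W s sn])
    have h: "smooth_on (snd c ` fst c) (\<lambda>x. ?h1 (chart_inv c x) + ?h2 (chart_inv c x))"
      using h1 h2 c(1) unfolding smooth_function_def o_def
      by (intro smooth_on_add open_chart_image[OF atlas c(1)]) force+
    have "directional_derivative A p (?F a p) (\<lambda>q. ?h1 q + ?h2 q) =
       frechet_derivative ((\<lambda>q. ?h1 q + ?h2 q) \<circ> chart_inv c) (at (snd c p)) (a c)"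
      by (rule dd[OF c(2) smooth_functionI[OF atlas c(1) W order_refl h]])
    also have "frechet_derivative ((\<lambda>q. ?h1 q + ?h2 q) \<circ> chart_inv c) (at (snd c p))
       = frechet_derivative (\<lambda>x. frechet_derivative (?f \<circ> chart_inv c) (at x) (b c)) (at (snd c p))"
    proof (rule frechet_derivative_transform_within_open[OF _ open_chart_image[OF atlas c(1)]])
      show "(\<lambda>q. ?h1 q + ?h2 q) \<circ> chart_inv c differentiable at (snd c p)"
        using smooth_on_differentiable[OF h] c(2) by (simp add: o_def)
      show "((\<lambda>q. ?h1 q + ?h2 q) \<circ> chart_inv c) x = frechet_derivative (?f \<circ> chart_inv c) (at x) (b c)"
        if "x \<in> snd c ` fst c" for x
        using metric_compatible[OF W s s s chart_inv_in[OF that], of "b c" "z c" "w c"] dd[OF chart_inv_in[OF that] f, of b]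
        by (simp add: chart_inv_right[OF that])
    qed (use c in blast)
    finally have "directional_derivative A p (?F a p) ?h1 + directional_derivative A p (?F a p) ?h2 =
        frechet_derivative (\<lambda>x. frechet_derivative (?f \<circ> chart_inv c) (at x) (b c)) (at (snd c p)) (a c)"
      using directional_derivative_add[OF coordinate_field_tangent[OF atlas c] W c(2) h1 h2] by simp
    then show ?thesis
      unfolding metric_compatible[OF W s sn s c(2)] metric_compatible[OF W s s sn c(2)] Fp[OF T(3)] Fp[OF T(4)] .
  qed
  \<comment> \<open>Coordinate fields commute, so the bracket term of the curvature drops
    out.\<close>
  have R: "curvature A nab p x y v = nab (?F x) (nab (?F y) (?F v)) p - nab (?F y) (nab (?F x) (?F v)) p"
    if "v \<in> tangent_space A p" for v
  proof -
    have "nab (lie_bracket A (?F x) (?F y)) (?F v) p = nab (\<lambda>q. 0) (?F v) p"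
      by (rule connection_cong[OF atlas levi_civita_affine W lie_bracket_smooth[OF W s s] s _ refl c(2)])
        (rule lie_bracket_coordinate_fields[OF c(1)])
    then show ?thesis
      using connection_zero_left[OF atlas levi_civita_affine W s c(2)]
      by (simp add: curvature_coordinate_fields[OF T(1,2) that] curvature_field_def)
  qed
  have nT: "nab U V p \<in> tangent_space A p" if "smooth_vector_field A ?W U" "smooth_vector_field A ?W V" for U V
    by (rule smooth_vector_fieldD(1)[OF atlas connection_smooth[OF atlas levi_civita_affine W that] c(2)])
  note nn = nT[OF s sn]
  have "g p (curvature A nab p x y z) w + g p z (curvature A nab p x y w) = 0"
    unfolding R[OF T(3)] R[OF T(4)] metric_diff_left[OF chart_point_carrier nn nn T(4)]
      metric_diff_right[OF chart_point_carrier nn nn T(3)]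
    using second[of x y] second[of y x]
      second_derivative_symmetric[OF fc open_chart_image[OF atlas c(1)], of "snd c p" "x c" "y c"] c(2)
    by simp
  then show ?thesis
    using metric_sym[OF chart_point_carrier T(3) curvature_tangent[OF T(1,2,4)]] by simp
qed

lemma curvature_metric_pair_symmetry:
  assumes T: "x \<in> tangent_space A p" "y \<in> tangent_space A p" "z \<in> tangent_space A p" "w \<in> tangent_space A p"
  shows "g p (curvature A nab p x y z) w = g p (curvature A nab p z w x) y"
proof (rule curvature_pair_symmetry[where r = "\<lambda>x y z w. g p (curvature A nab p x y z) w" and T = "tangent_space A p", OF _ _ _ T])
  note m = chart_point_carrier
  fix x y z w assume T: "x \<in> tangent_space A p" "y \<in> tangent_space A p" "z \<in> tangent_space A p" "w \<in> tangent_space A p"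
  show "g p (curvature A nab p x y z) w = - g p (curvature A nab p y x z) w"
    using curvature_skew[OF T(1-3)] metric_minus_left[OF m curvature_tangent[OF T(2,1,3)] T(4)] by simp
  show "g p (curvature A nab p x y z) w = - g p (curvature A nab p x y w) z"
    by (rule curvature_metric_skew[OF T])
  show "g p (curvature A nab p x y z) w + g p (curvature A nab p y z x) w + g p (curvature A nab p z x y) w = 0"
    using curvature_bianchi[OF T(1-3)] metric_zero_left[OF m T(4)]
      metric_add_left[OF m tangent_add[OF atlas curvature_tangent[OF T(1-3)] curvature_tangent[OF T(2,3,1)]] curvature_tangent[OF T(3,1,2)] T(4)]
      metric_add_left[OF m curvature_tangent[OF T(1-3)] curvature_tangent[OF T(2,3,1)] T(4)] by simp
qed

end

end

section \<open>Curves, parallel fields and geodesics\<close>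

lemma frechet_chain_vector_derivative:
  assumes "(y has_vector_derivative y') (at t within I)" "f differentiable (at (y t))"
  shows "((\<lambda>s. f (y s)) has_vector_derivative frechet_derivative f (at (y t)) y') (at t within I)"
proof -
  have f: "(f has_derivative frechet_derivative f (at (y t))) (at (y t))"
    using assms(2) frechet_derivative_works by blast
  from has_derivative_compose[OF assms(1)[unfolded has_vector_derivative_def] f] show ?thesis
    by (simp add: has_vector_derivative_def linear_cmul[OF has_derivative_linear[OF f]])
qed

text \<open>Separates the geodesic equation from the initial data recorded in
  \<open>geodesic_from\<close>, because uniqueness compares two curves and rescaling changes the
  data.\<close>

definition geodesic :: "('a, 'e::euclidean_space) chart set \<Rightarrow> ('a, 'e) connection \<Rightarrow> (real \<Rightarrow> 'a) \<Rightarrow> bool" where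
  "geodesic A nab \<gamma> \<longleftrightarrow> parallel_along A nab {0..1} \<gamma> (velocity A {0..1} \<gamma>)"

context
  fixes A :: "('a, 'e::euclidean_space) chart set" and nab :: "('a, 'e) connection"
  assumes atlas: "smooth_atlas A" and affine: "affine_connection A nab"
begin

lemma curve_near:
  assumes "continuous_map (top_of_set I) (manifold_topology A) \<gamma>" and t: "t \<in> I"
    and c: "c \<in> A" "\<gamma> t \<in> fst c" and S: "open S" "snd c (\<gamma> t) \<in> S"
  obtains \<delta> where "\<delta> > 0" "\<And>s. s \<in> I \<Longrightarrow> dist s t < \<delta> \<Longrightarrow> \<gamma> s \<in> fst c \<and> snd c (\<gamma> s) \<in> S"
proof -
  have "openin (top_of_set I) {s \<in> I. \<gamma> s \<in> {p \<in> fst c. snd c p \<in> S}}"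
    using openin_continuous_map_preimage[OF assms(1) openin_chart_preimage[OF atlas c(1) S(1)]] by simp
  then have "\<exists>e>0. \<forall>s\<in>I. dist s t < e \<longrightarrow> s \<in> {s \<in> I. \<gamma> s \<in> {p \<in> fst c. snd c p \<in> S}}"
    using t c S unfolding openin_euclidean_subtopology_iff by blast
  then show ?thesis using that by blast
qed

lemma continuous_map_chart_curve:
  assumes c: "c \<in> A" and y: "continuous_on I y" "\<And>t. t \<in> I \<Longrightarrow> y t \<in> snd c ` fst c"
  shows "continuous_map (top_of_set I) (manifold_topology A) (\<lambda>t. chart_inv c (y t))"
  unfolding continuous_map_def
proof (intro conjI allI impI)
  show "(\<lambda>t. chart_inv c (y t)) \<in> topspace (top_of_set I) \<rightarrow> topspace (manifold_topology A)"
    using chart_inv_in[OF y(2)] chart_subset_carrier[OF atlas c] by (auto simp: topspace_manifold[OF atlas])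
  fix W assume W: "openin (manifold_topology A) W"
  have "{t \<in> topspace (top_of_set I). chart_inv c (y t) \<in> W} = {t \<in> I. y t \<in> snd c ` (fst c \<inter> W)}"
    using y(2) by (auto simp: chart_image_Int[OF atlas c])
  also have "openin (top_of_set I) \<dots>"
    using continuous_openin_preimage_gen[OF y(1) openin_chart_image[OF atlas W c]]
    by (simp add: vimage_def Int_def)
  finally show "openin (top_of_set I) {t \<in> topspace (top_of_set I). chart_inv c (y t) \<in> W}" .
qed

lemma curve_velocity:
  assumes \<gamma>: "differentiable_curve A I \<gamma>" and t: "t \<in> I" and c: "c \<in> A" "\<gamma> t \<in> fst c"
  shows "((snd c \<circ> \<gamma>) has_vector_derivative velocity A I \<gamma> t c) (at t within I)"
  using \<gamma> t c unfolding differentiable_curve_def velocity_def by (simp add: vector_derivative_works)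

lemma chart_curve:
  assumes c: "c \<in> A" and y: "\<And>t. t \<in> {0..1} \<Longrightarrow> y t \<in> snd c ` fst c"
    and y': "\<And>t. t \<in> {0..1} \<Longrightarrow> (y has_vector_derivative y' t) (at t within {0..1})"
    and \<gamma>: "\<And>t. t \<in> {0..1} \<Longrightarrow> \<gamma> t = chart_inv c (y t)"
  shows "differentiable_curve A {0..1} \<gamma>"
    and "t \<in> {0..1} \<Longrightarrow> velocity A {0..1} \<gamma> t = coordinate_field A c (y' t) (\<gamma> t)"
proof -
  have cont: "continuous_on {0..1} y"
    using y' continuous_on_eq_continuous_within has_vector_derivative_continuous by blast
  have d: "((snd d \<circ> \<gamma>) has_vector_derivative coordinate_field A c (y' t) (\<gamma> t) d) (at t within {0..1})"
    if t: "t \<in> {0..1}" and d: "d \<in> A" "\<gamma> t \<in> fst d" for t d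
  proof -
    have p: "\<gamma> t \<in> fst c" "snd c (\<gamma> t) = y t" using y[OF t] \<gamma>[OF t] by (simp_all add: chart_inv_in chart_inv_right)
    have "((\<lambda>s. (snd d \<circ> chart_inv c) (y s)) has_vector_derivative
        frechet_derivative (snd d \<circ> chart_inv c) (at (y t)) (y' t)) (at t within {0..1})"
    proof (rule frechet_chain_vector_derivative[where f = "snd d \<circ> chart_inv c", OF y'[OF t]])
      show "snd d \<circ> chart_inv c differentiable at (y t)"
        using transition_differentiable[OF atlas c d(1) p(1) d(2)] unfolding p(2) .
    qed
    then have "((\<lambda>s. (snd d \<circ> chart_inv c) (y s)) has_vector_derivative coordinate_field A c (y' t) (\<gamma> t) d) (at t within {0..1})"
      using d p by (simp add: coordinate_field_def)
    then show ?thesis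
      by (rule has_vector_derivative_transform[OF t, rotated]) (simp add: \<gamma>)
  qed
  show "differentiable_curve A {0..1} \<gamma>"
    unfolding differentiable_curve_def
  proof (intro conjI ballI impI)
    show "continuous_map (top_of_set {0..1}) (manifold_topology A) \<gamma>"
      by (rule continuous_map_eq[OF continuous_map_chart_curve[OF c cont y]]) (simp_all add: \<gamma>)
    show "(snd d \<circ> \<gamma>) differentiable at t within {0..1}" if "t \<in> {0..1}" "d \<in> A" "\<gamma> t \<in> fst d" for t d
      using d[OF that] unfolding has_vector_derivative_def by (rule differentiableI)
  qed
  show "velocity A {0..1} \<gamma> t = coordinate_field A c (y' t) (\<gamma> t)" if t: "t \<in> {0..1}"
  proof
    fix d
    show "velocity A {0..1} \<gamma> t d = coordinate_field A c (y' t) (\<gamma> t) d"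
    proof (cases "d \<in> A \<and> \<gamma> t \<in> fst d")
      case True
      then show ?thesis
        using vector_derivative_within_closed_interval[OF _ t d[OF t]] by (simp add: velocity_def)
    next
      case False
      then show ?thesis by (auto simp: velocity_def coordinate_field_def)
    qed
  qed
qed

text \<open>\<open>parallel_along\<close> demands its equation in every chart that the curve meets.
  A solution in one chart provides all of them, since the second-derivative term in the
  transformation law of \<open>christoffel\<close> balances the derivative of the transition matrix
  along the curve.\<close>

lemma parallel_along_chart:
  assumes c: "c \<in> A" and y: "\<And>t. t \<in> {0..1} \<Longrightarrow> y t \<in> snd c ` fst c"
    and y': "\<And>t. t \<in> {0..1} \<Longrightarrow> (y has_vector_derivative y' t) (at t within {0..1})"
    and \<gamma>: "\<And>t. t \<in> {0..1} \<Longrightarrow> \<gamma> t = chart_inv c (y t)"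
    and V: "\<And>t. t \<in> {0..1} \<Longrightarrow> (V has_vector_derivative - christoffel A nab c (\<gamma> t) (y' t) (V t)) (at t within {0..1})"
  shows "parallel_along A nab {0..1} \<gamma> (\<lambda>t. coordinate_field A c (V t) (\<gamma> t))"
proof -
  have curve1: "differentiable_curve A {0..1} \<gamma>" by (rule chart_curve(1)[OF c y y' \<gamma>])
  have curve2: "velocity A {0..1} \<gamma> t = coordinate_field A c (y' t) (\<gamma> t)" if "t \<in> {0..1}" for t
    by (rule chart_curve(2)[OF c y y' \<gamma> that])
  have p: "\<gamma> t \<in> fst c" "snd c (\<gamma> t) = y t" if "t \<in> {0..1}" for t
    using y[OF that] \<gamma>[OF that] by (simp_all add: chart_inv_in chart_inv_right)
  show ?thesis
    unfolding parallel_along_def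
  proof (intro conjI ballI impI curve1)
    fix t :: real assume t: "t \<in> {0..1}"
    show "coordinate_field A c (V t) (\<gamma> t) \<in> tangent_space A (\<gamma> t)"
      by (rule coordinate_field_tangent[OF atlas c p(1)[OF t]])
    fix d assume d: "d \<in> A" "\<gamma> t \<in> fst d"
    let ?D = "\<lambda>x. frechet_derivative (snd d \<circ> chart_inv c) (at x)"
    let ?S = "snd c ` (fst c \<inter> fst d)"
    have S: "open ?S" "y t \<in> ?S"
      using open_chart_overlap[OF atlas c d(1)] p[OF t] d(2) by (auto intro: image_eqI[of _ _ "\<gamma> t"])
    have tr: "smooth_on ?S (snd d \<circ> chart_inv c)" by (rule smooth_transition[OF atlas c d(1)])
    have "((\<lambda>s. ?D (y s) (V s)) has_derivative
        (\<lambda>a. frechet_derivative (\<lambda>x. ?D x (V t)) (at (y t)) (a *\<^sub>R y' t) +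
           ?D (y t) (a *\<^sub>R (- christoffel A nab c (\<gamma> t) (y' t) (V t))))) (at t within {0..1})"
    proof (rule has_derivative_linear_family_compose[where \<Phi> = ?D and y = t and S = ?S])
      show "linear (?D x)" if "x \<in> ?S" for x
        using smooth_on_has_derivative[OF tr that] has_derivative_linear by blast
      show "(\<lambda>x. ?D x e) differentiable at (y t)" for e
        by (rule smooth_on_differentiable[OF smooth_on_frechet_derivative[OF tr] S(2)])
    qed (use y'[OF t] V[OF t] S in \<open>simp_all add: has_vector_derivative_def\<close>)
    moreover have "frechet_derivative (\<lambda>x. ?D x (V t)) (at (y t)) (a *\<^sub>R y' t) +
           ?D (y t) (a *\<^sub>R (- christoffel A nab c (\<gamma> t) (y' t) (V t)))
       = a *\<^sub>R (- christoffel A nab d (\<gamma> t) (?D (y t) (y' t)) (?D (y t) (V t)))" for a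
    proof -
      have l1: "linear (frechet_derivative (\<lambda>x. ?D x (V t)) (at (y t)))"
        using smooth_on_has_derivative[OF smooth_on_frechet_derivative[OF tr] S(2)] has_derivative_linear by blast
      have l2: "linear (?D (y t))" using smooth_on_has_derivative[OF tr S(2)] has_derivative_linear by blast
      show ?thesis
        using christoffel_change_chart[OF atlas affine c p(1)[OF t] d, of "y' t" "V t"]
        by (simp add: linear_cmul[OF l1] linear_cmul[OF l2] linear_neg[OF l2] p(2)[OF t] scaleR_add_right)
    qed
    ultimately have main: "((\<lambda>s. ?D (y s) (V s)) has_vector_derivative
        - christoffel A nab d (\<gamma> t) (?D (y t) (y' t)) (?D (y t) (V t))) (at t within {0..1})"
      by (simp add: has_vector_derivative_def)
    \<comment> \<open>Outside \<open>fst d\<close> the field has the default value 0 in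
      \<open>d\<close>; the expression through the transition derivative represents it only near
      \<open>t\<close>.\<close>
    obtain \<delta> where \<delta>: "\<delta> > 0" "\<And>s. s \<in> {0..1} \<Longrightarrow> dist s t < \<delta> \<Longrightarrow> \<gamma> s \<in> fst d"
      using curve_near[of "{0..1}" \<gamma> t d UNIV] curve1 t d unfolding differentiable_curve_def by auto
    have "((\<lambda>s. coordinate_field A c (V s) (\<gamma> s) d) has_vector_derivative
        - christoffel A nab d (\<gamma> t) (?D (y t) (y' t)) (?D (y t) (V t))) (at t within {0..1})"
      by (rule has_vector_derivative_transform_within[OF main \<delta>(1) t])
        (use \<delta>(2) p d(1) in \<open>simp add: coordinate_field_def\<close>)
    then show "((\<lambda>s. coordinate_field A c (V s) (\<gamma> s) d) has_vector_derivative
        - christoffel A nab d (\<gamma> t) (velocity A {0..1} \<gamma> t d) (coordinate_field A c (V t) (\<gamma> t) d)) (at t within {0..1})"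
      using p[OF t] d by (simp add: curve2[OF t] coordinate_field_def)
  qed
qed

section \<open>Uniqueness and rescaling of geodesics\<close>

lemma geodesic_curve: "geodesic A nab \<gamma> \<Longrightarrow> differentiable_curve A {0..1} \<gamma>"
  and geodesic_continuous: "geodesic A nab \<gamma> \<Longrightarrow> continuous_map (top_of_set {0..1}) (manifold_topology A) \<gamma>"
  by (simp_all add: geodesic_def parallel_along_def differentiable_curve_def)

lemma geodesic_ode:
  assumes \<gamma>: "geodesic A nab \<gamma>" and t: "t \<in> {0..1}" and c: "c \<in> A" "\<gamma> t \<in> fst c"
  shows "((\<lambda>s. (snd c (\<gamma> s), velocity A {0..1} \<gamma> s c)) has_vector_derivative
     (velocity A {0..1} \<gamma> t c, - christoffel A nab c (\<gamma> t) (velocity A {0..1} \<gamma> t c) (velocity A {0..1} \<gamma> t c))) (at t within {0..1})"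
proof -
  have "((\<lambda>s. velocity A {0..1} \<gamma> s c) has_vector_derivative
      - christoffel A nab c (\<gamma> t) (velocity A {0..1} \<gamma> t c) (velocity A {0..1} \<gamma> t c)) (at t within {0..1})"
    using \<gamma> t c unfolding geodesic_def parallel_along_def by blast
  with curve_velocity[OF geodesic_curve[OF \<gamma>] t c] show ?thesis
    by (intro has_vector_derivative_Pair) (simp_all add: o_def)
qed

text \<open>Position and velocity in a chart solve a first-order system with smooth right-hand side
  \<open>F\<close>. By continuity both states stay for a short time in a ball on which
  \<open>F\<close> is Lipschitz, and there uniqueness applies. The result looks forward in time, as
  the continuation argument does.\<close>

lemma geodesic_unique_local:
  assumes \<gamma>: "geodesic A nab \<gamma>" and \<beta>: "geodesic A nab \<beta>" and t: "t \<in> {0..1}"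
    and eq: "\<gamma> t = \<beta> t" "velocity A {0..1} \<gamma> t = velocity A {0..1} \<beta> t"
  obtains \<delta> where "\<delta> > 0" "\<And>s. s \<in> {0..1} \<Longrightarrow> t \<le> s \<Longrightarrow> s < t + \<delta> \<Longrightarrow> \<gamma> s = \<beta> s"
proof -
  have "\<gamma> t \<in> carrier A"
    using continuous_map_image_subset_topspace[OF geodesic_continuous[OF \<gamma>]] t topspace_manifold[OF atlas] by auto
  then obtain c where c: "c \<in> A" "\<gamma> t \<in> fst c" using chart_at[OF atlas] by blast
  define F where "F = (\<lambda>z. (snd z, - christoffel A nab c (chart_inv c (fst z)) (snd z) (snd z)))"
  define state where "state = (\<lambda>\<gamma> s. (snd c (\<gamma> s), velocity A {0..1} \<gamma> s c))"
  let ?S = "(snd c ` fst c) \<times> (UNIV :: 'e set)"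
  have S: "open ?S" using open_chart_image[OF atlas c(1)] by (simp add: open_Times)
  have "smooth_on ?S F"
    unfolding F_def
  proof (intro smooth_on_Pair smooth_on_minus smooth_on_snd smooth_on_ident S)
    have sf: "smooth_on ?S fst" using smooth_on_fst[OF S smooth_on_ident[OF S]] .
    have ss: "smooth_on ?S snd" using smooth_on_snd[OF S smooth_on_ident[OF S]] .
    have im: "fst ` ?S \<subseteq> snd c ` fst c" by auto
    show "smooth_on ?S (\<lambda>z. christoffel A nab c (chart_inv c (fst z)) (snd z) (snd z))"
    proof (rule smooth_on_bilinear_family[where \<Gamma> = "\<lambda>z. christoffel A nab c (chart_inv c (fst z))", OF S _ _ ss ss])
      show "bilinear (christoffel A nab c (chart_inv c (fst z)))" if "z \<in> ?S" for z
        using christoffel_bilinear[OF atlas affine c(1) chart_inv_in[of "fst z" c]] that by auto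
      show "smooth_on ?S (\<lambda>z. christoffel A nab c (chart_inv c (fst z)) v w)" for v w
        by (rule smooth_on_compose[where f = fst, OF S open_chart_image[OF atlas c(1)] im sf christoffel_smooth[OF atlas affine c(1)]])
    qed
  qed
  moreover have "state \<gamma> t \<in> ?S" using c by (simp add: state_def)
  ultimately obtain r L where r: "r > 0" "cball (state \<gamma> t) r \<subseteq> ?S"
    and L: "\<And>y z. y \<in> cball (state \<gamma> t) r \<Longrightarrow> z \<in> cball (state \<gamma> t) r \<Longrightarrow> norm (F y - F z) \<le> L * norm (y - z)"
    using smooth_on_locally_lipschitz[OF _ S] by metis
  have near: "\<exists>\<delta>>0. \<forall>s\<in>{0..1}. dist s t < \<delta> \<longrightarrow> \<alpha> s \<in> fst c \<and> state \<alpha> s \<in> cball (state \<gamma> t) r"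
    if \<alpha>: "geodesic A nab \<alpha>" "\<alpha> t = \<gamma> t" "state \<alpha> t = state \<gamma> t" for \<alpha>
  proof -
    have "continuous (at t within {0..1}) (state \<alpha>)"
      using geodesic_ode[OF \<alpha>(1) t c(1)] c(2) \<alpha>(2) unfolding state_def by (intro has_vector_derivative_continuous) auto
    then obtain \<delta>1 where \<delta>1: "\<delta>1 > 0" "\<And>s. s \<in> {0..1} \<Longrightarrow> dist s t < \<delta>1 \<Longrightarrow> dist (state \<alpha> s) (state \<alpha> t) < r"
      using r(1) unfolding continuous_within_eps_delta by metis
    obtain \<delta>2 where \<delta>2: "\<delta>2 > 0" "\<And>s. s \<in> {0..1} \<Longrightarrow> dist s t < \<delta>2 \<Longrightarrow> \<alpha> s \<in> fst c \<and> snd c (\<alpha> s) \<in> UNIV"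
      using curve_near[OF geodesic_continuous[OF \<alpha>(1)] t c(1) _ open_UNIV] c(2) \<alpha>(2) by auto
    show ?thesis
      using \<delta>1 \<delta>2 \<alpha>(3) by (intro exI[of _ "min \<delta>1 \<delta>2"]) (auto simp: dist_commute less_imp_le)
  qed
  have st: "state \<gamma> t = state \<beta> t" using eq by (simp add: state_def)
  obtain \<delta>1 where \<delta>1: "\<delta>1 > 0" "\<And>s. s \<in> {0..1} \<Longrightarrow> dist s t < \<delta>1 \<Longrightarrow> \<gamma> s \<in> fst c \<and> state \<gamma> s \<in> cball (state \<gamma> t) r"
    using near[OF \<gamma> refl refl] by blast
  obtain \<delta>2 where \<delta>2: "\<delta>2 > 0" "\<And>s. s \<in> {0..1} \<Longrightarrow> dist s t < \<delta>2 \<Longrightarrow> \<beta> s \<in> fst c \<and> state \<beta> s \<in> cball (state \<gamma> t) r"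
    using near[OF \<beta> eq(1)[symmetric] st[symmetric]] by blast
  show ?thesis
  proof (rule that[of "min \<delta>1 \<delta>2"])
    fix s assume s: "s \<in> {0..1}" "t \<le> s" "s < t + min \<delta>1 \<delta>2"
    have in1: "\<gamma> q \<in> fst c \<and> state \<gamma> q \<in> cball (state \<gamma> t) r" if "q \<in> {t..s}" for q
      using \<delta>1(2)[of q] that s t by (auto simp: dist_real_def)
    have in2: "\<beta> q \<in> fst c \<and> state \<beta> q \<in> cball (state \<gamma> t) r" if "q \<in> {t..s}" for q
      using \<delta>2(2)[of q] that s t by (auto simp: dist_real_def)
    have ode: "(state \<alpha> has_vector_derivative F (state \<alpha> q)) (at q within {t..s})"
      if "geodesic A nab \<alpha>" "q \<in> {t..s}" "\<alpha> q \<in> fst c" for \<alpha> q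
    proof -
      have "q \<in> {0..1}" using that s t by auto
      from geodesic_ode[OF that(1) this c(1) that(3)]
      have "(state \<alpha> has_vector_derivative F (state \<alpha> q)) (at q within {0..1})"
        using chart_inv_left[OF atlas c(1) that(3)] unfolding state_def F_def by simp
      then show ?thesis by (rule has_vector_derivative_within_subset) (use s t in auto)
    qed
    have "state \<gamma> s = state \<beta> s"
      by (rule ode_unique[where y = "state \<gamma>" and z = "state \<beta>" and a = t and b = s and F = "\<lambda>_. F" and L = L])
        (use ode[OF \<gamma>] ode[OF \<beta>] in1 in2 L st s in auto)
    then have "snd c (\<gamma> s) = snd c (\<beta> s)" by (simp add: state_def)
    then show "\<gamma> s = \<beta> s"
      using in1[of s] in2[of s] s(2) chart_inj[OF atlas c(1)] by (auto dest: inj_onD)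
  qed (use \<delta>1 \<delta>2 in simp)
qed

text \<open>For \<open>t > 0\<close> the velocity is determined by difference quotients from the
  left. This serves at the infimum of the times of disagreement, beyond which nothing is known
  yet.\<close>

lemma velocity_eq_on_initial_segment:
  assumes \<gamma>: "geodesic A nab \<gamma>" and \<beta>: "geodesic A nab \<beta>" and t: "t \<in> {0<..1}"
    and eq: "\<And>s. s \<in> {0..t} \<Longrightarrow> \<gamma> s = \<beta> s"
  shows "velocity A {0..1} \<gamma> t = velocity A {0..1} \<beta> t"
proof
  fix c
  have t': "t \<in> {0..1}" "0 < t" "t \<in> {0..t}" "{0..t} \<subseteq> {0..1}" using t by auto
  show "velocity A {0..1} \<gamma> t c = velocity A {0..1} \<beta> t c"
  proof (cases "c \<in> A \<and> \<gamma> t \<in> fst c")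
    case True
    then have c: "c \<in> A" "\<gamma> t \<in> fst c" "\<beta> t \<in> fst c" using eq[OF t'(3)] by auto
    have 1: "((snd c \<circ> \<gamma>) has_vector_derivative velocity A {0..1} \<gamma> t c) (at t within {0..t})"
      using curve_velocity[OF geodesic_curve[OF \<gamma>] t'(1) c(1,2)] t'(4) by (rule has_vector_derivative_within_subset)
    have "((snd c \<circ> \<beta>) has_vector_derivative velocity A {0..1} \<beta> t c) (at t within {0..t})"
      using curve_velocity[OF geodesic_curve[OF \<beta>] t'(1) c(1,3)] t'(4) by (rule has_vector_derivative_within_subset)
    then have "((snd c \<circ> \<gamma>) has_vector_derivative velocity A {0..1} \<beta> t c) (at t within {0..t})"
      by (rule has_vector_derivative_transform[OF t'(3), rotated]) (simp add: eq)
    with 1 show ?thesis using vector_derivative_within_closed_interval[OF t'(2,3)] by metis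
  next
    case False
    then show ?thesis using eq[OF t'(3)] by (auto simp: velocity_def)
  qed
qed

text \<open>At the infimum \<open>m\<close> of the times of disagreement the curves still agree,
  because in a Hausdorff space the set of agreement is closed; their velocities agree too. Local
  uniqueness then pushes the agreement past \<open>m\<close>, a contradiction.\<close>

lemma geodesic_unique:
  assumes haus: "Hausdorff_space (manifold_topology A)" and \<gamma>: "geodesic A nab \<gamma>" and \<beta>: "geodesic A nab \<beta>"
    and eq: "\<gamma> 0 = \<beta> 0" "velocity A {0..1} \<gamma> 0 = velocity A {0..1} \<beta> 0" and t: "t \<in> {0..1}"
  shows "\<gamma> t = \<beta> t"
proof (rule ccontr)
  define N where "N = {s \<in> {0..1}. \<gamma> s \<noteq> \<beta> s}"
  assume "\<gamma> t \<noteq> \<beta> t"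
  then have N: "N \<noteq> {}" "bdd_below N" using t by (auto simp: N_def)
  define m where "m = Inf N"
  have m: "m \<in> {0..1}"
    using N cInf_greatest[OF N(1), of 0] cInf_lower[OF _ N(2)] unfolding m_def N_def by force
  have below: "\<gamma> s = \<beta> s" if "s \<in> {0..<m}" for s
    using cInf_lower[OF _ N(2), of s] that m unfolding m_def N_def by force
  have "closedin (top_of_set {0..1}) {s \<in> topspace (top_of_set {0..1}). \<gamma> s = \<beta> s}"
    by (rule closedin_continuous_maps_eq[OF haus geodesic_continuous[OF \<gamma>] geodesic_continuous[OF \<beta>]])
  then have "closed {s \<in> {0..1}. \<gamma> s = \<beta> s}" using closedin_closed_trans[OF _ closed_atLeastAtMost] by simp
  moreover have "{0..<m} \<subseteq> {s \<in> {0..1}. \<gamma> s = \<beta> s}" using below m by auto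
  ultimately have cl: "closure {0..<m} \<subseteq> {s \<in> {0..1}. \<gamma> s = \<beta> s}" by (simp add: closure_minimal)
  have at_m: "\<gamma> s = \<beta> s" if "s \<in> {0..m}" for s
  proof (cases "m = 0")
    case True then show ?thesis using that eq by simp
  next
    case False then show ?thesis using cl that m by (auto simp: closure_atLeastLessThan)
  qed
  have "velocity A {0..1} \<gamma> m = velocity A {0..1} \<beta> m"
  proof (cases "m = 0")
    case False then show ?thesis using m at_m by (intro velocity_eq_on_initial_segment[OF \<gamma> \<beta>]) auto
  qed (use eq in simp)
  with at_m m obtain \<delta> where \<delta>: "\<delta> > 0" "\<And>s. s \<in> {0..1} \<Longrightarrow> m \<le> s \<Longrightarrow> s < m + \<delta> \<Longrightarrow> \<gamma> s = \<beta> s"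
    using geodesic_unique_local[OF \<gamma> \<beta> m] by (metis atLeastAtMost_iff order_refl)
  have "m + \<delta> \<le> Inf N"
  proof (rule cInf_greatest[OF N(1)])
    fix s assume "s \<in> N"
    then show "m + \<delta> \<le> s" using \<delta>(2)[of s] at_m[of s] unfolding N_def by force
  qed
  with \<delta>(1) show False by (simp add: m_def)
qed

text \<open>Slowing the parameter by \<open>t\<close> multiplies the velocity by \<open>t\<close>
  and its derivative by the square of \<open>t\<close>, which bilinearity of
  \<open>christoffel\<close> matches. The value \<open>t = 0\<close>, giving a constant geodesic, is
  included.\<close>

lemma geodesic_rescale:
  assumes \<gamma>: "geodesic A nab \<gamma>" and t: "t \<in> {0..1}"
  shows "geodesic A nab (\<lambda>s. \<gamma> (t * s))"
    and "s \<in> {0..1} \<Longrightarrow> velocity A {0..1} (\<lambda>s. \<gamma> (t * s)) s = t *\<^sub>R velocity A {0..1} \<gamma> (t * s)"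
proof -
  have ts: "t * s \<in> {0..1}" if "s \<in> {0..1}" for s using t that by (auto simp: mult_le_one)
  have dt: "((*) t has_vector_derivative t) (at s within {0..1})" for s
    using has_vector_derivative_mult_right[OF has_vector_derivative_id, of t] by (simp add: o_def)
  have chain: "((\<lambda>s. f (t * s)) has_vector_derivative t *\<^sub>R f') (at s within {0..1})"
    if f: "(f has_vector_derivative f') (at (t * s) within {0..1})" and s: "s \<in> {0..1}" for f :: "real \<Rightarrow> 'e" and f' s
  proof -
    have "(f has_vector_derivative f') (at (t * s) within (*) t ` {0..1})"
      by (rule has_vector_derivative_within_subset[OF f]) (use ts in auto)
    from vector_diff_chain_within[OF dt this] show ?thesis by (simp add: o_def)
  qed
  have v: "((snd c \<circ> (\<lambda>s. \<gamma> (t * s))) has_vector_derivative t *\<^sub>R velocity A {0..1} \<gamma> (t * s) c) (at s within {0..1})"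
    if "s \<in> {0..1}" "c \<in> A" "\<gamma> (t * s) \<in> fst c" for s c
    using chain[OF curve_velocity[OF geodesic_curve[OF \<gamma>] ts[OF that(1)] that(2,3)] that(1)] by (simp add: o_def)
  have vel: "velocity A {0..1} (\<lambda>s. \<gamma> (t * s)) s = t *\<^sub>R velocity A {0..1} \<gamma> (t * s)" if "s \<in> {0..1}" for s
  proof
    fix c show "velocity A {0..1} (\<lambda>s. \<gamma> (t * s)) s c = (t *\<^sub>R velocity A {0..1} \<gamma> (t * s)) c"
    proof (cases "c \<in> A \<and> \<gamma> (t * s) \<in> fst c")
      case True
      then have c: "c \<in> A" "\<gamma> (t * s) \<in> fst c" by auto
      have "velocity A {0..1} (\<lambda>s. \<gamma> (t * s)) s c = t *\<^sub>R velocity A {0..1} \<gamma> (t * s) c"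
        using vector_derivative_within_closed_interval[OF _ that v[OF that c]] c unfolding velocity_def[of A _ "\<lambda>s. \<gamma> (t * s)"] by simp
      then show ?thesis by (simp only: scaleR_fun_eval)
    next
      case False then show ?thesis by (auto simp: velocity_def scaleR_fun_eval)
    qed
  qed
  then show "s \<in> {0..1} \<Longrightarrow> velocity A {0..1} (\<lambda>s. \<gamma> (t * s)) s = t *\<^sub>R velocity A {0..1} \<gamma> (t * s)" .
  show "geodesic A nab (\<lambda>s. \<gamma> (t * s))"
    unfolding geodesic_def parallel_along_def
  proof (intro conjI ballI impI)
    have "continuous_map (top_of_set {0..1}) (top_of_set {0..1}) ((*) t)"
      using ts by (auto simp: continuous_map_in_subtopology intro!: continuous_intros)
    from continuous_map_compose[OF this geodesic_continuous[OF \<gamma>]]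
    have "continuous_map (top_of_set {0..1}) (manifold_topology A) (\<lambda>s. \<gamma> (t * s))" by (simp add: o_def)
    moreover have "(snd c \<circ> (\<lambda>s. \<gamma> (t * s))) differentiable (at s within {0..1})"
      if "s \<in> {0..1}" "c \<in> A" "\<gamma> (t * s) \<in> fst c" for s c
      using v[OF that] unfolding has_vector_derivative_def by (rule differentiableI)
    ultimately show "differentiable_curve A {0..1} (\<lambda>s. \<gamma> (t * s))"
      unfolding differentiable_curve_def by blast
    fix s :: real assume s: "s \<in> {0..1}"
    have "velocity A {0..1} \<gamma> (t * s) \<in> tangent_space A (\<gamma> (t * s))"
      using \<gamma> ts[OF s] unfolding geodesic_def parallel_along_def by blast
    then show "velocity A {0..1} (\<lambda>s. \<gamma> (t * s)) s \<in> tangent_space A (\<gamma> (t * s))"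
      unfolding vel[OF s] by (rule tangent_scaleR[OF atlas])
    fix c assume c: "c \<in> A" "\<gamma> (t * s) \<in> fst c"
    let ?v = "velocity A {0..1} \<gamma> (t * s) c"
    have "((\<lambda>s. velocity A {0..1} \<gamma> s c) has_vector_derivative - christoffel A nab c (\<gamma> (t * s)) ?v ?v) (at (t * s) within {0..1})"
      using \<gamma> ts[OF s] c unfolding geodesic_def parallel_along_def by blast
    from has_vector_derivative_scaleR[OF DERIV_const chain[OF this s], of t]
    have "((\<lambda>s. t *\<^sub>R velocity A {0..1} \<gamma> (t * s) c) has_vector_derivative
        - christoffel A nab c (\<gamma> (t * s)) (t *\<^sub>R ?v) (t *\<^sub>R ?v)) (at s within {0..1})"
      by (simp add: bilinearD[OF christoffel_bilinear[OF atlas affine c]])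
    then have "((\<lambda>s. velocity A {0..1} (\<lambda>s. \<gamma> (t * s)) s c) has_vector_derivative
        - christoffel A nab c (\<gamma> (t * s)) (t *\<^sub>R ?v) (t *\<^sub>R ?v)) (at s within {0..1})"
      by (rule has_vector_derivative_transform[OF s, rotated]) (simp add: vel scaleR_fun_eval)
    then show "((\<lambda>s. velocity A {0..1} (\<lambda>s. \<gamma> (t * s)) s c) has_vector_derivative
        - christoffel A nab c (\<gamma> (t * s)) (velocity A {0..1} (\<lambda>s. \<gamma> (t * s)) s c) (velocity A {0..1} (\<lambda>s. \<gamma> (t * s)) s c)) (at s within {0..1})"
      by (simp add: vel[OF s] scaleR_fun_eval)
  qed
qed

text \<open>The rescaled geodesic witnesses the definite description in \<open>exp_map\<close>, and
  uniqueness of geodesics identifies the end point of any other candidate with its own.\<close>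

lemma exp_map_ray:
  assumes haus: "Hausdorff_space (manifold_topology A)" and \<gamma>: "geodesic_from A nab p v \<gamma>" and t: "t \<in> {0..1}"
  shows "exp_map A nab p (t *\<^sub>R v) = \<gamma> t"
proof -
  have g: "geodesic A nab \<gamma>" "\<gamma> 0 = p" "velocity A {0..1} \<gamma> 0 = v"
    using \<gamma> by (simp_all add: geodesic_from_def geodesic_def)
  let ?\<beta> = "\<lambda>s. \<gamma> (t * s)"
  note b = geodesic_rescale[OF g(1) t]
  have \<beta>: "geodesic_from A nab p (t *\<^sub>R v) ?\<beta>"
    using b(1) b(2)[of 0] g(2,3) by (simp add: geodesic_from_def geodesic_def)
  show ?thesis
    unfolding exp_map_def
  proof (rule the_equality)
    show "\<exists>\<gamma>'. geodesic_from A nab p (t *\<^sub>R v) \<gamma>' \<and> \<gamma>' 1 = \<gamma> t" using \<beta> by auto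
    fix q assume "\<exists>\<gamma>'. geodesic_from A nab p (t *\<^sub>R v) \<gamma>' \<and> \<gamma>' 1 = q"
    then obtain \<alpha> where \<alpha>: "geodesic_from A nab p (t *\<^sub>R v) \<alpha>" "\<alpha> 1 = q" by blast
    have "\<alpha> 1 = ?\<beta> 1"
      by (rule geodesic_unique[OF haus _ b(1)]) (use \<alpha> \<beta> in \<open>simp_all add: geodesic_from_def geodesic_def\<close>)
    then show "q = \<gamma> t" using \<alpha>(2) by simp
  qed
qed

end

section \<open>The connection map in charts\<close>

context
  fixes A :: "('a, 'e::euclidean_space) chart set"
  assumes atlas: "smooth_atlas A"
begin

context
  fixes c p assumes c: "c \<in> A" "p \<in> fst c"
begin

lemma coordinate_field_eqI: "v \<in> tangent_space A p \<Longrightarrow> v c = e \<Longrightarrow> coordinate_field A c e p = v"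
  using tangent_eq_coordinate_field[OF atlas _ c, of v] by simp

lemma coordinate_field_scaleR: "coordinate_field A c (r *\<^sub>R e) p = r *\<^sub>R coordinate_field A c e p"
  by (rule coordinate_field_eqI[OF tangent_scaleR[OF atlas coordinate_field_tangent[OF atlas c]]])
    (simp add: scaleR_fun_eval coordinate_field_same[OF atlas c])

lemma coordinate_field_diff:
  "coordinate_field A c (e - e') p = coordinate_field A c e p - coordinate_field A c e' p"
  by (rule coordinate_field_eqI[OF tangent_diff[OF atlas coordinate_field_tangent[OF atlas c] coordinate_field_tangent[OF atlas c]]])
    (simp add: coordinate_field_same[OF atlas c])

lemma coordinate_field_zero: "coordinate_field A c 0 p = 0"
  by (rule coordinate_field_eqI[OF tangent_zero[OF atlas]]) simp

lemma tangent_space_chart: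
  "(tangent_space A p, \<lambda>v. v c) \<in> tangent_space_atlas A p"
  "chart_inv (tangent_space A p, \<lambda>v. v c) e = coordinate_field A c e p"
proof -
  show "(tangent_space A p, \<lambda>v. v c) \<in> tangent_space_atlas A p" 
    unfolding tangent_space_atlas_def using c by blast
  have "inj_on (\<lambda>v. v c) (tangent_space A p)"
    by (rule inj_onI) (rule tangent_eqI[OF atlas _ _ c])
  then show "chart_inv (tangent_space A p, \<lambda>v. v c) e = coordinate_field A c e p"
    unfolding chart_inv_def fst_conv snd_conv
    by (rule inv_into_f_eq) (simp_all add: coordinate_field_tangent[OF atlas c] coordinate_field_same[OF atlas c])
qed

end

end

context
  fixes A :: "('a, 'e::euclidean_space) chart set" and nab :: "('a, 'e) connection" and p V U
  assumes atlas: "smooth_atlas A" and haus: "Hausdorff_space (manifold_topology A)"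
    and affine: "affine_connection A nab" and nn: "normal_neighbourhood A nab p V U"
begin

private abbreviation (input) ex where "ex \<equiv> exp_map A nab p"

lemma normal_neighbourhoodD:
  shows "V \<subseteq> exp_domain A nab p" "0 \<in> V" "\<And>v t. v \<in> V \<Longrightarrow> t \<in> {0..1} \<Longrightarrow> t *\<^sub>R v \<in> V"
    "openin (manifold_topology A) U" "p \<in> U" "bij_betw ex V U"
    "smooth_map (tangent_space_atlas A p) A V ex" "smooth_map A (tangent_space_atlas A p) U (inv_into V ex)"
  using nn by (auto simp: normal_neighbourhood_def diffeomorphism_def)

lemma normal_neighbourhood_tangent: "v \<in> V \<Longrightarrow> v \<in> tangent_space A p"
  using normal_neighbourhoodD(1) by (auto simp: exp_domain_def)

lemma exp_map_zero: "ex 0 = p"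
proof -
  obtain \<gamma> where \<gamma>: "geodesic_from A nab p 0 \<gamma>"
    using normal_neighbourhoodD(1,2) by (auto simp: exp_domain_def)
  have "ex (0 *\<^sub>R 0) = \<gamma> 0" by (rule exp_map_ray[OF atlas affine haus \<gamma>]) simp
  then show ?thesis using \<gamma> by (simp add: geodesic_from_def)
qed

lemma inv_exp_map:
  assumes "q \<in> U" shows "inv_into V ex q \<in> V" "ex (inv_into V ex q) = q"
  using normal_neighbourhoodD(6) assms by (simp_all add: bij_betw_inv_into_right bij_betw_imp_surj_on inv_into_into)

section \<open>The exponential map and radial parallel transport in coordinates at the
  centre\<close>

context
  fixes c assumes c: "c \<in> A" "p \<in> fst c"
begin

private abbreviation (input) cf where "cf e \<equiv> coordinate_field A c e p"
text \<open>\<open>E d\<close> is the exponential map read from the coordinates of the tangent space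
  in \<open>c\<close> to the chart \<open>d\<close>; \<open>L\<close> is its inverse, the logarithm,
  read in \<open>c\<close>.\<close>

private abbreviation (input) E where "E \<equiv> \<lambda>d e. snd d (exp_map A nab p (coordinate_field A c e p))"
private abbreviation (input) L where "L \<equiv> \<lambda>x. inv_into V (exp_map A nab p) (chart_inv c x) c"

lemma exp_map_chart_smooth:
  assumes d: "d \<in> A"
  shows "open {e. cf e \<in> V \<and> ex (cf e) \<in> fst d}" "smooth_on {e. cf e \<in> V \<and> ex (cf e) \<in> fst d} (E d)"
proof -
  let ?C = "(tangent_space A p, \<lambda>v. v c)"
  have im: "snd ?C ` (fst ?C \<inter> V \<inter> ex -` fst d) = {e. cf e \<in> V \<and> ex (cf e) \<in> fst d}"
  proof (intro set_eqI iffI)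
    fix e assume "e \<in> {e. cf e \<in> V \<and> ex (cf e) \<in> fst d}"
    then show "e \<in> snd ?C ` (fst ?C \<inter> V \<inter> ex -` fst d)"
      by (intro image_eqI[of _ _ "cf e"]) (simp_all add: coordinate_field_same[OF atlas c] normal_neighbourhood_tangent)
  next
    fix e assume "e \<in> snd ?C ` (fst ?C \<inter> V \<inter> ex -` fst d)"
    then obtain v where "v \<in> V" "ex v \<in> fst d" "e = v c" by auto
    then show "e \<in> {e. cf e \<in> V \<and> ex (cf e) \<in> fst d}"
      using coordinate_field_eqI[OF atlas c normal_neighbourhood_tangent refl] by simp
  qed
  have "snd d \<circ> ex \<circ> chart_inv ?C = E d" by (simp add: fun_eq_iff tangent_space_chart(2)[OF atlas c])
  then show "open {e. cf e \<in> V \<and> ex (cf e) \<in> fst d}" "smooth_on {e. cf e \<in> V \<and> ex (cf e) \<in> fst d} (E d)"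
    using normal_neighbourhoodD(7)[unfolded smooth_map_def, THEN conjunct2, rule_format, OF tangent_space_chart(1)[OF atlas c] d]
    unfolding im by simp_all
qed

text \<open>Smoothness supplies some derivative at 0. Its value on \<open>w\<close> is read off
  along the ray through \<open>w\<close>, which the exponential map carries to the geodesic with
  initial velocity \<open>cf w\<close>; the derivative is one-sided, at the left end of
  \<open>{0..1}\<close>.\<close>

lemma exp_map_chart_derivative:
  assumes d: "d \<in> A" "p \<in> fst d"
  shows "(E d has_derivative frechet_derivative (snd d \<circ> chart_inv c) (at (snd c p))) (at 0)"
proof -
  let ?O = "{e. cf e \<in> V \<and> ex (cf e) \<in> fst d}" and ?D = "frechet_derivative (snd d \<circ> chart_inv c) (at (snd c p))"
  have 0: "0 \<in> ?O" using normal_neighbourhoodD(2) d(2) by (simp add: coordinate_field_zero[OF atlas c] exp_map_zero)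
  have E0: "(E d has_derivative frechet_derivative (E d) (at 0)) (at 0)"
    by (rule smooth_on_has_derivative[OF exp_map_chart_smooth(2)[OF d(1)] 0])
  have ray: "frechet_derivative (E d) (at 0) w = ?D w" if w: "w \<in> ?O" for w
  proof -
    obtain \<gamma> where \<gamma>: "geodesic_from A nab p (cf w) \<gamma>"
      using w normal_neighbourhoodD(1) by (auto simp: exp_domain_def)
    then have \<gamma>0: "geodesic A nab \<gamma>" "\<gamma> 0 = p" "velocity A {0..1} \<gamma> 0 = cf w"
      by (simp_all add: geodesic_from_def geodesic_def)
    have eq: "E d (0 + t *\<^sub>R w) = (snd d \<circ> \<gamma>) t" if "t \<in> {0..1}" for t
      using exp_map_ray[OF atlas affine haus \<gamma> that] by (simp add: coordinate_field_scaleR[OF atlas c])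
    have z: "(0::real) \<in> {0..1}" "(0::real) < 1" by simp_all
    have "E d differentiable at (0 + 0 *\<^sub>R w)" using differentiableI[OF E0] by simp
    from has_vector_derivative_at_within[OF line_has_vector_derivative[OF this]]
    have "((\<lambda>t. E d (0 + t *\<^sub>R w)) has_vector_derivative frechet_derivative (E d) (at 0) w) (at 0 within {0..1})"
      by simp
    moreover have "((snd d \<circ> \<gamma>) has_vector_derivative cf w d) (at 0 within {0..1})"
      using curve_velocity[OF atlas affine geodesic_curve[OF atlas affine \<gamma>0(1)] z(1) d(1)] \<gamma>0 d(2) by simp
    then have "((\<lambda>t. E d (0 + t *\<^sub>R w)) has_vector_derivative cf w d) (at 0 within {0..1})"
      by (rule has_vector_derivative_transform[OF z(1), rotated]) (rule eq)
    ultimately have "frechet_derivative (E d) (at 0) w = cf w d"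
      using vector_derivative_within_closed_interval[OF z(2,1)] by metis
    then show ?thesis using c d by (simp add: coordinate_field_def)
  qed
  obtain r where r: "r > 0" "ball 0 r \<subseteq> ?O"
    using exp_map_chart_smooth(1)[OF d(1)] 0 open_contains_ball by blast
  have "frechet_derivative (E d) (at 0) e = ?D e" for e
  proof -
    \<comment> \<open>Rays are available for vectors with \<open>cf w\<close> in \<open>V\<close>;
      \<open>e\<close> is scaled into a ball of such vectors, and linearity removes the factor
      again.\<close>
    define t where "t = r / (norm e + 1)"
    have n: "norm e + 1 > 0" by (simp add: add_nonneg_pos)
    have t: "t > 0" using r(1) n by (simp add: t_def)
    have "norm (t *\<^sub>R e) < r"
      using n r(1) by (simp add: t_def pos_divide_less_eq distrib_left)
    then have "frechet_derivative (E d) (at 0) (t *\<^sub>R e) = ?D (t *\<^sub>R e)"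
      by (intro ray subsetD[OF r(2)]) simp
    then have "t *\<^sub>R frechet_derivative (E d) (at 0) e = t *\<^sub>R ?D e"
      by (simp only: linear_cmul[OF has_derivative_linear[OF E0]] linear_cmul[OF transition_linear[OF atlas c(1) d(1) c(2) d(2)]])
    then show ?thesis using t by simp
  qed
  then have "frechet_derivative (E d) (at 0) = ?D" by (rule ext)
  with E0 show ?thesis by simp
qed

lemma inv_exp_map_chart_smooth: "smooth_on (snd c ` (fst c \<inter> U)) L"
proof -
  let ?C = "(tangent_space A p, \<lambda>v. v c)"
  have "fst c \<inter> U \<inter> inv_into V ex -` fst ?C = fst c \<inter> U"
    using inv_exp_map(1) normal_neighbourhood_tangent by auto
  then show ?thesis
    using normal_neighbourhoodD(8)[unfolded smooth_map_def, THEN conjunct2, rule_format, OF c(1) tangent_space_chart(1)[OF atlas c]]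
    by (simp add: o_def)
qed

lemma inv_exp_map_chart_zero: "L (snd c p) = 0"
proof -
  have "inv_into V ex p = 0"
    using normal_neighbourhoodD(2,6) exp_map_zero by (metis bij_betw_inv_into_left)
  then show ?thesis using chart_inv_left[OF atlas c] by simp
qed

text \<open>\<open>E c\<close> after \<open>L\<close> is the identity near \<open>snd c p\<close>,
  and \<open>E c\<close> has identity derivative at 0, so the chain rule leaves only the identity
  for the derivative of \<open>L\<close>.\<close>

lemma inv_exp_map_chart_derivative: "(L has_derivative (\<lambda>a. a)) (at (snd c p))"
proof -
  let ?S = "snd c ` (fst c \<inter> U)"
  have S: "open ?S" "snd c p \<in> ?S"
    using openin_chart_image[OF atlas normal_neighbourhoodD(4) c(1)] c(2) normal_neighbourhoodD(5) by auto
  have L: "(L has_derivative frechet_derivative L (at (snd c p))) (at (snd c p))"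
    by (rule smooth_on_has_derivative[OF inv_exp_map_chart_smooth S(2)])
  have E: "(E c has_derivative (\<lambda>v. v)) (at (L (snd c p)))"
    using exp_map_chart_derivative[OF c] unfolding inv_exp_map_chart_zero transition_same[OF atlas c] .
  have "((\<lambda>x. E c (L x)) has_derivative frechet_derivative L (at (snd c p))) (at (snd c p))"
    using has_derivative_compose[OF L E] by simp
  moreover have "((\<lambda>x. E c (L x)) has_derivative (\<lambda>a. a)) (at (snd c p))"
  proof (rule has_derivative_transform_within_open[OF has_derivative_ident S])
    fix x assume "x \<in> ?S"
    then obtain q where q: "q \<in> fst c" "q \<in> U" "x = snd c q" by blast
    have "cf (inv_into V ex q c) = inv_into V ex q"
      by (rule coordinate_field_eqI[OF atlas c normal_neighbourhood_tangent[OF inv_exp_map(1)[OF q(2)]] refl])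
    then show "x = E c (L x)" by (simp add: q(3) chart_inv_left[OF atlas c(1) q(1)] inv_exp_map(2)[OF q(2)])
  qed
  ultimately have "frechet_derivative L (at (snd c p)) = (\<lambda>a. a)" by (rule has_derivative_unique)
  with L show ?thesis by simp
qed

text \<open>Near \<open>(p, u)\<close>, \<open>transport_to\<close> is the time-one map of
  \<open>linear_transport\<close> precomposed with the logarithm \<open>L\<close> in the base
  coordinate. Since \<open>L\<close> vanishes at \<open>snd c p\<close> with identity derivative
  there, the derivative of the time-one map carries over unchanged.\<close>

lemma transport_to_chart:
  assumes u: "u \<in> tangent_space A p"
  obtains N \<Psi> where "open N" "(snd c p, u c) \<in> N"
    "\<And>z. z \<in> N \<Longrightarrow> transport_to A nab p V (chart_inv (tb_chart A c) z) = cf (\<Psi> z)"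
    "\<Psi> (snd c p, u c) = u c"
    "(\<Psi> has_derivative (\<lambda>z. snd z + christoffel A nab c p (fst z) (u c))) (at (snd c p, u c))"
proof -
  let ?O = "{e. cf e \<in> V \<and> ex (cf e) \<in> fst c}"
  note O = exp_map_chart_smooth[OF c(1)]
  have 0: "0 \<in> ?O" using normal_neighbourhoodD(2) c(2) by (simp add: coordinate_field_zero[OF atlas c] exp_map_zero)
  obtain r where r: "r > 0" "ball 0 r \<subseteq> ?O" using O(1) 0 open_contains_ball by blast
  let ?DE = "\<lambda>x. frechet_derivative (E c) (at x)"
  \<comment> \<open>The Christoffel symbols are pulled back by \<open>E c\<close> in the base point
    and in the velocity argument only; the transported field stays in the coordinates of
    \<open>c\<close>.\<close>
  define B where "B = (\<lambda>x a e. christoffel A nab c (ex (cf x)) (?DE x a) e)"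
  have Er: "smooth_on (ball 0 r) (E c)" by (rule smooth_on_subset[OF O(2) r(2)])
  have exc: "ex (cf x) \<in> fst c" if "x \<in> ball 0 r" for x using that r(2) by auto
  have ci: "chart_inv c (E c x) = ex (cf x)" if "x \<in> ball 0 r" for x by (rule chart_inv_left[OF atlas c(1) exc[OF that]])
  have Eim: "E c ` ball 0 r \<subseteq> snd c ` fst c" using exc by blast
  have DEl: "linear (?DE x)" if "x \<in> ball 0 r" for x
    using smooth_on_has_derivative[OF Er that] has_derivative_linear by blast
  have bilB: "bilinear (B x)" if x: "x \<in> ball 0 r" for x
    unfolding B_def bilinear_def linear_iff
    by (simp add: bilinearD[OF christoffel_bilinear[OF atlas affine c(1) exc[OF x]]] linear_add[OF DEl[OF x]] linear_cmul[OF DEl[OF x]])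
  have contB: "continuous_on (ball 0 r) (\<lambda>x. B x a e)" for a e
  proof -
    have "smooth_on (ball 0 r) (\<lambda>x. christoffel A nab c (chart_inv c (E c x)) (?DE x a) e)"
    proof (rule smooth_on_bilinear_family[where \<Gamma> = "\<lambda>x. christoffel A nab c (chart_inv c (E c x))", OF open_ball _ _ smooth_on_frechet_derivative[OF Er] smooth_on_const[OF open_ball]])
      show "bilinear (christoffel A nab c (chart_inv c (E c x)))" if "x \<in> ball 0 r" for x
        unfolding ci[OF that] by (rule christoffel_bilinear[OF atlas affine c(1) exc[OF that]])
      show "smooth_on (ball 0 r) (\<lambda>x. christoffel A nab c (chart_inv c (E c x)) v w)" for v w
        by (rule smooth_on_compose[where f = "E c", OF open_ball open_chart_image[OF atlas c(1)] Eim Er christoffel_smooth[OF atlas affine c(1)]])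
    qed
    then have "continuous_on (ball 0 r) (\<lambda>x. christoffel A nab c (chart_inv c (E c x)) (?DE x a) e)"
      by (rule smooth_on_continuous)
    then show ?thesis by (rule continuous_on_eq) (simp only: B_def ci)
  qed
  obtain \<delta> where \<delta>: "0 < \<delta>" "\<delta> \<le> r"
    and sol: "\<And>w y. w \<in> ball 0 \<delta> \<Longrightarrow> \<exists>V. linear_transport B w V \<and> V 0 = y"
    and uniq: "\<And>w V W t. w \<in> ball 0 \<delta> \<Longrightarrow> linear_transport B w V \<Longrightarrow> linear_transport B w W \<Longrightarrow>
       V 0 = W 0 \<Longrightarrow> t \<in> {0..1} \<Longrightarrow> V t = W t"
    and der: "\<And>\<Phi> u. \<forall>w\<in>ball 0 \<delta>. \<forall>V. linear_transport B w V \<longrightarrow> \<Phi> (w, V 0) = V 1 \<Longrightarrow>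
       (\<Phi> has_derivative (\<lambda>z. snd z + B 0 (fst z) u)) (at (0, u))"
    by (rule linear_transport_derivative[OF r(1) bilB contB]) (assumption | rule that)+
  define \<beta> where "\<beta> = (\<lambda>w t. ex ((1 - t) *\<^sub>R cf w))"
  have \<beta>1: "\<beta> w 1 = p" for w by (simp add: \<beta>_def exp_map_zero)
  have transport: "parallel_transport A nab (\<beta> w) (coordinate_field A c (W 0) (\<beta> w 0)) = cf (W 1)"
    if w: "w \<in> ball 0 \<delta>" and W: "linear_transport B w W" for w W
  proof -
    define y where "y = (\<lambda>t. E c ((1 - t) *\<^sub>R w))"
    \<comment> \<open>The path runs towards the centre, hence the sign; it cancels the minus sign in
      the equation for parallel fields and produces \<open>linear_transport\<close>.\<close>
    define y' where "y' = (\<lambda>t. - ?DE ((1 - t) *\<^sub>R w) w)"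
    have tw: "(1 - t) *\<^sub>R w \<in> ball 0 r" if "t \<in> {0..1}" for t
      using that w \<delta>(2) le_less_trans[OF mult_left_le_one_le[of "norm w" "1 - t"]] by auto
    have \<beta>E: "\<beta> w t = ex (cf ((1 - t) *\<^sub>R w))" for t by (simp add: \<beta>_def coordinate_field_scaleR[OF atlas c])
    have yc: "y t \<in> snd c ` fst c" if "t \<in> {0..1}" for t
      using Eim tw[OF that] unfolding y_def by blast
    have yd: "(y has_vector_derivative y' t) (at t within {0..1})" if t: "t \<in> {0..1}" for t
    proof -
      have "((\<lambda>t. (1 - t) *\<^sub>R w) has_vector_derivative - w) (at t within {0..1})"
        by (auto intro!: derivative_eq_intros)
      from frechet_chain_vector_derivative[OF this smooth_on_differentiable[OF Er tw[OF t]]]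
      show ?thesis unfolding y_def y'_def by (simp only: linear_neg[OF DEl[OF tw[OF t]]])
    qed
    have yi: "\<beta> w t = chart_inv c (y t)" if "t \<in> {0..1}" for t
      unfolding y_def ci[OF tw[OF that]] \<beta>E ..
    have bc: "\<beta> w t \<in> fst c" if "t \<in> {0..1}" for t unfolding \<beta>E by (rule exc[OF tw[OF that]])
    have BG: "- christoffel A nab c (\<beta> w t) (y' t) e = B ((1 - t) *\<^sub>R w) w e" if "t \<in> {0..1}" for t e
      using bilinearD(5)[OF christoffel_bilinear[OF atlas affine c(1) bc[OF that]]] unfolding B_def y'_def \<beta>E by simp
    show ?thesis
      unfolding parallel_transport_def
    proof (rule the_equality)
      have "parallel_along A nab {0..1} (\<beta> w) (\<lambda>t. coordinate_field A c (W t) (\<beta> w t))"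
        by (rule parallel_along_chart[OF atlas affine c(1) yc yd yi])
          (use W in \<open>simp_all add: BG linear_transport_def\<close>)
      then show "\<exists>V. parallel_along A nab {0..1} (\<beta> w) V \<and> V 0 = coordinate_field A c (W 0) (\<beta> w 0) \<and> V 1 = cf (W 1)"
        using \<beta>1[of w] by (intro exI[of _ "\<lambda>t. coordinate_field A c (W t) (\<beta> w t)"]) simp
      fix v assume "\<exists>V. parallel_along A nab {0..1} (\<beta> w) V \<and> V 0 = coordinate_field A c (W 0) (\<beta> w 0) \<and> V 1 = v"
      then obtain X where X: "parallel_along A nab {0..1} (\<beta> w) X" "X 0 = coordinate_field A c (W 0) (\<beta> w 0)" "X 1 = v" by blast
      \<comment> \<open>Conversely, every parallel field along the path, read in \<open>c\<close>,
        solves the same linear equation, so its end value is forced.\<close>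
      have "linear_transport B w (\<lambda>t. X t c)"
        unfolding linear_transport_def
      proof
        fix t :: real assume t: "t \<in> {0..1}"
        have "velocity A {0..1} (\<beta> w) t c = y' t"
          using chart_curve(2)[OF atlas affine c(1) yc yd yi t] coordinate_field_same[OF atlas c(1) bc[OF t]] by simp
        then show "((\<lambda>t. X t c) has_vector_derivative B ((1 - t) *\<^sub>R w) w (X t c)) (at t within {0..1})"
          using X(1) t c(1) bc[OF t] BG[OF t] unfolding parallel_along_def by metis
      qed
      moreover have "X 0 c = W 0" using X(2) coordinate_field_same[OF atlas c(1) bc[of 0]] by simp
      ultimately have "X 1 c = W 1" using uniq[OF w _ W, of "\<lambda>t. X t c" 1] by simp
      moreover have "X 1 \<in> tangent_space A p"
        using X(1) \<beta>1[of w] unfolding parallel_along_def by (metis atLeastAtMost_iff order_refl zero_le_one)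
      ultimately show "v = cf (W 1)" using coordinate_field_eqI[OF atlas c] X(3) by metis
    qed
  qed
  \<comment> \<open>Defined from \<open>parallel_transport\<close> for all arguments; for
    \<open>w\<close> in the ball of radius \<open>\<delta>\<close> it is the time-one map, as
    \<open>der\<close> requires.\<close>
  define \<Phi> where "\<Phi> = (\<lambda>z. parallel_transport A nab (\<beta> (fst z)) (coordinate_field A c (snd z) (\<beta> (fst z) 0)) c)"
  have \<Phi>: "\<Phi> (w, W 0) = W 1" if "w \<in> ball 0 \<delta>" "linear_transport B w W" for w W
    using transport[OF that] by (simp add: \<Phi>_def coordinate_field_same[OF atlas c])
  have transport\<Phi>: "parallel_transport A nab (\<beta> w) (coordinate_field A c e (\<beta> w 0)) = cf (\<Phi> (w, e))"
    if "w \<in> ball 0 \<delta>" for w e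
    using sol[OF that, of e] transport[OF that] \<Phi>[OF that] by metis
  have "linear_transport B 0 (\<lambda>t. u c)"
    using bilinearD(7)[OF bilB] r(1) by (simp add: linear_transport_def)
  then have \<Phi>0: "\<Phi> (0, u c) = u c" using \<Phi>[of 0 "\<lambda>t. u c"] \<delta>(1) by simp
  have B0: "B 0 a e = christoffel A nab c p a e" for a e
    using frechet_derivative_eq[OF exp_map_chart_derivative[OF c]]
    by (simp add: B_def coordinate_field_zero[OF atlas c] exp_map_zero transition_same[OF atlas c])
  have \<Phi>d: "(\<Phi> has_derivative (\<lambda>z. snd z + christoffel A nab c p (fst z) (u c))) (at (0, u c))"
  proof -
    have "\<forall>w\<in>ball 0 \<delta>. \<forall>V. linear_transport B w V \<longrightarrow> \<Phi> (w, V 0) = V 1" using \<Phi> by blast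
    from der[OF this, of "u c"] show ?thesis by (simp only: B0)
  qed
  let ?S = "snd c ` (fst c \<inter> U)"
  have S: "open ?S" "snd c p \<in> ?S"
    using openin_chart_image[OF atlas normal_neighbourhoodD(4) c(1)] c(2) normal_neighbourhoodD(5) by auto
  \<comment> \<open>The coordinates of vectors whose base point lies in \<open>U\<close> and has its
    logarithm in the ball where the transport equation is controlled.\<close>
  define N where "N = (?S \<inter> L -` ball 0 \<delta>) \<times> (UNIV :: 'e set)"
  define \<Psi> where "\<Psi> = (\<lambda>z. \<Phi> (L (fst z), snd z))"
  show ?thesis
  proof (rule that[of N \<Psi>])
    show "open N"
      unfolding N_def by (intro open_Times continuous_open_preimage smooth_on_continuous[OF inv_exp_map_chart_smooth] S open_ball open_UNIV)
    show "(snd c p, u c) \<in> N" using S(2) \<delta>(1) inv_exp_map_chart_zero by (simp add: N_def)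
    show "\<Psi> (snd c p, u c) = u c" by (simp add: \<Psi>_def inv_exp_map_chart_zero \<Phi>0)
    have f: "(fst has_derivative fst) (at (snd c p, u c))" by (rule bounded_linear_imp_has_derivative[OF bounded_linear_fst])
    have s: "(snd has_derivative snd) (at (snd c p, u c))" by (rule bounded_linear_imp_has_derivative[OF bounded_linear_snd])
    have L: "((\<lambda>z. L (fst z)) has_derivative (\<lambda>z. fst z)) (at (snd c p, u c))"
      using has_derivative_compose[OF f, of L "\<lambda>a. a"] inv_exp_map_chart_derivative by simp
    have "(\<Phi> has_derivative (\<lambda>z. snd z + christoffel A nab c p (fst z) (u c))) (at (L (fst (snd c p, u c)), snd (snd c p, u c)))"
      using \<Phi>d by (simp add: inv_exp_map_chart_zero)
    from has_derivative_compose[OF has_derivative_Pair[OF L s] this]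
    show "(\<Psi> has_derivative (\<lambda>z. snd z + christoffel A nab c p (fst z) (u c))) (at (snd c p, u c))"
      by (simp add: \<Psi>_def)
    fix z assume "z \<in> N"
    then obtain q e where q: "q \<in> fst c" "q \<in> U" and z: "z = (snd c q, e)" and Lz: "L (snd c q) \<in> ball 0 \<delta>"
      unfolding N_def by (cases z) auto
    have Lq: "L (snd c q) = inv_into V ex q c" by (simp add: chart_inv_left[OF atlas c(1) q(1)])
    have cfL: "cf (L (snd c q)) = inv_into V ex q"
      unfolding Lq by (rule coordinate_field_eqI[OF atlas c normal_neighbourhood_tangent[OF inv_exp_map(1)[OF q(2)]] refl])
    have \<beta>q: "\<beta> (L (snd c q)) 0 = q" unfolding \<beta>_def cfL using inv_exp_map(2)[OF q(2)] by simp
    have "chart_inv (tb_chart A c) z = (q, coordinate_field A c e q)"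
      using chart_inv_tb[OF atlas c(1), of "snd c q" e] q by (simp add: z chart_inv_left[OF atlas c(1)])
    then have "transport_to A nab p V (chart_inv (tb_chart A c) z) = parallel_transport A nab (\<beta> (L (snd c q))) (coordinate_field A c e q)"
      unfolding transport_to_def \<beta>_def cfL by simp
    also have "\<dots> = cf (\<Psi> z)"
      using transport\<Phi>[OF Lz, of e] unfolding \<beta>q by (simp add: \<Psi>_def z)
    finally show "transport_to A nab p V (chart_inv (tb_chart A c) z) = cf (\<Psi> z)" .
  qed
qed

text \<open>Transport minus \<open>u\<close> vanishes at \<open>(p, u)\<close>, so the outer
  exponential map is differentiated at 0, where it contributes only the change of chart from
  \<open>c\<close> to \<open>d\<close>. What remains is the derivative of the transport.\<close>

lemma differential_connection_map:
  assumes u: "u \<in> tangent_space A p" and \<xi>: "\<xi> \<in> tangent_space (tangent_bundle A) (p, u)"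
  shows "differential (tangent_bundle A) A (ex \<circ> (\<lambda>y. y - u) \<circ> transport_to A nab p V) (p, u) \<xi> =
    cf (snd (\<xi> (tb_chart A c)) + christoffel A nab c p (fst (\<xi> (tb_chart A c))) (u c))"
proof -
  let ?F = "ex \<circ> (\<lambda>y. y - u) \<circ> transport_to A nab p V" and ?C = "tb_chart A c"
  obtain N \<Psi> where N: "open N" "(snd c p, u c) \<in> N"
    and tr: "\<And>z. z \<in> N \<Longrightarrow> transport_to A nab p V (chart_inv ?C z) = cf (\<Psi> z)"
    and \<Psi>: "\<Psi> (snd c p, u c) = u c"
      "(\<Psi> has_derivative (\<lambda>z. snd z + christoffel A nab c p (fst z) (u c))) (at (snd c p, u c))"
    by (rule transport_to_chart[OF u]) (assumption | rule that)+
  have cu: "cf (u c) = u" by (rule coordinate_field_eqI[OF atlas c u refl])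
  have C: "?C \<in> tangent_bundle A" "(p, u) \<in> fst ?C" "snd ?C (p, u) = (snd c p, u c)"
    using c u by (simp_all add: tangent_bundle_eq fst_tb_chart snd_tb_chart mem_tb_over)
  have FN: "?F (chart_inv ?C z) = ex (cf (\<Psi> z - u c))" if "z \<in> N" for z
    using tr[OF that] by (simp add: coordinate_field_diff[OF atlas c] cu)
  have "chart_inv ?C (snd c p, u c) = (p, u)"
    using chart_inv_tb[OF atlas c(1), of "snd c p" "u c"] c by (simp add: chart_inv_left[OF atlas c] cu)
  then have Fp: "?F (p, u) = p" using FN[OF N(2)] by (simp add: \<Psi>(1) coordinate_field_zero[OF atlas c] exp_map_zero)
  show ?thesis
  proof
    fix d
    show "differential (tangent_bundle A) A ?F (p, u) \<xi> d = cf (snd (\<xi> ?C) + christoffel A nab c p (fst (\<xi> ?C)) (u c)) d"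
    proof (cases "d \<in> A \<and> p \<in> fst d")
      case True
      then have d: "d \<in> A" "p \<in> fst d" by auto
      have m: "((\<lambda>z. \<Psi> z - u c) has_derivative (\<lambda>z. snd z + christoffel A nab c p (fst z) (u c))) (at (snd c p, u c))"
        using has_derivative_diff[OF \<Psi>(2) has_derivative_const[of "u c"]] by simp
      have "(E d has_derivative frechet_derivative (snd d \<circ> chart_inv c) (at (snd c p))) (at (\<Psi> (snd c p, u c) - u c))"
        using exp_map_chart_derivative[OF d] by (simp add: \<Psi>(1))
      from has_derivative_compose[OF m this]
      have "((snd d \<circ> ?F \<circ> chart_inv ?C) has_derivative
          (\<lambda>z. frechet_derivative (snd d \<circ> chart_inv c) (at (snd c p)) (snd z + christoffel A nab c p (fst z) (u c)))) (at (snd c p, u c))"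
        by (rule has_derivative_transform_within_open[OF _ N]) (use FN in simp)
      from differential_chart[OF smooth_atlas_tangent_bundle[OF atlas] \<xi> C(1,2) d(1) _ this[folded C(3)]]
      show ?thesis using Fp d c by (simp add: coordinate_field_def)
    next
      case False
      then show ?thesis using Fp unfolding differential_def coordinate_field_def by (auto simp: Let_def)
    qed
  qed
qed

end

end

text \<open>The right-hand side contains neither \<open>V\<close> nor \<open>U\<close>, so the
  freedom in choosing the normal neighbourhood at each point does not affect
  \<open>K\<close>.\<close>

lemma connection_map_chart:
  assumes M: "smooth_manifold A" and affine: "affine_connection A nab" and K: "connection_map A nab K"
    and c: "c \<in> A" "p \<in> fst c" and u: "u \<in> tangent_space A p"
    and \<xi>: "\<xi> \<in> tangent_space (tangent_bundle A) (p, u)"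
  shows "K (p, u) \<xi> = coordinate_field A c (snd (\<xi> (tb_chart A c)) + christoffel A nab c p (fst (\<xi> (tb_chart A c))) (u c)) p"
proof -
  have atlas: "smooth_atlas A" and haus: "Hausdorff_space (manifold_topology A)"
    using M by (simp_all add: smooth_manifold_def)
  have "(p, u) \<in> carrier (tangent_bundle A)"
    using c u chart_subset_carrier[OF atlas c(1)] by (auto simp: carrier_tangent_bundle mem_tb_over)
  then obtain V U where nn: "normal_neighbourhood A nab p V U" and
    "K (p, u) \<xi> = differential (tangent_bundle A) A (exp_map A nab p \<circ> (\<lambda>y. y - u) \<circ> transport_to A nab p V) (p, u) \<xi>"
    using K \<xi> unfolding connection_map_def by blast
  then show ?thesis using differential_connection_map[OF atlas haus affine nn c u \<xi>] by simp
qed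

section \<open>Horizontal and vertical lifts\<close>

context
  fixes A :: "('a, 'e::euclidean_space) chart set" and nab :: "('a, 'e) connection"
    and K :: "'a \<times> ('a, 'e) tvec \<Rightarrow> ('a \<times> ('a, 'e) tvec, 'e \<times> 'e) tvec \<Rightarrow> ('a, 'e) tvec"
  assumes M: "smooth_manifold A" and affine: "affine_connection A nab" and K: "connection_map A nab K"
begin

private lemma atlas: "smooth_atlas A"
  using M by (simp add: smooth_manifold_def)

private lemma atlas_tb: "smooth_atlas (tangent_bundle A)"
  by (rule smooth_atlas_tangent_bundle[OF atlas])

context
  fixes c assumes c: "c \<in> A"
begin

lemma d_proj_chart:
  assumes p: "p \<in> fst c" and u: "u \<in> tangent_space A p" and \<xi>: "\<xi> \<in> tangent_space (tangent_bundle A) (p, u)"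
  shows "d_proj A (p, u) \<xi> = coordinate_field A c (fst (\<xi> (tb_chart A c))) p"
proof
  fix d
  let ?C = "tb_chart A c"
  have C: "?C \<in> tangent_bundle A" "(p, u) \<in> fst ?C" "snd ?C (p, u) = (snd c p, u c)"
    using c p u by (simp_all add: tangent_bundle_eq fst_tb_chart snd_tb_chart mem_tb_over)
  show "d_proj A (p, u) \<xi> d = coordinate_field A c (fst (\<xi> ?C)) p d"
  proof (cases "d \<in> A \<and> p \<in> fst d")
    case True
    then have d: "d \<in> A" "p \<in> fst d" by auto
    have f: "(fst has_derivative fst) (at (snd c p, u c))" by (rule bounded_linear_imp_has_derivative[OF bounded_linear_fst])
    have "((snd d \<circ> chart_inv c) has_derivative frechet_derivative (snd d \<circ> chart_inv c) (at (snd c p))) (at (fst (snd c p, u c)))"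
      using transition_differentiable[OF atlas c d(1) p d(2)] by (simp flip: frechet_derivative_works)
    from has_derivative_compose[OF f this]
    have "((snd d \<circ> fst \<circ> chart_inv ?C) has_derivative (\<lambda>z. frechet_derivative (snd d \<circ> chart_inv c) (at (snd c p)) (fst z))) (at (snd c p, u c))"
      by (rule has_derivative_transform_within_open[of _ _ _ _ "snd c ` fst c \<times> UNIV"])
        (use open_chart_image[OF atlas c] p in \<open>auto simp: open_Times chart_inv_tb[OF atlas c]\<close>)
    from differential_chart[OF atlas_tb \<xi> C(1,2) d(1) _ this[folded C(3)]]
    show ?thesis using d c p by (simp add: d_proj_def coordinate_field_def)
  next
    case False
    then show ?thesis unfolding d_proj_def differential_def coordinate_field_def by (auto simp: Let_def)
  qed
qed

context
  fixes p u assumes p: "p \<in> fst c" and u: "u \<in> tangent_space A p"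
begin

private lemma C: "tb_chart A c \<in> tangent_bundle A" "(p, u) \<in> fst (tb_chart A c)"
  "snd (tb_chart A c) (p, u) = (snd c p, u c)"
  using c p u by (simp_all add: tangent_bundle_eq fst_tb_chart snd_tb_chart mem_tb_over)

lemma d_proj_tangent: "\<xi> \<in> tangent_space (tangent_bundle A) (p, u) \<Longrightarrow> d_proj A (p, u) \<xi> \<in> tangent_space A p"
  and connection_map_tangent: "\<xi> \<in> tangent_space (tangent_bundle A) (p, u) \<Longrightarrow> K (p, u) \<xi> \<in> tangent_space A p"
  by (simp_all add: d_proj_chart[OF p u] connection_map_chart[OF M affine K c p u] coordinate_field_tangent[OF atlas c p])

text \<open>The chart formulas of \<open>d_proj\<close> and \<open>K\<close> form a triangular
  system in the two coordinates and are solved here for them. Hence the two projections determine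
  the vector and can be prescribed independently, which is the splitting into horizontal and
  vertical subspaces.\<close>

lemma tb_tangent_chart:
  assumes \<xi>: "\<xi> \<in> tangent_space (tangent_bundle A) (p, u)"
  shows "\<xi> (tb_chart A c) = (d_proj A (p, u) \<xi> c, K (p, u) \<xi> c - christoffel A nab c p (d_proj A (p, u) \<xi> c) (u c))"
  by (simp add: d_proj_chart[OF p u \<xi>] connection_map_chart[OF M affine K c p u \<xi>] coordinate_field_same[OF atlas c p])

lemma tb_tangent_eqI:
  assumes "\<xi> \<in> tangent_space (tangent_bundle A) (p, u)" "\<eta> \<in> tangent_space (tangent_bundle A) (p, u)"
    and "d_proj A (p, u) \<xi> = d_proj A (p, u) \<eta>" "K (p, u) \<xi> = K (p, u) \<eta>"
  shows "\<xi> = \<eta>"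
  by (rule tangent_eqI[OF atlas_tb assms(1,2) C(1,2)]) (simp add: tb_tangent_chart assms)

lemma tb_tangent_exists:
  assumes x: "x \<in> tangent_space A p" and z: "z \<in> tangent_space A p"
  defines "\<xi> \<equiv> coordinate_field (tangent_bundle A) (tb_chart A c) (x c, z c - christoffel A nab c p (x c) (u c)) (p, u)"
  shows "\<xi> \<in> tangent_space (tangent_bundle A) (p, u)" "d_proj A (p, u) \<xi> = x" "K (p, u) \<xi> = z"
proof -
  show \<xi>: "\<xi> \<in> tangent_space (tangent_bundle A) (p, u)"
    unfolding \<xi>_def by (rule coordinate_field_tangent[OF atlas_tb C(1,2)])
  have "\<xi> (tb_chart A c) = (x c, z c - christoffel A nab c p (x c) (u c))"
    unfolding \<xi>_def by (rule coordinate_field_same[OF atlas_tb C(1,2)])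
  then show "d_proj A (p, u) \<xi> = x" "K (p, u) \<xi> = z"
    using d_proj_chart[OF p u \<xi>] connection_map_chart[OF M affine K c p u \<xi>]
      coordinate_field_eqI[OF atlas c p x refl] coordinate_field_eqI[OF atlas c p z refl] by simp_all
qed

lemma horizontal_lift_at:
  assumes x: "x \<in> tangent_space A p"
  shows "horizontal_lift_at A K (p, u) x \<in> tangent_space (tangent_bundle A) (p, u)"
    "d_proj A (p, u) (horizontal_lift_at A K (p, u) x) = x" "K (p, u) (horizontal_lift_at A K (p, u) x) = 0"
    "horizontal_lift_at A K (p, u) x (tb_chart A c) = (x c, - christoffel A nab c p (x c) (u c))"
proof -
  note e = tb_tangent_exists[OF x tangent_zero[OF atlas]]
  have "\<exists>!\<xi>. \<xi> \<in> tangent_space (tangent_bundle A) (p, u) \<and> d_proj A (p, u) \<xi> = x \<and> K (p, u) \<xi> = 0"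
    by (rule ex_ex1I) (blast intro: e, metis tb_tangent_eqI)
  from theI'[OF this]
  have "horizontal_lift_at A K (p, u) x \<in> tangent_space (tangent_bundle A) (p, u) \<and>
      d_proj A (p, u) (horizontal_lift_at A K (p, u) x) = x \<and> K (p, u) (horizontal_lift_at A K (p, u) x) = 0"
    unfolding horizontal_lift_at_def .
  then show h: "horizontal_lift_at A K (p, u) x \<in> tangent_space (tangent_bundle A) (p, u)"
    "d_proj A (p, u) (horizontal_lift_at A K (p, u) x) = x" "K (p, u) (horizontal_lift_at A K (p, u) x) = 0" by auto
  show "horizontal_lift_at A K (p, u) x (tb_chart A c) = (x c, - christoffel A nab c p (x c) (u c))"
    by (simp add: tb_tangent_chart[OF h(1)] h(2,3))
qed

lemma vertical_lift_at:
  assumes x: "x \<in> tangent_space A p"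
  shows "vertical_lift_at A K (p, u) x \<in> tangent_space (tangent_bundle A) (p, u)"
    "d_proj A (p, u) (vertical_lift_at A K (p, u) x) = 0" "K (p, u) (vertical_lift_at A K (p, u) x) = x"
    "vertical_lift_at A K (p, u) x (tb_chart A c) = (0, x c)"
proof -
  note e = tb_tangent_exists[OF tangent_zero[OF atlas] x]
  have "\<exists>!\<xi>. \<xi> \<in> tangent_space (tangent_bundle A) (p, u) \<and> d_proj A (p, u) \<xi> = 0 \<and> K (p, u) \<xi> = x"
    by (rule ex_ex1I) (blast intro: e, metis tb_tangent_eqI)
  from theI'[OF this]
  have "vertical_lift_at A K (p, u) x \<in> tangent_space (tangent_bundle A) (p, u) \<and>
      d_proj A (p, u) (vertical_lift_at A K (p, u) x) = 0 \<and> K (p, u) (vertical_lift_at A K (p, u) x) = x"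
    unfolding vertical_lift_at_def .
  then show h: "vertical_lift_at A K (p, u) x \<in> tangent_space (tangent_bundle A) (p, u)"
    "d_proj A (p, u) (vertical_lift_at A K (p, u) x) = 0" "K (p, u) (vertical_lift_at A K (p, u) x) = x" by auto
  show "vertical_lift_at A K (p, u) x (tb_chart A c) = (0, x c)"
    by (simp add: tb_tangent_chart[OF h(1)] h(2,3) bilinearD(7)[OF christoffel_bilinear[OF atlas affine c p]])
qed

lemma tb_tangent_decompose:
  assumes \<xi>: "\<xi> \<in> tangent_space (tangent_bundle A) (p, u)"
  shows "\<xi> = horizontal_lift_at A K (p, u) (d_proj A (p, u) \<xi>) + vertical_lift_at A K (p, u) (K (p, u) \<xi>)"
proof -
  note h = horizontal_lift_at[OF d_proj_tangent[OF \<xi>]] and v = vertical_lift_at[OF connection_map_tangent[OF \<xi>]]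
  show ?thesis
    by (rule tangent_eqI[OF atlas_tb \<xi> tangent_add[OF atlas_tb h(1) v(1)] C(1,2)])
      (simp add: h(4) v(4) tb_tangent_chart[OF \<xi>])
qed

end

section \<open>Lifts as smooth vector fields over a chart, and their derivatives\<close>

private lemma tb_domain: "snd (tb_chart A c) ` fst (tb_chart A c) = snd c ` fst c \<times> UNIV"
  using tb_chart_image[OF atlas c, of "fst c"] by (simp add: fst_tb_chart)

private lemma tb_domain_open: "open (snd c ` fst c \<times> (UNIV :: 'e set))"
  by (intro open_Times open_chart_image[OF atlas c] open_UNIV)

lemma lift_chart:
  assumes X: "smooth_vector_field A (fst c) X" and z: "z \<in> snd c ` fst c \<times> UNIV"
  shows "horizontal_lift A K X (chart_inv (tb_chart A c) z) (tb_chart A c) =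
      (X (chart_inv c (fst z)) c, - christoffel A nab c (chart_inv c (fst z)) (X (chart_inv c (fst z)) c) (snd z))"
    and "vertical_lift A K X (chart_inv (tb_chart A c) z) (tb_chart A c) = (0, X (chart_inv c (fst z)) c)"
proof -
  have x: "fst z \<in> snd c ` fst c" using z by auto
  have q: "chart_inv c (fst z) \<in> fst c" by (rule chart_inv_in[OF x])
  have i: "chart_inv (tb_chart A c) z = (chart_inv c (fst z), coordinate_field A c (snd z) (chart_inv c (fst z)))"
    using chart_inv_tb[OF atlas c x, of "snd z"] by simp
  show "horizontal_lift A K X (chart_inv (tb_chart A c) z) (tb_chart A c) =
      (X (chart_inv c (fst z)) c, - christoffel A nab c (chart_inv c (fst z)) (X (chart_inv c (fst z)) c) (snd z))"
    "vertical_lift A K X (chart_inv (tb_chart A c) z) (tb_chart A c) = (0, X (chart_inv c (fst z)) c)"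
    unfolding horizontal_lift_def vertical_lift_def i
    by (simp_all add: horizontal_lift_at(4)[OF q coordinate_field_tangent[OF atlas c q] smooth_vector_fieldD(1)[OF atlas X q]]
        vertical_lift_at(4)[OF q coordinate_field_tangent[OF atlas c q] smooth_vector_fieldD(1)[OF atlas X q]]
        coordinate_field_same[OF atlas c q])
qed

text \<open>The fibre coordinate enters the horizontal lift only through the bilinear
  \<open>christoffel\<close>, so smoothness of the symbols over the base gives joint smoothness on
  the bundle.\<close>

lemma lift_smooth:
  assumes X: "smooth_vector_field A (fst c) X"
  shows "smooth_vector_field (tangent_bundle A) (tb_over A (fst c)) (horizontal_lift A K X)"
    and "smooth_vector_field (tangent_bundle A) (tb_over A (fst c)) (vertical_lift A K X)"
proof -
  let ?S = "snd c ` fst c \<times> (UNIV :: 'e set)"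
  have C: "tb_chart A c \<in> tangent_bundle A" using c by (simp add: tangent_bundle_eq)
  have W: "openin (manifold_topology (tangent_bundle A)) (tb_over A (fst c))"
    by (rule openin_tb_over[OF atlas openin_chart[OF atlas c]])
  have sub: "tb_over A (fst c) \<subseteq> fst (tb_chart A c)" by (simp add: fst_tb_chart)
  note S = tb_domain_open
  have im: "snd (tb_chart A c) ` tb_over A (fst c) = ?S" using tb_domain by (simp add: fst_tb_chart)
  have F: "fst ` ?S \<subseteq> snd c ` fst c" by auto
  have sf: "smooth_on ?S fst" using smooth_on_fst[OF S smooth_on_ident[OF S]] .
  have ss: "smooth_on ?S snd" using smooth_on_snd[OF S smooth_on_ident[OF S]] .
  have Xc: "smooth_on (snd c ` fst c) (\<lambda>x. X (chart_inv c x) c)"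
    using smooth_vector_fieldD(2)[OF atlas X c] by simp
  have sX: "smooth_on ?S (\<lambda>z. X (chart_inv c (fst z)) c)"
    by (rule smooth_on_compose[where f = fst, OF S open_chart_image[OF atlas c] F sf Xc])
  have sG: "smooth_on ?S (\<lambda>z. christoffel A nab c (chart_inv c (fst z)) (X (chart_inv c (fst z)) c) (snd z))"
  proof (rule smooth_on_bilinear_family[where \<Gamma> = "\<lambda>z. christoffel A nab c (chart_inv c (fst z))", OF S _ _ sX ss])
    show "bilinear (christoffel A nab c (chart_inv c (fst z)))" if "z \<in> ?S" for z
      using christoffel_bilinear[OF atlas affine c chart_inv_in[of "fst z" c]] that by auto
    show "smooth_on ?S (\<lambda>z. christoffel A nab c (chart_inv c (fst z)) v w)" for v w
      by (rule smooth_on_compose[where f = fst, OF S open_chart_image[OF atlas c] F sf christoffel_smooth[OF atlas affine c]])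
  qed
  show "smooth_vector_field (tangent_bundle A) (tb_over A (fst c)) (horizontal_lift A K X)"
  proof (rule smooth_vector_fieldI[OF atlas_tb C W sub], unfold im)
    show "smooth_on ?S (\<lambda>z. horizontal_lift A K X (chart_inv (tb_chart A c) z) (tb_chart A c))"
      by (rule smooth_on_cong[OF S smooth_on_Pair[OF S sX smooth_on_minus[OF S sG]]]) (rule lift_chart(1)[OF X, symmetric])
    fix Q assume "Q \<in> tb_over A (fst c)"
    then obtain q y where Q: "Q = (q, y)" "q \<in> fst c" "y \<in> tangent_space A q" by (cases Q) (simp add: mem_tb_over)
    show "horizontal_lift A K X Q \<in> tangent_space (tangent_bundle A) Q"
      using horizontal_lift_at(1)[OF Q(2,3) smooth_vector_fieldD(1)[OF atlas X Q(2)]] by (simp add: Q(1) horizontal_lift_def)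
  qed
  show "smooth_vector_field (tangent_bundle A) (tb_over A (fst c)) (vertical_lift A K X)"
  proof (rule smooth_vector_fieldI[OF atlas_tb C W sub], unfold im)
    show "smooth_on ?S (\<lambda>z. vertical_lift A K X (chart_inv (tb_chart A c) z) (tb_chart A c))"
      by (rule smooth_on_cong[OF S smooth_on_Pair[OF S smooth_on_const[OF S] sX]]) (rule lift_chart(2)[OF X, symmetric])
    fix Q assume "Q \<in> tb_over A (fst c)"
    then obtain q y where Q: "Q = (q, y)" "q \<in> fst c" "y \<in> tangent_space A q" by (cases Q) (simp add: mem_tb_over)
    show "vertical_lift A K X Q \<in> tangent_space (tangent_bundle A) Q"
      using vertical_lift_at(1)[OF Q(2,3) smooth_vector_fieldD(1)[OF atlas X Q(2)]] by (simp add: Q(1) vertical_lift_def)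
  qed
qed

context
  fixes p u assumes p: "p \<in> fst c" and u: "u \<in> tangent_space A p"
begin

text \<open>These derivatives are the input for the coordinate brackets. In the bracket of two
  horizontal lifts, differentiating \<open>christoffel\<close> at frozen arguments yields the
  derivative terms of the curvature, and its linear dependence on the fibre coordinate yields the
  quadratic terms.\<close>

lemma lift_chart_derivative:
  assumes X: "smooth_vector_field A (fst c) X"
  defines "DX \<equiv> frechet_derivative (\<lambda>x. X (chart_inv c x) c) (at (snd c p))"
  shows "frechet_derivative (\<lambda>z. horizontal_lift A K X (chart_inv (tb_chart A c) z) (tb_chart A c)) (at (snd c p, u c)) =
      (\<lambda>z. (DX (fst z), - (frechet_derivative (\<lambda>x. christoffel A nab c (chart_inv c x) (X p c) (u c)) (at (snd c p)) (fst z) +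
        christoffel A nab c p (DX (fst z)) (u c) + christoffel A nab c p (X p c) (snd z))))"
    and "frechet_derivative (\<lambda>z. vertical_lift A K X (chart_inv (tb_chart A c) z) (tb_chart A c)) (at (snd c p, u c)) =
      (\<lambda>z. (0, DX (fst z)))"
proof -
  let ?S = "snd c ` fst c \<times> (UNIV :: 'e set)" and ?z = "(snd c p, u c)"
  have z: "?z \<in> ?S" using p by simp
  have x: "snd c p \<in> snd c ` fst c" using p by simp
  have ip: "chart_inv c (snd c p) = p" by (rule chart_inv_left[OF atlas c p])
  have f: "(fst has_derivative fst) (at ?z)" by (rule bounded_linear_imp_has_derivative[OF bounded_linear_fst])
  have s: "(snd has_derivative snd) (at ?z)" by (rule bounded_linear_imp_has_derivative[OF bounded_linear_snd])
  have Xc: "smooth_on (snd c ` fst c) (\<lambda>x. X (chart_inv c x) c)"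
    using smooth_vector_fieldD(2)[OF atlas X c] by simp
  have "((\<lambda>x. X (chart_inv c x) c) has_derivative DX) (at (fst ?z))"
    using smooth_on_has_derivative[OF Xc x] by (simp add: DX_def)
  from has_derivative_compose[OF f this]
  have dX: "((\<lambda>z. X (chart_inv c (fst z)) c) has_derivative (\<lambda>z. DX (fst z))) (at ?z)" .
  have dG: "((\<lambda>z. christoffel A nab c (chart_inv c (fst z)) (X (chart_inv c (fst z)) c) (snd z)) has_derivative
    (\<lambda>a. frechet_derivative (\<lambda>x. christoffel A nab c (chart_inv c x) (X (chart_inv c (fst ?z)) c) (snd ?z)) (at (fst ?z)) (fst a)
      + christoffel A nab c (chart_inv c (fst ?z)) (DX (fst a)) (snd ?z)
      + christoffel A nab c (chart_inv c (fst ?z)) (X (chart_inv c (fst ?z)) c) (snd a))) (at ?z)"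
  proof (rule has_derivative_bilinear_family[where y = ?z and h = fst and \<Gamma> = "\<lambda>x. christoffel A nab c (chart_inv c x)",
        OF open_chart_image[OF atlas c] _ _ _ f dX s])
    show "bilinear (christoffel A nab c (chart_inv c x))" if "x \<in> snd c ` fst c" for x
      by (rule christoffel_bilinear[OF atlas affine c chart_inv_in[OF that]])
    show "(\<lambda>x. christoffel A nab c (chart_inv c x) v w) differentiable at (fst ?z)" for v w
      using smooth_on_differentiable[OF christoffel_smooth[OF atlas affine c] x] by simp
  qed (use p in simp)
  have "((\<lambda>z. horizontal_lift A K X (chart_inv (tb_chart A c) z) (tb_chart A c)) has_derivative
      (\<lambda>z. (DX (fst z), - (frechet_derivative (\<lambda>x. christoffel A nab c (chart_inv c x) (X p c) (u c)) (at (snd c p)) (fst z) +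
        christoffel A nab c p (DX (fst z)) (u c) + christoffel A nab c p (X p c) (snd z))))) (at ?z)"
    by (rule has_derivative_transform_within_open[OF has_derivative_Pair[OF dX has_derivative_minus[OF dG, unfolded fst_conv snd_conv ip]]
          tb_domain_open z]) (rule lift_chart(1)[OF X, symmetric])
  then show "frechet_derivative (\<lambda>z. horizontal_lift A K X (chart_inv (tb_chart A c) z) (tb_chart A c)) (at (snd c p, u c)) =
      (\<lambda>z. (DX (fst z), - (frechet_derivative (\<lambda>x. christoffel A nab c (chart_inv c x) (X p c) (u c)) (at (snd c p)) (fst z) +
        christoffel A nab c p (DX (fst z)) (u c) + christoffel A nab c p (X p c) (snd z))))"
    by (rule frechet_derivative_eq)
  have "((\<lambda>z. vertical_lift A K X (chart_inv (tb_chart A c) z) (tb_chart A c)) has_derivative (\<lambda>z. (0, DX (fst z)))) (at ?z)"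
    by (rule has_derivative_transform_within_open[OF has_derivative_Pair[OF has_derivative_const dX] tb_domain_open z])
      (rule lift_chart(2)[OF X, symmetric])
  then show "frechet_derivative (\<lambda>z. vertical_lift A K X (chart_inv (tb_chart A c) z) (tb_chart A c)) (at (snd c p, u c)) =
      (\<lambda>z. (0, DX (fst z)))"
    by (rule frechet_derivative_eq)
qed

text \<open>Over the chart the function is constant along the fibres, so its derivative sees only
  the projection of the direction to the base.\<close>

lemma directional_derivative_pullback:
  assumes \<xi>: "\<xi> \<in> tangent_space (tangent_bundle A) (p, u)" and G: "smooth_function A (fst c) G"
    and eq: "\<And>Q. Q \<in> tb_over A (fst c) \<Longrightarrow> f Q = m * G (fst Q)"
  shows "directional_derivative (tangent_bundle A) (p, u) \<xi> f = m * directional_derivative A p (d_proj A (p, u) \<xi>) G"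
proof -
  let ?C = "tb_chart A c" and ?z = "(snd c p, u c)"
  have C: "?C \<in> tangent_bundle A" "(p, u) \<in> fst ?C" "snd ?C (p, u) = ?z"
    using c p u by (simp_all add: tangent_bundle_eq fst_tb_chart snd_tb_chart mem_tb_over)
  have z: "?z \<in> snd c ` fst c \<times> UNIV" using p by simp
  have "smooth_on (snd c ` fst c) (G \<circ> chart_inv c)" using G c unfolding smooth_function_def by force
  then have dG: "((G \<circ> chart_inv c) has_derivative frechet_derivative (G \<circ> chart_inv c) (at (snd c p))) (at (snd c p))"
    by (rule smooth_on_has_derivative) (use p in simp)
  have fd: "(fst has_derivative fst) (at ?z)" by (rule bounded_linear_imp_has_derivative[OF bounded_linear_fst])
  have "((\<lambda>z. m * (G \<circ> chart_inv c) (fst z)) has_derivative (\<lambda>z. m * frechet_derivative (G \<circ> chart_inv c) (at (snd c p)) (fst z))) (at ?z)"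
    using has_derivative_compose[OF fd, of "G \<circ> chart_inv c"] dG by (intro has_derivative_mult_right) simp
  then have d: "((f \<circ> chart_inv ?C) has_derivative (\<lambda>z. m * frechet_derivative (G \<circ> chart_inv c) (at (snd c p)) (fst z))) (at ?z)"
  proof (rule has_derivative_transform_within_open[OF _ tb_domain_open z])
    fix y :: "'e \<times> 'e" assume "y \<in> snd c ` fst c \<times> UNIV"
    then have y: "fst y \<in> snd c ` fst c" by auto
    have "chart_inv ?C y = (chart_inv c (fst y), coordinate_field A c (snd y) (chart_inv c (fst y)))"
      using chart_inv_tb[OF atlas c y, of "snd y"] by simp
    then show "m * (G \<circ> chart_inv c) (fst y) = (f \<circ> chart_inv ?C) y"
      using eq[of "chart_inv ?C y"] chart_inv_in[OF y] coordinate_field_tangent[OF atlas c chart_inv_in[OF y]]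
      by (simp add: mem_tb_over)
  qed
  have "directional_derivative (tangent_bundle A) (p, u) \<xi> f = m * frechet_derivative (G \<circ> chart_inv c) (at (snd c p)) (fst (\<xi> ?C))"
    using directional_derivative_chart[OF atlas_tb \<xi> C(1,2), of f] d frechet_derivative_eq[OF d]
    unfolding C(3) by (simp add: differentiableI[OF d])
  also have "frechet_derivative (G \<circ> chart_inv c) (at (snd c p)) (fst (\<xi> ?C)) = directional_derivative A p (d_proj A (p, u) \<xi>) G"
    using directional_derivative_chart[OF atlas d_proj_tangent[OF p u \<xi>] c p differentiableI[OF dG]]
      tb_tangent_chart[OF p u \<xi>] by simp
  finally show ?thesis .
qed

end

end

end

section \<open>The Levi-Civita connection of the lifted metric\<close>

text \<open>The mixed product in the order vertical, horizontal is not listed in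
  \<open>lift_metric\<close>; it follows from the symmetry of both metrics.\<close>

lemma lift_metric_values:
  assumes M: "smooth_manifold A" and riem: "riemannian_metric A g" and lc: "levi_civita_connection A g nab"
    and K: "connection_map A nab K" and riembar: "riemannian_metric (tangent_bundle A) gbar"
    and lift: "lift_metric A g K m1 m2 m3 gbar" and lcbar: "levi_civita_connection (tangent_bundle A) gbar nabbar"
    and c: "c \<in> A" "p \<in> fst c" and u: "u \<in> tangent_space A p" and x: "x \<in> tangent_space A p" and y: "y \<in> tangent_space A p"
  shows "gbar (p, u) (horizontal_lift_at A K (p, u) x) (horizontal_lift_at A K (p, u) y) = m1 * g p x y" "gbar (p, u) (horizontal_lift_at A K (p, u) x) (vertical_lift_at A K (p, u) y) = m2 * g p x y"
    "gbar (p, u) (vertical_lift_at A K (p, u) x) (horizontal_lift_at A K (p, u) y) = m2 * g p x y" "gbar (p, u) (vertical_lift_at A K (p, u) x) (vertical_lift_at A K (p, u) y) = m3 * g p x y"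
proof -
  have atlas: "smooth_atlas A" using M by (simp add: smooth_manifold_def)
  note affine = levi_civita_affine[OF atlas riem lc]
  have p: "p \<in> carrier A" "(p, u) \<in> carrier (tangent_bundle A)"
    using chart_subset_carrier[OF atlas c(1)] c(2) u by (auto simp: carrier_tangent_bundle mem_tb_over)
  have l: "gbar (p, u) (horizontal_lift_at A K (p, u) x) (horizontal_lift_at A K (p, u) y) = m1 * g p x y \<and> gbar (p, u) (horizontal_lift_at A K (p, u) x) (vertical_lift_at A K (p, u) y) = m2 * g p x y \<and> gbar (p, u) (vertical_lift_at A K (p, u) x) (vertical_lift_at A K (p, u) y) = m3 * g p x y"
    if "x \<in> tangent_space A p" "y \<in> tangent_space A p" for x y
    using lift p(2) that unfolding lift_metric_def by blast
  show "gbar (p, u) (horizontal_lift_at A K (p, u) x) (horizontal_lift_at A K (p, u) y) = m1 * g p x y" "gbar (p, u) (horizontal_lift_at A K (p, u) x) (vertical_lift_at A K (p, u) y) = m2 * g p x y" "gbar (p, u) (vertical_lift_at A K (p, u) x) (vertical_lift_at A K (p, u) y) = m3 * g p x y"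
    using l[OF x y] by auto
  show "gbar (p, u) (vertical_lift_at A K (p, u) x) (horizontal_lift_at A K (p, u) y) = m2 * g p x y"
    using l[OF y x] metric_sym[OF smooth_atlas_tangent_bundle[OF atlas] riembar lcbar p(2)
        horizontal_lift_at(1)[OF M affine K c u y] vertical_lift_at(1)[OF M affine K c u x]]
      metric_sym[OF atlas riem lc p(1) x y] by simp
qed

context
  fixes A :: "('a, 'e::euclidean_space) chart set" and g :: "('a, 'e) metric" and nab :: "('a, 'e) connection"
    and K :: "'a \<times> ('a, 'e) tvec \<Rightarrow> ('a \<times> ('a, 'e) tvec, 'e \<times> 'e) tvec \<Rightarrow> ('a, 'e) tvec"
    and gbar :: "('a \<times> ('a, 'e) tvec, 'e \<times> 'e) metric"
    and nabbar :: "('a \<times> ('a, 'e) tvec, 'e \<times> 'e) connection"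
    and m1 m2 m3 :: real and c and p :: 'a and u :: "('a, 'e) tvec"
  assumes M: "smooth_manifold A" and riem: "riemannian_metric A g" and lc: "levi_civita_connection A g nab"
    and K: "connection_map A nab K"
    and riembar: "riemannian_metric (tangent_bundle A) gbar"
    and lift: "lift_metric A g K m1 m2 m3 gbar"
    and lcbar: "levi_civita_connection (tangent_bundle A) gbar nabbar"
    and c: "c \<in> A" "p \<in> fst c" and u: "u \<in> tangent_space A p"
begin

private lemma base_atlas: "smooth_atlas A"
  using M by (simp add: smooth_manifold_def)

private lemmas tb_atlas = smooth_atlas_tangent_bundle[OF base_atlas]

private lemmas base_affine = levi_civita_affine[OF base_atlas riem lc]

private abbreviation (input) "T \<equiv> tangent_space A p"
private abbreviation (input) "H \<equiv> horizontal_lift_at A K (p, u)"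
private abbreviation (input) "V \<equiv> vertical_lift_at A K (p, u)"
private abbreviation (input) "R \<equiv> curvature A nab p"
private abbreviation (input) "hor \<equiv> horizontal_lift A K"
private abbreviation (input) "ver \<equiv> vertical_lift A K"
private abbreviation (input) "field X \<equiv> smooth_vector_field A (fst c) X"

private lemma W: "openin (manifold_topology A) (fst c)"
  by (rule openin_chart[OF base_atlas c(1)])

private lemma W_tb: "openin (manifold_topology (tangent_bundle A)) (tb_over A (fst c))" "(p, u) \<in> tb_over A (fst c)"
  using openin_tb_over[OF base_atlas W] c u by (simp_all add: mem_tb_over)

private lemma p_carrier: "p \<in> carrier A" "(p, u) \<in> carrier (tangent_bundle A)"
  using chart_subset_carrier[OF base_atlas c(1)] c(2) u by (auto simp: carrier_tangent_bundle mem_tb_over)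

private lemmas Hl = horizontal_lift_at[OF M base_affine K c(1) c(2) u]
private lemmas Vl = vertical_lift_at[OF M base_affine K c(1) c(2) u]

private lemma fieldT: "field X \<Longrightarrow> X p \<in> T"
  using smooth_vector_fieldD(1)[OF base_atlas _ c(2)] .

private lemma nabT: "field X \<Longrightarrow> field Y \<Longrightarrow> nab X Y p \<in> T"
  by (rule fieldT[OF connection_smooth[OF base_atlas base_affine W]])

private lemmas RT = curvature_tangent[OF base_atlas riem lc c]

private lemma hor_at: "hor X (p, u) = H (X p)" and ver_at: "ver X (p, u) = V (X p)"
  by (simp_all add: horizontal_lift_def vertical_lift_def)

section \<open>Brackets of lifts\<close>

lemma lie_bracket_tangent_bundle:
  assumes "smooth_vector_field (tangent_bundle A) (tb_over A (fst c)) F"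
    "smooth_vector_field (tangent_bundle A) (tb_over A (fst c)) F'"
    and \<xi>: "\<xi> \<in> tangent_space (tangent_bundle A) (p, u)"
    and eq: "frechet_derivative (\<lambda>z. F' (chart_inv (tb_chart A c) z) (tb_chart A c)) (at (snd c p, u c)) (F (p, u) (tb_chart A c)) -
      frechet_derivative (\<lambda>z. F (chart_inv (tb_chart A c) z) (tb_chart A c)) (at (snd c p, u c)) (F' (p, u) (tb_chart A c)) = \<xi> (tb_chart A c)"
  shows "lie_bracket (tangent_bundle A) F F' (p, u) = \<xi>"
proof -
  have C: "tb_chart A c \<in> tangent_bundle A" "(p, u) \<in> fst (tb_chart A c)"
    using c u by (simp_all add: tangent_bundle_eq fst_tb_chart mem_tb_over)
  show ?thesis
    by (rule tangent_eqI[OF tb_atlas smooth_vector_fieldD(1)[OF tb_atlas lie_bracket_smooth[OF tb_atlas riembar lcbar W_tb(1) assms(1,2)] W_tb(2)] \<xi> C])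
      (simp add: lie_bracket_def C snd_tb_chart eq)
qed

text \<open>Both sides are tangent, so coordinates in the induced chart are compared. The bracket of
  \<open>X\<close> and \<open>Y\<close> is written as a difference of covariant derivatives, in
  which form its terms cancel against those from metric compatibility in the Koszul formula.\<close>

lemma lie_bracket_lifts:
  assumes X: "field X" and Y: "field Y"
  shows "lie_bracket (tangent_bundle A) (hor X) (hor Y) (p, u) = H (nab X Y p - nab Y X p) - V (R (X p) (Y p) u)"
    and "lie_bracket (tangent_bundle A) (hor X) (ver Y) (p, u) = V (nab X Y p)"
    and "lie_bracket (tangent_bundle A) (ver X) (hor Y) (p, u) = - V (nab Y X p)"
    and "lie_bracket (tangent_bundle A) (ver X) (ver Y) (p, u) = 0"
proof -
  note sX = lift_smooth[OF M base_affine K c(1) X] and sY = lift_smooth[OF M base_affine K c(1) Y]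
  note dX = lift_chart_derivative[OF M base_affine K c u X] and dY = lift_chart_derivative[OF M base_affine K c u Y]
  note bil = bilinearD[OF christoffel_bilinear[OF base_atlas base_affine c]]
  note RXY = RT[OF fieldT[OF X] fieldT[OF Y] u]
  note N = nabT[OF X Y] nabT[OF Y X]
  note D = tangent_diff[OF base_atlas N]
  note nc = connection_chart[OF base_atlas base_affine W c(2) c X Y] connection_chart[OF base_atlas base_affine W c(2) c Y X]
  have lin: "linear (frechet_derivative (\<lambda>x. Z (chart_inv c x) c) (at (snd c p)))" if "field Z" for Z
    using smooth_on_has_derivative[OF smooth_vector_fieldD(2)[OF base_atlas that c(1)]] c(2) has_derivative_linear by blast
  note lin0 = linear_0[OF lin[OF X]] linear_0[OF lin[OF Y]]
  have linG: "frechet_derivative (\<lambda>x. christoffel A nab c (chart_inv c x) v w) (at (snd c p)) 0 = 0" for v w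
    using smooth_on_has_derivative[OF christoffel_smooth[OF base_atlas base_affine c(1)]] c(2) has_derivative_linear linear_0 by blast
  have sym: "christoffel A nab c p (Y p c) (X p c) = christoffel A nab c p (X p c) (Y p c)"
    by (rule christoffel_sym[OF base_atlas riem lc c])
  show "lie_bracket (tangent_bundle A) (hor X) (hor Y) (p, u) = H (nab X Y p - nab Y X p) - V (R (X p) (Y p) u)"
    by (rule lie_bracket_tangent_bundle[OF sX(1) sY(1) tangent_diff[OF tb_atlas Hl(1)[OF D] Vl(1)[OF RXY]]])
      (simp add: dX dY hor_at Hl(4) fieldT X Y Hl(4)[OF D] Vl(4)[OF RXY] nc sym bil riemann_chart_def
        curvature_chart[OF base_atlas riem lc c fieldT[OF X] fieldT[OF Y] u])
  show "lie_bracket (tangent_bundle A) (hor X) (ver Y) (p, u) = V (nab X Y p)"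
    by (rule lie_bracket_tangent_bundle[OF sX(1) sY(2) Vl(1)[OF N(1)]])
      (simp add: dX dY hor_at ver_at Hl(4) Vl(4) fieldT X Y Vl(4)[OF N(1)] nc bil lin0 linG)
  show "lie_bracket (tangent_bundle A) (ver X) (hor Y) (p, u) = - V (nab Y X p)"
    by (rule lie_bracket_tangent_bundle[OF sX(2) sY(1) tangent_minus[OF tb_atlas Vl(1)[OF N(2)]]])
      (simp add: dX dY hor_at ver_at Hl(4) Vl(4) fieldT X Y Vl(4)[OF N(2)] nc bil lin0 linG)
  show "lie_bracket (tangent_bundle A) (ver X) (ver Y) (p, u) = 0"
    by (rule lie_bracket_tangent_bundle[OF sX(2) sY(2) tangent_zero[OF tb_atlas]])
      (simp add: dX dY ver_at Vl(4) fieldT X Y lin0 zero_prod_def)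
qed

section \<open>The Koszul formula on lifts and recovery of the two components\<close>

private lemma gbar_fields:
  assumes X: "field X" and Y: "field Y" and Q: "Q \<in> tb_over A (fst c)"
  shows "gbar Q (hor X Q) (hor Y Q) = m1 * g (fst Q) (X (fst Q)) (Y (fst Q))"
    "gbar Q (hor X Q) (ver Y Q) = m2 * g (fst Q) (X (fst Q)) (Y (fst Q))"
    "gbar Q (ver X Q) (hor Y Q) = m2 * g (fst Q) (X (fst Q)) (Y (fst Q))"
    "gbar Q (ver X Q) (ver Y Q) = m3 * g (fst Q) (X (fst Q)) (Y (fst Q))"
  using lift_metric_values[OF M riem lc K riembar lift lcbar c(1), of "fst Q" "snd Q",
      OF _ _ smooth_vector_fieldD(1)[OF base_atlas X] smooth_vector_fieldD(1)[OF base_atlas Y]] Q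
  unfolding horizontal_lift_def vertical_lift_def by (simp_all add: mem_tb_over)

private lemmas gbar_values = lift_metric_values[OF M riem lc K riembar lift lcbar c u]

private lemmas Gsym = metric_sym[OF base_atlas riem lc p_carrier(1)]
private lemmas Gadd = metric_add_left[OF base_atlas riem lc p_carrier(1)]
private lemmas Gdiff = metric_diff_left[OF base_atlas riem lc p_carrier(1)]

text \<open>Only the projection of the direction matters: it is \<open>X p\<close> for the
  horizontal lift, where metric compatibility on the base applies, and 0 for the vertical
  one.\<close>

lemma directional_derivative_lift_metric:
  assumes X: "field X" and Y: "field Y" and Z: "field Z"
    and eq: "\<And>Q. Q \<in> tb_over A (fst c) \<Longrightarrow> f Q = m * g (fst Q) (Y (fst Q)) (Z (fst Q))"
  shows "directional_derivative (tangent_bundle A) (p, u) (H (X p)) f = m * (g p (nab X Y p) (Z p) + g p (nab X Z p) (Y p))"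
    and "directional_derivative (tangent_bundle A) (p, u) (V (X p)) f = 0"
proof -
  note G = smooth_metric_function[OF base_atlas riem lc W Y Z]
  note pull = directional_derivative_pullback[OF M base_affine K c u _ G eq]
  show "directional_derivative (tangent_bundle A) (p, u) (H (X p)) f = m * (g p (nab X Y p) (Z p) + g p (nab X Z p) (Y p))"
    using pull[OF Hl(1)[OF fieldT[OF X]]] metric_compatible[OF base_atlas riem lc W X Y Z c(2)]
      Gsym[OF fieldT[OF Y] nabT[OF X Z]]
    by (simp add: Hl(2)[OF fieldT[OF X]])
  have "smooth_on (snd c ` fst c) ((\<lambda>q. g q (Y q) (Z q)) \<circ> chart_inv c)" using G c(1) unfolding smooth_function_def by force
  then have d: "((\<lambda>q. g q (Y q) (Z q)) \<circ> chart_inv c has_derivative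
      frechet_derivative ((\<lambda>q. g q (Y q) (Z q)) \<circ> chart_inv c) (at (snd c p))) (at (snd c p))"
    by (rule smooth_on_has_derivative) (use c(2) in simp)
  show "directional_derivative (tangent_bundle A) (p, u) (V (X p)) f = 0"
    using pull[OF Vl(1)[OF fieldT[OF X]]] directional_derivative_chart[OF base_atlas tangent_zero[OF base_atlas] c differentiableI[OF d]]
      linear_0[OF has_derivative_linear[OF d]]
    by (simp add: Vl(2)[OF fieldT[OF X]])
qed

private lemma bracket_values:
  assumes X: "field X" and Y: "field Y" and z: "z \<in> T"
  shows "gbar (p, u) (lie_bracket (tangent_bundle A) (hor X) (hor Y) (p, u)) (H z) =
      m1 * (g p (nab X Y p) z - g p (nab Y X p) z) - m2 * g p (R (X p) (Y p) u) z"
    "gbar (p, u) (lie_bracket (tangent_bundle A) (hor X) (hor Y) (p, u)) (V z) =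
      m2 * (g p (nab X Y p) z - g p (nab Y X p) z) - m3 * g p (R (X p) (Y p) u) z"
    "gbar (p, u) (lie_bracket (tangent_bundle A) (hor X) (ver Y) (p, u)) (H z) = m2 * g p (nab X Y p) z"
    "gbar (p, u) (lie_bracket (tangent_bundle A) (hor X) (ver Y) (p, u)) (V z) = m3 * g p (nab X Y p) z"
    "gbar (p, u) (lie_bracket (tangent_bundle A) (ver X) (hor Y) (p, u)) (H z) = - (m2 * g p (nab Y X p) z)"
    "gbar (p, u) (lie_bracket (tangent_bundle A) (ver X) (hor Y) (p, u)) (V z) = - (m3 * g p (nab Y X p) z)"
    "gbar (p, u) (lie_bracket (tangent_bundle A) (ver X) (ver Y) (p, u)) (H z) = 0"
    "gbar (p, u) (lie_bracket (tangent_bundle A) (ver X) (ver Y) (p, u)) (V z) = 0"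
  by (simp_all only: lie_bracket_lifts[OF X Y] gbar_values nabT[OF X Y] nabT[OF Y X]
      tangent_diff[OF base_atlas nabT[OF X Y] nabT[OF Y X]] RT[OF fieldT[OF X] fieldT[OF Y] u] z Hl(1) Vl(1) Gdiff
      metric_diff_left[OF tb_atlas riembar lcbar p_carrier(2)] metric_minus_left[OF tb_atlas riembar lcbar p_carrier(2)]
      metric_zero_left[OF tb_atlas riembar lcbar p_carrier(2)])

text \<open>The Koszul formula delivers curvature terms with the test vector \<open>z\<close> inside
  the curvature. Pair symmetry moves \<open>z\<close> to the outer slot of the metric, and the
  Bianchi identity rewrites \<open>R u y x\<close> as \<open>R u x y + R x y u\<close>.\<close>

private lemma curvature_terms:
  assumes "x \<in> T" "y \<in> T" "z \<in> T"
  shows "g p (R x z u) y = g p (R u x y) z + g p (R x y u) z" "g p (R y z u) x = g p (R u x y) z"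
    "g p (R x z u) y = g p (R u y x) z"
proof -
  note ps = curvature_metric_pair_symmetry[OF base_atlas riem lc c]
  show 1: "g p (R y z u) x = g p (R u x y) z" by (rule ps[OF assms(2,3) u assms(1)])
  show 2: "g p (R x z u) y = g p (R u y x) z" by (rule ps[OF assms(1,3) u assms(2)])
  have "R u x y + R x y u + R y u x = R u y x + R y u x"
    using curvature_bianchi[OF base_atlas riem lc c u assms(1,2)] curvature_skew[OF base_atlas riem lc c u assms(2,1)] by simp
  then have "R u y x = R u x y + R x y u" by (metis add_right_imp_eq)
  then show "g p (R x z u) y = g p (R u x y) z + g p (R x y u) z"
    using 2 Gadd[OF RT[OF u assms(1,2)] RT[OF assms(1,2) u] assms(3)] by simp
qed

text \<open>In the first identity the three brackets contribute curvature; the two occurrences of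
  \<open>R (X p) (Y p) u\<close> cancel and \<open>R u (X p) (Y p)\<close> appears twice, which
  absorbs the factor 2 of the Koszul formula. With one vertical field only one curvature term
  survives, whence the halves; with two or more there is none.\<close>

lemma koszul_lifts:
  assumes X: "field X" and Y: "field Y" and Z: "field Z"
  shows "gbar (p, u) (nabbar (hor X) (hor Y) (p, u)) (H (Z p)) = m1 * g p (nab X Y p) (Z p) + m2 * g p (R u (X p) (Y p)) (Z p)"
    "gbar (p, u) (nabbar (hor X) (hor Y) (p, u)) (V (Z p)) = m2 * g p (nab X Y p) (Z p) - m3 / 2 * g p (R (X p) (Y p) u) (Z p)"
    "gbar (p, u) (nabbar (hor X) (ver Y) (p, u)) (H (Z p)) = m2 * g p (nab X Y p) (Z p) + m3 / 2 * g p (R u (Y p) (X p)) (Z p)"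
    "gbar (p, u) (nabbar (hor X) (ver Y) (p, u)) (V (Z p)) = m3 * g p (nab X Y p) (Z p)"
    "gbar (p, u) (nabbar (ver X) (hor Y) (p, u)) (H (Z p)) = m3 / 2 * g p (R u (X p) (Y p)) (Z p)"
    "gbar (p, u) (nabbar (ver X) (hor Y) (p, u)) (V (Z p)) = 0"
    "gbar (p, u) (nabbar (ver X) (ver Y) (p, u)) (H (Z p)) = 0"
    "gbar (p, u) (nabbar (ver X) (ver Y) (p, u)) (V (Z p)) = 0"
proof -
  note s = lift_smooth[OF M base_affine K c(1)]
  note k = koszul[OF tb_atlas riembar lcbar W_tb]
  have dd: "directional_derivative (tangent_bundle A) (p, u) (H (U p)) (\<lambda>Q. gbar Q (hor V' Q) (hor W' Q)) = m1 * (g p (nab U V' p) (W' p) + g p (nab U W' p) (V' p))"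
    "directional_derivative (tangent_bundle A) (p, u) (H (U p)) (\<lambda>Q. gbar Q (hor V' Q) (ver W' Q)) = m2 * (g p (nab U V' p) (W' p) + g p (nab U W' p) (V' p))"
    "directional_derivative (tangent_bundle A) (p, u) (H (U p)) (\<lambda>Q. gbar Q (ver V' Q) (hor W' Q)) = m2 * (g p (nab U V' p) (W' p) + g p (nab U W' p) (V' p))"
    "directional_derivative (tangent_bundle A) (p, u) (H (U p)) (\<lambda>Q. gbar Q (ver V' Q) (ver W' Q)) = m3 * (g p (nab U V' p) (W' p) + g p (nab U W' p) (V' p))"
    "directional_derivative (tangent_bundle A) (p, u) (V (U p)) (\<lambda>Q. gbar Q (hor V' Q) (hor W' Q)) = 0"
    "directional_derivative (tangent_bundle A) (p, u) (V (U p)) (\<lambda>Q. gbar Q (hor V' Q) (ver W' Q)) = 0"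
    "directional_derivative (tangent_bundle A) (p, u) (V (U p)) (\<lambda>Q. gbar Q (ver V' Q) (hor W' Q)) = 0"
    "directional_derivative (tangent_bundle A) (p, u) (V (U p)) (\<lambda>Q. gbar Q (ver V' Q) (ver W' Q)) = 0"
    if "field U" "field V'" "field W'" for U V' W'
    using directional_derivative_lift_metric[OF that gbar_fields(1)[OF that(2,3)]]
      directional_derivative_lift_metric[OF that gbar_fields(2)[OF that(2,3)]]
      directional_derivative_lift_metric[OF that gbar_fields(3)[OF that(2,3)]]
      directional_derivative_lift_metric[OF that gbar_fields(4)[OF that(2,3)]] by simp_all
  note t = fieldT[OF X] fieldT[OF Y] fieldT[OF Z]
  note simps = hor_at ver_at dd X Y Z bracket_values t
  note ct = curvature_terms[OF t]
  show "gbar (p, u) (nabbar (hor X) (hor Y) (p, u)) (H (Z p)) = m1 * g p (nab X Y p) (Z p) + m2 * g p (R u (X p) (Y p)) (Z p)"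
    using k[OF s(1)[OF X] s(1)[OF Y] s(1)[OF Z]] by (simp only: simps ct(1,2)) (simp add: algebra_simps)
  show "gbar (p, u) (nabbar (hor X) (hor Y) (p, u)) (V (Z p)) = m2 * g p (nab X Y p) (Z p) - m3 / 2 * g p (R (X p) (Y p) u) (Z p)"
    using k[OF s(1)[OF X] s(1)[OF Y] s(2)[OF Z]] by (simp only: simps) (simp add: algebra_simps)
  show "gbar (p, u) (nabbar (hor X) (ver Y) (p, u)) (H (Z p)) = m2 * g p (nab X Y p) (Z p) + m3 / 2 * g p (R u (Y p) (X p)) (Z p)"
    using k[OF s(1)[OF X] s(2)[OF Y] s(1)[OF Z]] by (simp only: simps ct(3)) (simp add: algebra_simps)
  show "gbar (p, u) (nabbar (hor X) (ver Y) (p, u)) (V (Z p)) = m3 * g p (nab X Y p) (Z p)"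
    using k[OF s(1)[OF X] s(2)[OF Y] s(2)[OF Z]] by (simp only: simps) (simp add: algebra_simps)
  show "gbar (p, u) (nabbar (ver X) (hor Y) (p, u)) (H (Z p)) = m3 / 2 * g p (R u (X p) (Y p)) (Z p)"
    using k[OF s(2)[OF X] s(1)[OF Y] s(1)[OF Z]] by (simp only: simps ct(2)) (simp add: algebra_simps)
  show "gbar (p, u) (nabbar (ver X) (hor Y) (p, u)) (V (Z p)) = 0"
    using k[OF s(2)[OF X] s(1)[OF Y] s(2)[OF Z]] by (simp only: simps) (simp add: algebra_simps)
  show "gbar (p, u) (nabbar (ver X) (ver Y) (p, u)) (H (Z p)) = 0"
    using k[OF s(2)[OF X] s(2)[OF Y] s(1)[OF Z]] by (simp only: simps) (simp add: algebra_simps)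
  show "gbar (p, u) (nabbar (ver X) (ver Y) (p, u)) (V (Z p)) = 0"
    using k[OF s(2)[OF X] s(2)[OF Y] s(2)[OF Z]] by (simp only: simps)
qed

text \<open>Pairing with the lifts of one vector gives two linear equations for the inner products
  of the components with that vector. The tests use values \<open>Z p\<close> of fields over the
  chart, and coordinate fields realise every tangent vector as such a value; nondegeneracy of
  \<open>g\<close> then identifies the components.\<close>

lemma tangent_bundle_vector_eqI:
  assumes \<Delta>: "m1 * m3 - m2\<^sup>2 > 0" and \<xi>: "\<xi> \<in> tangent_space (tangent_bundle A) (p, u)" and x: "x \<in> T" and y: "y \<in> T"
    and h: "\<And>Z. field Z \<Longrightarrow> gbar (p, u) \<xi> (H (Z p)) = m1 * g p x (Z p) + m2 * g p y (Z p)"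
    and v: "\<And>Z. field Z \<Longrightarrow> gbar (p, u) \<xi> (V (Z p)) = m2 * g p x (Z p) + m3 * g p y (Z p)"
  shows "d_proj A (p, u) \<xi> = x \<and> K (p, u) \<xi> = y"
proof -
  let ?x = "d_proj A (p, u) \<xi>" and ?y = "K (p, u) \<xi>"
  have xT: "?x \<in> T" and yT: "?y \<in> T"
    using d_proj_tangent[OF M base_affine K c u \<xi>] connection_map_tangent[OF M base_affine K c u \<xi>] by auto
  note b = metric_add_left[OF tb_atlas riembar lcbar p_carrier(2) Hl(1)[OF xT] Vl(1)[OF yT]]
  have eq: "g p ?x z = g p x z \<and> g p ?y z = g p y z" if z: "z \<in> T" for z
  proof -
    let ?Z = "coordinate_field A c (z c)"
    have Z: "smooth_vector_field A (fst c) ?Z" by (rule smooth_coordinate_field[OF base_atlas c(1)])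
    have Zp: "?Z p = z" by (rule coordinate_field_eqI[OF base_atlas c z refl])
    have "gbar (p, u) \<xi> (H z) = m1 * g p ?x z + m2 * g p ?y z"
      by (subst tb_tangent_decompose[OF M base_affine K c u \<xi>]) (simp only: b[OF Hl(1)[OF z]] gbar_values xT yT z)
    then have 1: "m1 * g p ?x z + m2 * g p ?y z = m1 * g p x z + m2 * g p y z" using h[OF Z] by (simp add: Zp)
    have "gbar (p, u) \<xi> (V z) = m2 * g p ?x z + m3 * g p ?y z"
      by (subst tb_tangent_decompose[OF M base_affine K c u \<xi>]) (simp only: b[OF Vl(1)[OF z]] gbar_values xT yT z)
    then have 2: "m2 * g p ?x z + m3 * g p ?y z = m2 * g p x z + m3 * g p y z" using v[OF Z] by (simp add: Zp)
    \<comment> \<open>Cramer's rule: the two equations are combined with the cofactors of the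
      matrix.\<close>
    have "(m1 * m3 - m2\<^sup>2) * (g p ?x z - g p x z) =
        m3 * ((m1 * g p ?x z + m2 * g p ?y z) - (m1 * g p x z + m2 * g p y z)) - m2 * ((m2 * g p ?x z + m3 * g p ?y z) - (m2 * g p x z + m3 * g p y z))"
      "(m1 * m3 - m2\<^sup>2) * (g p ?y z - g p y z) =
        m1 * ((m2 * g p ?x z + m3 * g p ?y z) - (m2 * g p x z + m3 * g p y z)) - m2 * ((m1 * g p ?x z + m2 * g p ?y z) - (m1 * g p x z + m2 * g p y z))"
      by (simp_all add: algebra_simps power2_eq_square)
    then have "(m1 * m3 - m2\<^sup>2) * (g p ?x z - g p x z) = 0" "(m1 * m3 - m2\<^sup>2) * (g p ?y z - g p y z) = 0"
      unfolding 1 2 by simp_all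
    then show ?thesis using \<Delta> by simp
  qed
  show ?thesis
    using metric_eqI[OF base_atlas riem lc p_carrier(1) xT x] metric_eqI[OF base_atlas riem lc p_carrier(1) yT y] eq by blast
qed

end

theorem theorem3p5:
  fixes A :: "('a, 'e::euclidean_space) chart set"
    and g :: "('a, 'e) metric"
    and nab :: "('a, 'e) connection"
    and K :: "'a \<times> ('a, 'e) tvec \<Rightarrow> ('a \<times> ('a, 'e) tvec, 'e \<times> 'e) tvec \<Rightarrow> ('a, 'e) tvec"
    and gbar :: "('a \<times> ('a, 'e) tvec, 'e \<times> 'e) metric"
    and nabbar :: "('a \<times> ('a, 'e) tvec, 'e \<times> 'e) connection"
    and m1 m2 m3 :: real
    and X Y :: "('a, 'e) vfield"
    and p :: 'a and u :: "('a, 'e) tvec"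
  assumes "smooth_manifold A"
    and "riemannian_metric A g"
    and "levi_civita_connection A g nab"
    and "connection_map A nab K"
    and "m1 > 0" and "m3 > 0" and "m1 * m3 - m2\<^sup>2 > 0"
    and "riemannian_metric (tangent_bundle A) gbar"
    and "lift_metric A g K m1 m2 m3 gbar"
    and "levi_civita_connection (tangent_bundle A) gbar nabbar"
    and "smooth_vector_field A (carrier A) X"
    and "smooth_vector_field A (carrier A) Y"
    and "(p, u) \<in> carrier (tangent_bundle A)"
  shows
    "let Xh = horizontal_lift A K X; Xv = vertical_lift A K X;
         Yh = horizontal_lift A K Y; Yv = vertical_lift A K Y;
         R = curvature A nab p; \<Delta> = m1 * m3 - m2\<^sup>2
     in
       d_proj A (p, u) (nabbar Xh Yh (p, u)) =
         nab X Y p + (1 / \<Delta>) *\<^sub>R ((m2 * m3) *\<^sub>R R u (X p) (Y p) + (m2 * m3 / 2) *\<^sub>R R (X p) (Y p) u) \<and>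
       K (p, u) (nabbar Xh Yh (p, u)) =
         (1 / \<Delta>) *\<^sub>R ((- (m2\<^sup>2)) *\<^sub>R R u (X p) (Y p) - (m1 * m3 / 2) *\<^sub>R R (X p) (Y p) u) \<and>
       d_proj A (p, u) (nabbar Xh Yv (p, u)) =
         (1 / \<Delta>) *\<^sub>R ((m3\<^sup>2 / 2) *\<^sub>R R u (Y p) (X p)) \<and>
       K (p, u) (nabbar Xh Yv (p, u)) =
         nab X Y p - (1 / \<Delta>) *\<^sub>R ((m2 * m3 / 2) *\<^sub>R R u (Y p) (X p)) \<and>
       d_proj A (p, u) (nabbar Xv Yh (p, u)) =
         (1 / \<Delta>) *\<^sub>R ((m3\<^sup>2 / 2) *\<^sub>R R u (X p) (Y p)) \<and>
       K (p, u) (nabbar Xv Yh (p, u)) =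
         - ((1 / \<Delta>) *\<^sub>R ((m2 * m3 / 2) *\<^sub>R R u (X p) (Y p))) \<and>
       d_proj A (p, u) (nabbar Xv Yv (p, u)) = 0 \<and>
       K (p, u) (nabbar Xv Yv (p, u)) = 0"
proof -
  have M: "smooth_manifold A" and riem: "riemannian_metric A g" and lc: "levi_civita_connection A g nab"
    and K: "connection_map A nab K" and \<Delta>: "m1 * m3 - m2\<^sup>2 > 0"
    and riembar: "riemannian_metric (tangent_bundle A) gbar" and lift: "lift_metric A g K m1 m2 m3 gbar"
    and lcbar: "levi_civita_connection (tangent_bundle A) gbar nabbar"
    and XA: "smooth_vector_field A (carrier A) X" and YA: "smooth_vector_field A (carrier A) Y"
    and pu: "(p, u) \<in> carrier (tangent_bundle A)"
    by fact+
  have atlas: "smooth_atlas A" using M by (simp add: smooth_manifold_def)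
  note atlas_tb = smooth_atlas_tangent_bundle[OF atlas]
  note affine = levi_civita_affine[OF atlas riem lc]
  have p: "p \<in> carrier A" and u: "u \<in> tangent_space A p" using pu by (simp_all add: carrier_tangent_bundle mem_tb_over)
  obtain c where c: "c \<in> A" "p \<in> fst c" using chart_at[OF atlas p] by blast
  have W: "openin (manifold_topology A) (fst c)" by (rule openin_chart[OF atlas c(1)])
  have W_tb: "openin (manifold_topology (tangent_bundle A)) (tb_over A (fst c))" "(p, u) \<in> tb_over A (fst c)"
    using openin_tb_over[OF atlas W] c u by (simp_all add: mem_tb_over)
  \<comment> \<open>The connections act on total functions and their rules hold over each open set,
    so passing to the chart domain alters none of the vectors in the conclusion.\<close>
  have X: "smooth_vector_field A (fst c) X" and Y: "smooth_vector_field A (fst c) Y"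
    using smooth_vector_field_subset[OF atlas _ chart_subset_carrier[OF atlas c(1)]] XA YA by auto
  have x: "X p \<in> tangent_space A p" and y: "Y p \<in> tangent_space A p"
    using smooth_vector_fieldD(1)[OF atlas _ c(2)] X Y by auto
  have N: "nab X Y p \<in> tangent_space A p"
    by (rule smooth_vector_fieldD(1)[OF atlas connection_smooth[OF atlas affine W X Y] c(2)])
  define R where "R = curvature A nab p"
  define i where "i = 1 / (m1 * m3 - m2\<^sup>2)"
  \<comment> \<open>Inserting this factor into the curvature terms of the Koszul identities turns
    the required equations into polynomial identities in \<open>i\<close>, \<open>m1\<close>,
    \<open>m2\<close> and \<open>m3\<close>.\<close>
  have i: "i * (m1 * m3 - m2\<^sup>2) * t = t" for t using \<Delta> by (simp add: i_def)
  have RT: "R u (X p) (Y p) \<in> tangent_space A p" "R (X p) (Y p) u \<in> tangent_space A p" "R u (Y p) (X p) \<in> tangent_space A p"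
    unfolding R_def using curvature_tangent[OF atlas riem lc c] u x y by auto
  note sX = lift_smooth[OF M affine K c(1) X] and sY = lift_smooth[OF M affine K c(1) Y]
  have T: "nabbar F F' (p, u) \<in> tangent_space (tangent_bundle A) (p, u)"
    if "smooth_vector_field (tangent_bundle A) (tb_over A (fst c)) F" "smooth_vector_field (tangent_bundle A) (tb_over A (fst c)) F'" for F F'
    by (rule smooth_vector_fieldD(1)[OF atlas_tb connection_smooth[OF atlas_tb levi_civita_affine[OF atlas_tb riembar lcbar] W_tb(1) that] W_tb(2)])
  note eqI = tangent_bundle_vector_eqI[OF M riem lc K riembar lift lcbar c u \<Delta>]
  note k = koszul_lifts[OF M riem lc K riembar lift lcbar c u X Y, folded R_def]
  note tan = tangent_add[OF atlas] tangent_diff[OF atlas] tangent_minus[OF atlas] tangent_scaleR[OF atlas]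
    tangent_zero[OF atlas] N RT
  have Zt: "Z p \<in> tangent_space A p" if "smooth_vector_field A (fst c) Z" for Z
    by (rule smooth_vector_fieldD(1)[OF atlas that c(2)])
  note G = metric_add_left[OF atlas riem lc p] metric_diff_left[OF atlas riem lc p] metric_minus_left[OF atlas riem lc p]
    metric_scaleR_left[OF atlas riem lc p] metric_zero_left[OF atlas riem lc p]
  \<comment> \<open>The claimed components are verified against the Koszul pairings: the multiples
    of \<open>R (X p) (Y p) u\<close> cancel in the pairing with horizontal lifts, those of
    \<open>R u (X p) (Y p)\<close> in the pairing with vertical lifts.\<close>
  have hh: "d_proj A (p, u) (nabbar (horizontal_lift A K X) (horizontal_lift A K Y) (p, u)) =
        nab X Y p + i *\<^sub>R ((m2 * m3) *\<^sub>R R u (X p) (Y p) + (m2 * m3 / 2) *\<^sub>R R (X p) (Y p) u) \<and>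
      K (p, u) (nabbar (horizontal_lift A K X) (horizontal_lift A K Y) (p, u)) =
        i *\<^sub>R ((- (m2\<^sup>2)) *\<^sub>R R u (X p) (Y p) - (m1 * m3 / 2) *\<^sub>R R (X p) (Y p) u)"
  proof (rule eqI[OF T[OF sX(1) sY(1)]])
    fix Z assume Z: "smooth_vector_field A (fst c) Z"
    note z = Zt[OF Z]
    show "gbar (p, u) (nabbar (horizontal_lift A K X) (horizontal_lift A K Y) (p, u)) (horizontal_lift_at A K (p, u) (Z p)) =
      m1 * g p (nab X Y p + i *\<^sub>R ((m2 * m3) *\<^sub>R R u (X p) (Y p) + (m2 * m3 / 2) *\<^sub>R R (X p) (Y p) u)) (Z p) +
      m2 * g p (i *\<^sub>R ((- (m2\<^sup>2)) *\<^sub>R R u (X p) (Y p) - (m1 * m3 / 2) *\<^sub>R R (X p) (Y p) u)) (Z p)"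
      unfolding k(1)[OF Z]
      by (subst i[of "m2 * g p (R u (X p) (Y p)) (Z p)", symmetric], simp add: G tan z del: scaleR_minus_left) (simp add: field_simps power2_eq_square)
    show "gbar (p, u) (nabbar (horizontal_lift A K X) (horizontal_lift A K Y) (p, u)) (vertical_lift_at A K (p, u) (Z p)) =
      m2 * g p (nab X Y p + i *\<^sub>R ((m2 * m3) *\<^sub>R R u (X p) (Y p) + (m2 * m3 / 2) *\<^sub>R R (X p) (Y p) u)) (Z p) +
      m3 * g p (i *\<^sub>R ((- (m2\<^sup>2)) *\<^sub>R R u (X p) (Y p) - (m1 * m3 / 2) *\<^sub>R R (X p) (Y p) u)) (Z p)"
      unfolding k(2)[OF Z]
      by (subst i[of "m3 / 2 * g p (R (X p) (Y p) u) (Z p)", symmetric], simp add: G tan z del: scaleR_minus_left) (simp add: field_simps power2_eq_square)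
  qed (intro tan)+
  have hv: "d_proj A (p, u) (nabbar (horizontal_lift A K X) (vertical_lift A K Y) (p, u)) =
        i *\<^sub>R ((m3\<^sup>2 / 2) *\<^sub>R R u (Y p) (X p)) \<and>
      K (p, u) (nabbar (horizontal_lift A K X) (vertical_lift A K Y) (p, u)) =
        nab X Y p - i *\<^sub>R ((m2 * m3 / 2) *\<^sub>R R u (Y p) (X p))"
  proof (rule eqI[OF T[OF sX(1) sY(2)]])
    fix Z assume Z: "smooth_vector_field A (fst c) Z"
    note z = Zt[OF Z]
    show "gbar (p, u) (nabbar (horizontal_lift A K X) (vertical_lift A K Y) (p, u)) (horizontal_lift_at A K (p, u) (Z p)) =
      m1 * g p (i *\<^sub>R ((m3\<^sup>2 / 2) *\<^sub>R R u (Y p) (X p))) (Z p) +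
      m2 * g p (nab X Y p - i *\<^sub>R ((m2 * m3 / 2) *\<^sub>R R u (Y p) (X p))) (Z p)"
      unfolding k(3)[OF Z]
      by (subst i[of "m3 / 2 * g p (R u (Y p) (X p)) (Z p)", symmetric], simp add: G tan z) (simp add: field_simps power2_eq_square)
    show "gbar (p, u) (nabbar (horizontal_lift A K X) (vertical_lift A K Y) (p, u)) (vertical_lift_at A K (p, u) (Z p)) =
      m2 * g p (i *\<^sub>R ((m3\<^sup>2 / 2) *\<^sub>R R u (Y p) (X p))) (Z p) +
      m3 * g p (nab X Y p - i *\<^sub>R ((m2 * m3 / 2) *\<^sub>R R u (Y p) (X p))) (Z p)"
      unfolding k(4)[OF Z]
      by (simp add: G tan z) (simp add: field_simps power2_eq_square)
  qed (intro tan)+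
  have vh: "d_proj A (p, u) (nabbar (vertical_lift A K X) (horizontal_lift A K Y) (p, u)) =
        i *\<^sub>R ((m3\<^sup>2 / 2) *\<^sub>R R u (X p) (Y p)) \<and>
      K (p, u) (nabbar (vertical_lift A K X) (horizontal_lift A K Y) (p, u)) =
        - (i *\<^sub>R ((m2 * m3 / 2) *\<^sub>R R u (X p) (Y p)))"
  proof (rule eqI[OF T[OF sX(2) sY(1)]])
    fix Z assume Z: "smooth_vector_field A (fst c) Z"
    note z = Zt[OF Z]
    show "gbar (p, u) (nabbar (vertical_lift A K X) (horizontal_lift A K Y) (p, u)) (horizontal_lift_at A K (p, u) (Z p)) =
      m1 * g p (i *\<^sub>R ((m3\<^sup>2 / 2) *\<^sub>R R u (X p) (Y p))) (Z p) +
      m2 * g p (- (i *\<^sub>R ((m2 * m3 / 2) *\<^sub>R R u (X p) (Y p)))) (Z p)"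
      unfolding k(5)[OF Z]
      by (subst i[of "m3 / 2 * g p (R u (X p) (Y p)) (Z p)", symmetric], simp add: G tan z) (simp add: field_simps power2_eq_square)
    show "gbar (p, u) (nabbar (vertical_lift A K X) (horizontal_lift A K Y) (p, u)) (vertical_lift_at A K (p, u) (Z p)) =
      m2 * g p (i *\<^sub>R ((m3\<^sup>2 / 2) *\<^sub>R R u (X p) (Y p))) (Z p) +
      m3 * g p (- (i *\<^sub>R ((m2 * m3 / 2) *\<^sub>R R u (X p) (Y p)))) (Z p)"
      unfolding k(6)[OF Z]
      by (simp add: G tan z) (simp add: field_simps power2_eq_square)
  qed (intro tan)+
  have vv: "d_proj A (p, u) (nabbar (vertical_lift A K X) (vertical_lift A K Y) (p, u)) = 0 \<and>
      K (p, u) (nabbar (vertical_lift A K X) (vertical_lift A K Y) (p, u)) = 0"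
    by (rule eqI[OF T[OF sX(2) sY(2)] tangent_zero[OF atlas] tangent_zero[OF atlas]])
      (simp_all only: k(7,8) G(5)[OF Zt] mult_zero_right add_0)
  show ?thesis
    unfolding Let_def R_def[symmetric] i_def[symmetric] using hh hv vh vv by blast
qed

end
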